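(* Let $G\subseteq \mathrm{SL}_2(\mathbb{R})$ be a group and $H$ a finite index subgroup of $G$ such that $-I\in H$ and the images $\bar H,\bar G$ of $H,G$ in $\mathrm{PSL}_2(\mathbb{R})$ are Fuchsian groups of the first kind. Let $\rho:H\to \mathrm{GL}_m(\mathbb{C})$ be any finite dimensional representation, let $\mathbb{X}(\tau)$ be a weakly holomorphic vector-valued automorphic form (vvaf) for $H$ associated to $\rho$, and let $\widetilde\rho=\mathrm{Ind}_H^G(\rho)$. Then: (a) Let $\mathfrak{c}$ be an arbitrary cusp of $G$ and let $\{\mathfrak{c}_i \mid 1\le i\le n_{\mathfrak{c}}\}$ be a set of inequivalent cusps of $\bar H$ for which $\bar G\cdot \mathfrak{c}=\bigcup_{i=1}^{n_{\mathfrak{c}}}\bar H\cdot \mathfrak{c}_i$. For each $i$ let $t_i\in H$ be an element stabilizing $\mathfrak{c}_i$ whose image $\overline{t_i}$ generates the stabilizer subgroup of $\mathfrak{c}_i$ in $\bar H$. If $\rho(t_i)$ is not diagonalizable for some $i$, then $\widetilde\rho(t_{\mathfrak{c}})$ is not diagonalizable. (b) If $\mathbb{X}(\tau)$ is a weakly holomorphic logarithmic vvaf associated with $\rho$, then the lifted form $\widetilde{\mathbb{X}}(\tau)$ is a weakly holomorphic logarithmic vvaf associated with the induced representation $\widetilde\rho$, of the same weight as $\mathbb{X}(\tau)$.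
   Context: **Groups and cusps.** $\mathbb{H}$ is the upper half plane; matrices act by Möbius transformations. A Fuchsian group of the first kind is a discrete subgroup of $\mathrm{PSL}_2(\mathbb{R})$ whose quotient of $\mathbb{H}$ is a Riemann surface with finitely many punctures and which has a fundamental domain of finite area. An element of $\mathrm{SL}_2(\mathbb{R})$ is parabolic if its trace is $\pm2$. A cusp of $G$ (equivalently of $\bar G$) is a point of $\mathbb{R}\cup\{\infty\}$ fixed by a nontrivial parabolic element of $\bar G$; $\mathbb{H}^*_G$ is the union of $\mathbb{H}$ and the cusps of $G$. For a cusp $\mathfrak{c}\neq\infty$ put $A_{\mathfrak{c}}=\begin{pmatrix}\mathfrak{c}&-1\\1&0\end{pmatrix}$, and $A_\infty=I$. The cusp width $h_{\mathfrak{c}}>0$ is the real number such that the stabilizer $\bar G_{\mathfrak{c}}$ is generated by the image of $t_{\mathfrak{c}}=A_{\mathfrak{c}}\begin{pmatrix}1&h_{\mathfrak{c}}\\0&1\end{pmatrix}A_{\mathfrak{c}}^{-1}$. Put $\widetilde q_{\mathfrak{c}}=e^{2\pi i A_{\mathfrak{c}}^{-1}\tau/h_{\mathfrak{c}}}$ and $\log\widetilde q_{\mathfrak{c}}=2\pi i A_{\mathfrak{c}}^{-1}\tau/h_{\mathfrak{c}}$. **Vvafs.** For $\gamma=\begin{pmatrix}a&b\\c&d\end{pmatrix}\in \mathrm{SL}_2(\mathbb{R})$ and $k\in\mathbb{Z}$, $\mathbb{X}|_k\gamma(\tau)=(c\tau+d)^{-k}\mathbb{X}(\gamma\tau)$.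 A representation $\rho$ of $G$ such that all eigenvalues of $\rho(\gamma)$ have absolute value 1 for every parabolic $\gamma\in G$ is called admissible if $\rho(\gamma)$ is diagonalizable for every parabolic $\gamma\in G$, and logarithmic otherwise. A function $\mathbb{X}$ has moderate growth at $\infty$ if $\|\mathbb{X}(\tau)\|<e^{cy}$ for all $y=\mathrm{Im}\,\tau>Y$, for some $c\in\mathbb{R}$, $Y>0$; it has moderate growth at $\mathfrak{c}\in\mathbb{R}$ (with respect to $k$) if $\mathbb{X}|_kA_{\mathfrak{c}}$ has moderate growth at $\infty$. A weakly holomorphic admissible vvaf of weight $k$ associated to an admissible $\rho$ is a holomorphic $\mathbb{X}:\mathbb{H}\to\mathbb{C}^m$ with $\mathbb{X}|_k\gamma=\rho(\gamma)\mathbb{X}$ for all $\gamma\in G$ and moderate growth at all cusps. A weakly holomorphic logarithmic vvaf of weight $k$ associated to a logarithmic $\rho$ (with $\rho(I)=e^{i\pi k}\rho(-I)$) is a holomorphic $\mathbb{X}:\mathbb{H}\to\mathbb{C}^m$ with $\mathbb{X}|_k\gamma=\rho(\gamma)\mathbb{X}$ for all $\gamma\in G$ which at every cusp $\mathfrak{c}$ has an expansion $$\mathbb{X}(\tau)=\epsilon_{\mathfrak{c}}(\tau)\sum_{\lambda}\sum_{j=0}^{m(\lambda)-1}(\log\widetilde q_{\mathfrak{c}})^j\,\widetilde q_{\mathfrak{c}}^{\,\mu(\lambda)}\sum_{n\ge -M_{\mathfrak{c}}}\mathbb{X}^{\mathfrak{c}}[\lambda,j,n]\,\widetilde q_{\mathfrak{c}}^{\,n}$$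 with $M_{\mathfrak{c}}$ finite, where $\epsilon_\infty=1$, $\epsilon_{\mathfrak{c}}(\tau)=(\tau-\mathfrak{c})^{-k}$ for $\mathfrak{c}\ne\infty$, $\lambda$ runs over the eigenvalues of $\rho(t_{\mathfrak{c}})$ attached to its Jordan blocks, $m(\lambda)$ is the size of the block, and $0\le\mu(\lambda)<1$ with $\lambda=e^{2\pi i\mu(\lambda)}$. A weakly holomorphic vvaf is one of either kind. **Induction and lift.** Let $d=[G:H]$. For a cusp $\mathfrak{c}$ of $G$ and cusps $\mathfrak{c}_i$ as in (a), choose $A_i\in G$ with $A_i(\mathfrak{c})=\mathfrak{c}_i$ and let $h_i=[\bar G_{\mathfrak{c}_i}:\bar H_{\mathfrak{c}_i}]$; then $g_{i,j}=t_{\mathfrak{c}}^jA_i^{-1}$ ($1\le i\le n_{\mathfrak{c}}$, $0\le j<h_i$) are representatives of the $d$ left cosets $G/H$. For representatives $\gamma_1,\dots,\gamma_d$ of $G/H$, $\widetilde\rho(\gamma)$ is the $dm\times dm$ matrix whose $(a,b)$ block is $\rho(\gamma_a^{-1}\gamma\gamma_b)$ if $\gamma_a^{-1}\gamma\gamma_b\in H$ and $0$ otherwise. Let $\Delta_G$ be a fixed scalar-valued automorphic form for $G$ (with some rank-one multiplier) of nonzero weight $w_G$, holomorphic on $\mathbb{H}^*_G$, vanishing at the cusp $\infty$ and nonzero everywhere else on $\mathbb{H}^*_G$ up to $G$-equivalence (with $\infty$ replaced by a chosen cusp if $\infty$ is not a cusp of $G$). For $\mathbb{X}$ of weight $k$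 put $\mathbb{X}_0=\Delta_G^{-k/w_G}\mathbb{X}$ (weight $0$) and $$\widetilde{\mathbb{X}}^{(\mathfrak{c})}(\tau)=\Delta_G^{k/w_G}(\tau)\left(\mathbb{X}_0(g_{i,j}^{-1}\tau)\right)^t_{1\le i\le n_{\mathfrak{c}},\,0\le j<h_i}.$$ If $\infty$ is a cusp of $G$, the lifted form is $\widetilde{\mathbb{X}}=\widetilde{\mathbb{X}}^{(\infty)}$. Otherwise one picks a cusp $\mathfrak{c}$ of $G$ and sets $\widetilde{\mathbb{X}}=\widetilde{\mathbb{X}}^{(\mathfrak{c})}|_kA_{\mathfrak{c}}$, regarded as a form for $A_{\mathfrak{c}}^{-1}GA_{\mathfrak{c}}$ with the representation $A_{\mathfrak{c}}^{-1}\gamma A_{\mathfrak{c}}\mapsto\widetilde\rho(\gamma)$.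
   Formalization: In (b) the lifted form is shown to be associated with Dρ̃D⁻¹ rather than the block matrix ρ̃ itself, where D=diag(u(g_{i,j})I_m) and Δ_G^{k/w_G}|_kγ=u(γ)Δ_G^{k/w_G}; this is equivalent to ρ̃ and equals it if u=1 on the g_{i,j}; for nontrivial u the literal claim can fail. *)

theory Defs
  imports
    "HOL-Analysis.Analysis"
    "HOL-Algebra.Generated_Groups"
    "Jordan_Normal_Form.Jordan_Normal_Form"
begin

(* "$" is kept for the entries of the real 2x2 matrices; entries of the vectors and matrices of
   Jordan_Normal_Form, which carry the representations, are written vec_index v i and M $$ (i, j). *)
no_notation vec_index (infixl \<open>$\<close> 100)

section \<open>The groups and their action\<close>

type_synonym mat2 = "real^2^2"

abbreviation I2 :: mat2 where "I2 \<equiv> Finite_Cartesian_Product.mat 1"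

definition SL2R :: "mat2 monoid" where
  "SL2R = \<lparr> carrier = {A. Determinants.det A = 1}, monoid.mult = (**), one = I2 \<rparr>"

definition PSL2R :: "mat2 set monoid" where
  "PSL2R = SL2R Mod {I2, - I2}"

definition psl :: "mat2 \<Rightarrow> mat2 set" where
  "psl A = {I2, - I2} #>\<^bsub>SL2R\<^esub> A"

text \<open>The quotient topology; that this is a topology is checked below.\<close>

definition PSL2R_topology :: "mat2 set topology" where
  "PSL2R_topology = topology (\<lambda>U. U \<subseteq> carrier PSL2R \<and>
     openin (top_of_set (carrier SL2R)) {A \<in> carrier SL2R. psl A \<in> U})"

lemma openin_PSL2R_topology:
  "openin PSL2R_topology U \<longleftrightarrow> U \<subseteq> carrier PSL2R \<and>
     openin (top_of_set (carrier SL2R)) {A \<in> carrier SL2R. psl A \<in> U}"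
proof -
  have "istopology (\<lambda>U. U \<subseteq> carrier PSL2R \<and>
     openin (top_of_set (carrier SL2R)) {A \<in> carrier SL2R. psl A \<in> U})" (is "istopology ?P")
    unfolding istopology_def
  proof (intro conjI allI impI)
    fix S T assume "?P S" "?P T"
    moreover have "{A \<in> carrier SL2R. psl A \<in> S \<inter> T}
        = {A \<in> carrier SL2R. psl A \<in> S} \<inter> {A \<in> carrier SL2R. psl A \<in> T}" by auto
    ultimately show "S \<inter> T \<subseteq> carrier PSL2R"
      and "openin (top_of_set (carrier SL2R)) {A \<in> carrier SL2R. psl A \<in> S \<inter> T}"
      by (auto intro: openin_Int)
  next
    fix K assume K: "\<forall>U\<in>K. ?P U"
    have "{A \<in> carrier SL2R. psl A \<in> \<Union>K} = \<Union>((\<lambda>U. {A \<in> carrier SL2R. psl A \<in> U}) ` K)"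
      by auto
    then show "openin (top_of_set (carrier SL2R)) {A \<in> carrier SL2R. psl A \<in> \<Union>K}"
      using K by (auto intro: openin_Union)
    show "\<Union>K \<subseteq> carrier PSL2R" using K by auto
  qed
  then show ?thesis
    by (simp add: PSL2R_topology_def topology_inverse')
qed

definition UH :: "complex set" where
  "UH = {\<tau>. Im \<tau> > 0}"

definition aut :: "mat2 \<Rightarrow> complex \<Rightarrow> complex" where
  "aut A \<tau> = of_real (A $ 2 $ 1) * \<tau> + of_real (A $ 2 $ 2)"

definition mob :: "mat2 \<Rightarrow> complex \<Rightarrow> complex" where
  "mob A \<tau> = (of_real (A $ 1 $ 1) * \<tau> + of_real (A $ 1 $ 2)) / aut A \<tau>"

datatype boundary = Pt real | Infty

fun act :: "mat2 \<Rightarrow> boundary \<Rightarrow> boundary" where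
  "act A (Pt x) = (if A $ 2 $ 1 * x + A $ 2 $ 2 = 0 then Infty
     else Pt ((A $ 1 $ 1 * x + A $ 1 $ 2) / (A $ 2 $ 1 * x + A $ 2 $ 2)))"
| "act A Infty = (if A $ 2 $ 1 = 0 then Infty else Pt (A $ 1 $ 1 / A $ 2 $ 1))"


section \<open>Fuchsian groups of the first kind\<close>

definition psl_equiv :: "mat2 set set \<Rightarrow> complex \<Rightarrow> complex \<Rightarrow> bool" where
  "psl_equiv P \<tau> \<tau>' \<longleftrightarrow> (\<exists>p\<in>P. \<exists>A\<in>p. mob A \<tau> = \<tau>')"

definition discrete_subgroup :: "mat2 set set \<Rightarrow> bool" where
  "discrete_subgroup P \<longleftrightarrow> subgroup P PSL2R \<and> subtopology PSL2R_topology P = discrete_topology P"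

text \<open>Connected Riemann surfaces, given by a topology and a holomorphic atlas of charts \<open>(U, \<phi>)\<close>.\<close>

definition riemann_surface :: "'a topology \<Rightarrow> ('a set \<times> ('a \<Rightarrow> complex)) set \<Rightarrow> bool" where
  "riemann_surface S \<A> \<longleftrightarrow>
     Hausdorff_space S \<and> connected_space S \<and> (\<Union>(U, \<phi>)\<in>\<A>. U) = topspace S \<and>
     (\<forall>(U, \<phi>)\<in>\<A>. openin S U \<and> open (\<phi> ` U) \<and>
        homeomorphic_map (subtopology S U) (top_of_set (\<phi> ` U)) \<phi>) \<and>
     (\<forall>(U, \<phi>)\<in>\<A>. \<forall>(V, \<psi>)\<in>\<A>. (\<psi> \<circ> inv_into U \<phi>) holomorphic_on \<phi> ` (U \<inter> V))"

text \<open>The quotient of the upper half plane is (biholomorphic to) a compact Riemann surface with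
  finitely many points removed: \<open>\<pi>\<close> is the quotient map. A compact Riemann surface has the
  cardinality of the continuum, so it is no restriction to take its points (with an arbitrary
  abstract topology) from the type \<^typ>\<open>complex\<close>.\<close>

definition finitely_punctured_quotient :: "mat2 set set \<Rightarrow> bool" where
  "finitely_punctured_quotient P \<longleftrightarrow>
     (\<exists>(S :: complex topology) \<A> F \<pi>.
        riemann_surface S \<A> \<and> compact_space S \<and> finite F \<and> F \<subseteq> topspace S \<and>
        \<pi> ` UH = topspace S - F \<and>
        continuous_map (top_of_set UH) S \<pi> \<and>
        (\<forall>(U, \<phi>)\<in>\<A>. (\<phi> \<circ> \<pi>) holomorphic_on {\<tau> \<in> UH. \<pi> \<tau> \<in> U}) \<and>
        (\<forall>\<tau>\<in>UH. \<forall>\<tau>'\<in>UH. \<pi> \<tau> = \<pi> \<tau>' \<longleftrightarrow> psl_equiv P \<tau> \<tau>'))"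

definition fundamental_domain :: "mat2 set set \<Rightarrow> complex set \<Rightarrow> bool" where
  "fundamental_domain P D \<longleftrightarrow>
     open D \<and> connected D \<and> D \<subseteq> UH \<and>
     (\<forall>p\<in>P. \<forall>A\<in>p. p \<noteq> \<one>\<^bsub>PSL2R\<^esub> \<longrightarrow> mob A ` D \<inter> D = {}) \<and>
     (\<forall>\<tau>\<in>UH. \<exists>\<tau>'\<in>closure D. psl_equiv P \<tau> \<tau>') \<and>
     frontier D \<inter> UH \<in> null_sets lebesgue"

definition hyperbolic_area :: "complex set \<Rightarrow> ennreal" where
  "hyperbolic_area D = (\<integral>\<^sup>+\<tau>\<in>D. ennreal (1 / (Im \<tau>)\<^sup>2) \<partial>lborel)"

definition fuchsian_first_kind :: "mat2 set set \<Rightarrow> bool" where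
  "fuchsian_first_kind P \<longleftrightarrow>
     discrete_subgroup P \<and> finitely_punctured_quotient P \<and>
     (\<exists>D. fundamental_domain P D \<and> hyperbolic_area D < \<infinity>)"


section \<open>Cusps\<close>

definition parabolic :: "mat2 \<Rightarrow> bool" where
  "parabolic A \<longleftrightarrow> \<bar>Determinants.trace A\<bar> = 2"

definition is_cusp :: "mat2 set \<Rightarrow> boundary \<Rightarrow> bool" where
  "is_cusp G c \<longleftrightarrow> (\<exists>\<gamma>\<in>G. parabolic \<gamma> \<and> psl \<gamma> \<noteq> \<one>\<^bsub>PSL2R\<^esub> \<and> act \<gamma> c = c)"

definition stab :: "mat2 set \<Rightarrow> boundary \<Rightarrow> mat2 set set" where
  "stab G c = psl ` {\<gamma>\<in>G. act \<gamma> c = c}"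

definition orb :: "mat2 set \<Rightarrow> boundary \<Rightarrow> boundary set" where
  "orb G c = (\<lambda>\<gamma>. act \<gamma> c) ` G"

fun A_cusp :: "boundary \<Rightarrow> mat2" where
  "A_cusp Infty = I2"
| "A_cusp (Pt x) = vector [vector [x, - 1], vector [1, 0]]"

definition transl :: "boundary \<Rightarrow> real \<Rightarrow> mat2" where
  "transl c h = A_cusp c ** vector [vector [1, h], vector [0, 1]] ** inv\<^bsub>SL2R\<^esub> (A_cusp c)"

definition cusp_width :: "mat2 set \<Rightarrow> boundary \<Rightarrow> real" where
  "cusp_width G c = (THE h. h > 0 \<and> generate PSL2R {psl (transl c h)} = stab G c)"

definition t_cusp :: "mat2 set \<Rightarrow> boundary \<Rightarrow> mat2" where
  "t_cusp G c = transl c (cusp_width G c)"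

definition log_q :: "mat2 set \<Rightarrow> boundary \<Rightarrow> complex \<Rightarrow> complex" where
  "log_q G c \<tau> = 2 * of_real pi * \<i> * mob (inv\<^bsub>SL2R\<^esub> (A_cusp c)) \<tau> / of_real (cusp_width G c)"

definition q_cusp :: "mat2 set \<Rightarrow> boundary \<Rightarrow> complex \<Rightarrow> complex" where
  "q_cusp G c \<tau> = exp (log_q G c \<tau>)"


section \<open>Representations\<close>

definition GL :: "nat \<Rightarrow> complex Matrix.mat monoid" where
  "GL m = units_of (ring_mat TYPE(complex) m ())"

definition representation :: "mat2 set \<Rightarrow> nat \<Rightarrow> (mat2 \<Rightarrow> complex Matrix.mat) \<Rightarrow> bool" where
  "representation G m \<rho> \<longleftrightarrow> \<rho> \<in> hom (SL2R\<lparr>carrier := G\<rparr>) (GL m)"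

definition diagonalizable :: "complex Matrix.mat \<Rightarrow> bool" where
  "diagonalizable A \<longleftrightarrow> (\<exists>D. diagonal_mat D \<and> similar_mat A D)"

definition unimodular_at_parabolics :: "mat2 set \<Rightarrow> (mat2 \<Rightarrow> complex Matrix.mat) \<Rightarrow> bool" where
  "unimodular_at_parabolics G \<rho> \<longleftrightarrow>
     (\<forall>\<gamma>\<in>G. parabolic \<gamma> \<longrightarrow> (\<forall>l. eigenvalue (\<rho> \<gamma>) l \<longrightarrow> cmod l = 1))"

definition admissible :: "mat2 set \<Rightarrow> nat \<Rightarrow> (mat2 \<Rightarrow> complex Matrix.mat) \<Rightarrow> bool" where
  "admissible G m \<rho> \<longleftrightarrow> representation G m \<rho> \<and> unimodular_at_parabolics G \<rho> \<and>
     (\<forall>\<gamma>\<in>G. parabolic \<gamma> \<longrightarrow> diagonalizable (\<rho> \<gamma>))"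

definition logarithmic :: "mat2 set \<Rightarrow> nat \<Rightarrow> (mat2 \<Rightarrow> complex Matrix.mat) \<Rightarrow> bool" where
  "logarithmic G m \<rho> \<longleftrightarrow> representation G m \<rho> \<and> unimodular_at_parabolics G \<rho> \<and>
     \<not> (\<forall>\<gamma>\<in>G. parabolic \<gamma> \<longrightarrow> diagonalizable (\<rho> \<gamma>))"


section \<open>Vector-valued automorphic forms\<close>

definition slash :: "int \<Rightarrow> mat2 \<Rightarrow> (complex \<Rightarrow> complex) \<Rightarrow> complex \<Rightarrow> complex" where
  "slash k \<gamma> f \<tau> = aut \<gamma> \<tau> powi (- k) * f (mob \<gamma> \<tau>)"

definition vslash ::
  "int \<Rightarrow> mat2 \<Rightarrow> (complex \<Rightarrow> complex Matrix.vec) \<Rightarrow> complex \<Rightarrow> complex Matrix.vec" where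
  "vslash k \<gamma> X \<tau> = aut \<gamma> \<tau> powi (- k) \<cdot>\<^sub>v X (mob \<gamma> \<tau>)"

definition vnorm :: "complex Matrix.vec \<Rightarrow> real" where
  "vnorm v = L2_set (\<lambda>i. cmod (vec_index v i)) {..<dim_vec v}"

definition moderate_growth_at_infty :: "(complex \<Rightarrow> complex Matrix.vec) \<Rightarrow> bool" where
  "moderate_growth_at_infty X \<longleftrightarrow>
     (\<exists>(c::real) Y. Y > 0 \<and> (\<forall>\<tau>. Im \<tau> > Y \<longrightarrow> vnorm (X \<tau>) < exp (c * Im \<tau>)))"

definition moderate_growth :: "int \<Rightarrow> (complex \<Rightarrow> complex Matrix.vec) \<Rightarrow> boundary \<Rightarrow> bool" where
  "moderate_growth k X c \<longleftrightarrow> moderate_growth_at_infty (vslash k (A_cusp c) X)"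

definition holomorphic_vec :: "nat \<Rightarrow> (complex \<Rightarrow> complex Matrix.vec) \<Rightarrow> bool" where
  "holomorphic_vec m X \<longleftrightarrow> (\<forall>\<tau>\<in>UH. X \<tau> \<in> carrier_vec m) \<and>
     (\<forall>r<m. (\<lambda>\<tau>. vec_index (X \<tau>) r) holomorphic_on UH)"

definition automorphic :: "mat2 set \<Rightarrow> int \<Rightarrow> (mat2 \<Rightarrow> complex Matrix.mat) \<Rightarrow>
    (complex \<Rightarrow> complex Matrix.vec) \<Rightarrow> bool" where
  "automorphic G k \<rho> X \<longleftrightarrow> (\<forall>\<gamma>\<in>G. \<forall>\<tau>\<in>UH. vslash k \<gamma> X \<tau> = \<rho> \<gamma> *\<^sub>v X \<tau>)"

definition wh_admissible_vvaf :: "mat2 set \<Rightarrow> nat \<Rightarrow> int \<Rightarrow> (mat2 \<Rightarrow> complex Matrix.mat) \<Rightarrow>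
    (complex \<Rightarrow> complex Matrix.vec) \<Rightarrow> bool" where
  "wh_admissible_vvaf G m k \<rho> X \<longleftrightarrow>
     admissible G m \<rho> \<and> holomorphic_vec m X \<and> automorphic G k \<rho> X \<and>
     (\<forall>c. is_cusp G c \<longrightarrow> moderate_growth k X c)"

definition mu :: "complex \<Rightarrow> real" where
  "mu l = (THE x. 0 \<le> x \<and> x < 1 \<and> l = exp (2 * of_real pi * \<i> * of_real x))"

fun eps :: "int \<Rightarrow> boundary \<Rightarrow> complex \<Rightarrow> complex" where
  "eps k Infty \<tau> = 1"
| "eps k (Pt x) \<tau> = (\<tau> - of_real x) powi (- k)"

text \<open>\<open>bs\<close> lists the Jordan blocks of \<open>\<rho>(t\<^sub>c)\<close> as pairs of size and eigenvalue;
  \<open>a i j n\<close> is the coefficient vector that belongs to the \<open>i\<close>-th block.\<close>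

definition log_expansion :: "mat2 set \<Rightarrow> nat \<Rightarrow> int \<Rightarrow> (mat2 \<Rightarrow> complex Matrix.mat) \<Rightarrow>
    (complex \<Rightarrow> complex Matrix.vec) \<Rightarrow> boundary \<Rightarrow> bool" where
  "log_expansion G m k \<rho> X c \<longleftrightarrow>
     (\<exists>bs (M::int) (a :: nat \<Rightarrow> nat \<Rightarrow> int \<Rightarrow> complex Matrix.vec).
        jordan_nf (\<rho> (t_cusp G c)) bs \<and> (\<forall>i j n. a i j n \<in> carrier_vec m) \<and>
        (\<forall>\<tau>\<in>UH. \<forall>r<m.
           (\<forall>i<length bs. \<forall>j<fst (bs ! i).
              (\<lambda>n. vec_index (a i j n) r * q_cusp G c \<tau> powi n) summable_on {- M..}) \<and>
           vec_index (X \<tau>) r = eps k c \<tau> *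
             (\<Sum>i<length bs. \<Sum>j<fst (bs ! i).
                log_q G c \<tau> ^ j * exp (of_real (mu (snd (bs ! i))) * log_q G c \<tau>) *
                (\<Sum>\<^sub>\<infinity>n\<in>{- M..}. vec_index (a i j n) r * q_cusp G c \<tau> powi n))))"

definition wh_logarithmic_vvaf :: "mat2 set \<Rightarrow> nat \<Rightarrow> int \<Rightarrow> (mat2 \<Rightarrow> complex Matrix.mat) \<Rightarrow>
    (complex \<Rightarrow> complex Matrix.vec) \<Rightarrow> bool" where
  "wh_logarithmic_vvaf G m k \<rho> X \<longleftrightarrow>
     logarithmic G m \<rho> \<and> \<rho> I2 = exp (\<i> * of_real pi * of_int k) \<cdot>\<^sub>m \<rho> (- I2) \<and>
     holomorphic_vec m X \<and> automorphic G k \<rho> X \<and>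
     (\<forall>c. is_cusp G c \<longrightarrow> log_expansion G m k \<rho> X c)"

definition wh_vvaf :: "mat2 set \<Rightarrow> nat \<Rightarrow> int \<Rightarrow> (mat2 \<Rightarrow> complex Matrix.mat) \<Rightarrow>
    (complex \<Rightarrow> complex Matrix.vec) \<Rightarrow> bool" where
  "wh_vvaf G m k \<rho> X \<longleftrightarrow> wh_admissible_vvaf G m k \<rho> X \<or> wh_logarithmic_vvaf G m k \<rho> X"


section \<open>Induced representation\<close>

definition left_coset_reps :: "mat2 set \<Rightarrow> mat2 set \<Rightarrow> mat2 list \<Rightarrow> bool" where
  "left_coset_reps G H gs \<longleftrightarrow> set gs \<subseteq> G \<and>
     bij_betw (\<lambda>a. gs ! a <#\<^bsub>SL2R\<^esub> H) {..<length gs} ((\<lambda>\<gamma>. \<gamma> <#\<^bsub>SL2R\<^esub> H) ` G)"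

text \<open>The \<open>(a, b)\<close> block consists of the entries \<open>(a m + r, b m + s)\<close> with \<open>r, s < m\<close>.\<close>

definition induced :: "mat2 set \<Rightarrow> nat \<Rightarrow> (mat2 \<Rightarrow> complex Matrix.mat) \<Rightarrow> mat2 list \<Rightarrow>
    mat2 \<Rightarrow> complex Matrix.mat" where
  "induced H m \<rho> gs \<gamma> = Matrix.mat (length gs * m) (length gs * m) (\<lambda>(p, s).
     let h = inv\<^bsub>SL2R\<^esub> (gs ! (p div m)) ** \<gamma> ** (gs ! (s div m))
     in if h \<in> H then \<rho> h $$ (p mod m, s mod m) else 0)"

definition cusp_decomposition ::
  "mat2 set \<Rightarrow> mat2 set \<Rightarrow> boundary \<Rightarrow> nat \<Rightarrow> (nat \<Rightarrow> boundary) \<Rightarrow> bool" where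
  "cusp_decomposition G H c n cs \<longleftrightarrow>
     (\<forall>i<n. is_cusp H (cs i)) \<and>
     (\<forall>i<n. \<forall>j<n. i \<noteq> j \<longrightarrow> cs j \<notin> orb H (cs i)) \<and>
     orb G c = (\<Union>i<n. orb H (cs i))"

definition cusp_coset_reps :: "mat2 set \<Rightarrow> mat2 set \<Rightarrow> boundary \<Rightarrow> nat \<Rightarrow>
    (nat \<Rightarrow> boundary) \<Rightarrow> (nat \<Rightarrow> mat2) \<Rightarrow> mat2 list" where
  "cusp_coset_reps G H c n cs A =
     concat (map (\<lambda>i. map (\<lambda>j. (t_cusp G c [^]\<^bsub>SL2R\<^esub> j) ** inv\<^bsub>SL2R\<^esub> (A i))
        [0..<card (rcosets\<^bsub>PSL2R\<lparr>carrier := stab G (cs i)\<rparr>\<^esub> (stab H (cs i)))]) [0..<n])"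


section \<open>The lift\<close>

definition has_cusp_value :: "int \<Rightarrow> (complex \<Rightarrow> complex) \<Rightarrow> boundary \<Rightarrow> complex \<Rightarrow> bool" where
  "has_cusp_value w f c v \<longleftrightarrow> (slash w (A_cusp c) f \<longlongrightarrow> v) (filtercomap Im at_top)"

text \<open>\<open>\<nu>\<close> is the rank-one multiplier. Holomorphy at a cusp, and vanishing or not vanishing there,
  is expressed by the limit of \<open>\<Delta>|\<^sub>w A\<^sub>c\<close> as the imaginary part tends to infinity.\<close>

definition Delta_form :: "mat2 set \<Rightarrow> boundary \<Rightarrow> int \<Rightarrow> (complex \<Rightarrow> complex) \<Rightarrow> bool" where
  "Delta_form G c0 w \<Delta> \<longleftrightarrow>
     is_cusp G c0 \<and> (is_cusp G Infty \<longrightarrow> c0 = Infty) \<and> w \<noteq> 0 \<and>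
     (\<exists>\<nu>. wh_admissible_vvaf G 1 w \<nu> (\<lambda>\<tau>. Matrix.vec 1 (\<lambda>_. \<Delta> \<tau>))) \<and>
     (\<forall>\<tau>\<in>UH. \<Delta> \<tau> \<noteq> 0) \<and>
     has_cusp_value w \<Delta> c0 0 \<and>
     (\<forall>c. is_cusp G c \<and> c \<notin> orb G c0 \<longrightarrow> (\<exists>v. v \<noteq> 0 \<and> has_cusp_value w \<Delta> c v))"

text \<open>Fractional powers of \<open>\<Delta>\<close> are taken with respect to a holomorphic logarithm \<open>L\<close> of \<open>\<Delta>\<close> on
  the upper half plane: \<open>\<Delta> powr (k/w)\<close> is \<open>exp (k/w * L)\<close>.\<close>

definition is_log_of :: "(complex \<Rightarrow> complex) \<Rightarrow> (complex \<Rightarrow> complex) \<Rightarrow> bool" where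
  "is_log_of L \<Delta> \<longleftrightarrow> L holomorphic_on UH \<and> (\<forall>\<tau>\<in>UH. exp (L \<tau>) = \<Delta> \<tau>)"

definition Delta_power :: "(complex \<Rightarrow> complex) \<Rightarrow> complex \<Rightarrow> complex \<Rightarrow> complex" where
  "Delta_power L s \<tau> = exp (s * L \<tau>)"

definition weight_zero :: "int \<Rightarrow> int \<Rightarrow> (complex \<Rightarrow> complex) \<Rightarrow>
    (complex \<Rightarrow> complex Matrix.vec) \<Rightarrow> complex \<Rightarrow> complex Matrix.vec" where
  "weight_zero k w L X \<tau> = Delta_power L (- of_int k / of_int w) \<tau> \<cdot>\<^sub>v X \<tau>"

definition cusp_lift :: "nat \<Rightarrow> int \<Rightarrow> int \<Rightarrow> (complex \<Rightarrow> complex) \<Rightarrow> mat2 list \<Rightarrow>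
    (complex \<Rightarrow> complex Matrix.vec) \<Rightarrow> complex \<Rightarrow> complex Matrix.vec" where
  "cusp_lift m k w L gs X \<tau> = Delta_power L (of_int k / of_int w) \<tau> \<cdot>\<^sub>v
     Matrix.vec (length gs * m) (\<lambda>p.
       vec_index (weight_zero k w L X (mob (inv\<^bsub>SL2R\<^esub> (gs ! (p div m))) \<tau>)) (p mod m))"

text \<open>With \<open>f = \<Delta> powr (k/w)\<close> and \<open>f|\<^sub>k\<gamma> = u(\<gamma>) f\<close> for \<open>\<gamma> \<in> G\<close>, the \<open>a\<close>-th block of
  the lift of \<open>X\<close> is a constant multiple of \<open>X|\<^sub>k g\<^sub>a\<^sup>-\<^sup>1\<close>, the constant being \<open>u(g\<^sub>a)\<close>. Hence the
  lift transforms under the induced representation written in the basis rescaled blockwise by these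
  constants. This is the induced matrix representation itself when \<open>u\<close> is trivial, and an
  equivalent one in general.\<close>

definition multiplier :: "mat2 set \<Rightarrow> int \<Rightarrow> (complex \<Rightarrow> complex) \<Rightarrow> (mat2 \<Rightarrow> complex) \<Rightarrow> bool" where
  "multiplier G k f u \<longleftrightarrow>
     (\<forall>\<gamma>\<in>G. u \<gamma> \<noteq> 0 \<and> (\<forall>\<tau>\<in>UH. slash k \<gamma> f \<tau> = u \<gamma> * f \<tau>))"

definition rescaled_induced :: "(mat2 \<Rightarrow> complex) \<Rightarrow> mat2 set \<Rightarrow> nat \<Rightarrow>
    (mat2 \<Rightarrow> complex Matrix.mat) \<Rightarrow> mat2 list \<Rightarrow> mat2 \<Rightarrow> complex Matrix.mat" where
  "rescaled_induced u H m \<rho> gs \<gamma> =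
     mat_diag (length gs * m) (\<lambda>p. u (gs ! (p div m))) * induced H m \<rho> gs \<gamma> *
     mat_diag (length gs * m) (\<lambda>p. inverse (u (gs ! (p div m))))"

end

(*
  If t_i in H stabilizes the cusp c_i = B c, then t_i^2 is conjugate in G to a power of t_c, so
  diagonalizability of the induced matrix of t_c passes to that of t_i; the induced matrix of an
  element of H contains a conjugate of its rho-matrix as a direct summand. This gives (a) and, in
  (b), that the induced representation is logarithmic.

  For the expansion of the lift at a cusp c of G, the a-th block of the lift is a constant times
  X |_k g_a^{-1}, and g_a^{-1} maps c to a cusp c' of H. If N is the length of the t_c-orbit of the
  coset g_a H, then g_a t_c' g_a^{-1} = t_c^N, and q_c' pulled back by g_a^{-1} is a constant times
  q_c^{1/N}. Sorting the q_c'-expansion of X by the residue of the exponent modulo N turns an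
  eigenvalue exp(2 pi i mu) of rho(t_c') into the eigenvalues exp(2 pi i (mu + r) / N), r < N, of the
  induced matrix of t_c, and each of these has a Jordan block at least as large as that of rho(t_c').
*)
theory Submission
  imports Defs
    "Jordan_Normal_Form.Jordan_Normal_Form_Existence"
    "Jordan_Normal_Form.Jordan_Normal_Form_Uniqueness"
begin

no_notation vec_index (infixl \<open>$\<close> 100)

section \<open>Real two-by-two matrices\<close>

text \<open>The square in the argument for (a) is forced by a sign: an element of \<open>H\<close>
  fixing a cusp is a translation there only up to sign, and \<open>\<rho> (- I2)\<close> is merely
  an involution. Squaring removes the sign, and an invertible matrix with diagonalizable square is
  diagonalizable.

  The definition of a logarithmic form asks for an expansion along the blocks of some Jordan form,
  but not that every term occurs. They come from explicit chains, produced by the operator (T^N -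
  l^N) / (T - l), and not from a Jordan basis.

  The constants in the blocks of the lift are the multiplier of a fractional power of Delta. The
  ratio of this power to its transform under an element of \<open>G\<close> has a constant w-th
  power, so it is constant because the upper half plane is connected.

  Cusps are handled uniformly by writing B A_c = A_c' U with U upper triangular; the diagonal entry
  alpha of U governs how cusp widths change. As widths are given by a description operator,
  discreteness first has to show that they exist.\<close>

definition mat22 :: "real \<Rightarrow> real \<Rightarrow> real \<Rightarrow> real \<Rightarrow> mat2" where
  "mat22 a b c d = vector [vector [a, b], vector [c, d]]"

lemma mat22_nth [simp]:
  "mat22 a b c d $ 1 $ 1 = a" "mat22 a b c d $ 1 $ 2 = b"
  "mat22 a b c d $ 2 $ 1 = c" "mat22 a b c d $ 2 $ 2 = d"
  by (simp_all add: mat22_def vector_2)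

lemma mat2_eq_iff:
  "A = B \<longleftrightarrow> A $ 1 $ 1 = B $ 1 $ 1 \<and> A $ 1 $ 2 = B $ 1 $ 2 \<and> A $ 2 $ 1 = B $ 2 $ 1 \<and> A $ 2 $ 2 = B $ 2 $ 2"
  for A B :: mat2
  by (auto simp: Finite_Cartesian_Product.vec_eq_iff forall_2)

lemma mat2_mult_nth [simp]:
  "(A ** B) $ i $ j = A $ i $ 1 * B $ 1 $ j + A $ i $ 2 * B $ 2 $ j" for A B :: mat2
  by (simp add: matrix_matrix_mult_def sum_2)

lemma I2_nth [simp]: "I2 $ 1 $ 1 = 1" "I2 $ 1 $ 2 = 0" "I2 $ 2 $ 1 = 0" "I2 $ 2 $ 2 = 1"
  by (simp_all add: Finite_Cartesian_Product.mat_def)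

lemma neg_mult_mat2 [simp]: "(- A) ** B = - (A ** B)" "A ** (- B) = - (A ** B)" for A B :: mat2
  by (simp_all add: mat2_eq_iff)

lemma A_cusp_Pt: "A_cusp (Pt x) = mat22 x (-1) 1 0"
  by (simp add: mat22_def)

lemma SL2R_simps [simp]:
  "x \<otimes>\<^bsub>SL2R\<^esub> y = x ** y" "\<one>\<^bsub>SL2R\<^esub> = I2"
  by (simp_all add: SL2R_def)

lemma SL2R_carrier: "A \<in> carrier SL2R \<longleftrightarrow> A $ 1 $ 1 * A $ 2 $ 2 - A $ 1 $ 2 * A $ 2 $ 1 = 1"
  by (simp add: SL2R_def det_2)

lemma SL2R_one [simp]: "I2 \<in> carrier SL2R"
  by (simp add: SL2R_carrier)

lemma SL2R_mult [simp]: "A \<in> carrier SL2R \<Longrightarrow> B \<in> carrier SL2R \<Longrightarrow> A ** B \<in> carrier SL2R"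
  by (simp add: SL2R_def det_mul)

lemma SL2R_neg [simp]: "- A \<in> carrier SL2R \<longleftrightarrow> A \<in> carrier SL2R"
  by (simp add: SL2R_carrier)

lemma A_cusp_SL2R [simp]: "A_cusp c \<in> carrier SL2R"
  by (cases c) (auto simp: SL2R_carrier vector_2)

lemma group_SL2R: "group SL2R"
proof (rule groupI)
  fix A assume "A \<in> carrier SL2R"
  then show "\<exists>B\<in>carrier SL2R. B \<otimes>\<^bsub>SL2R\<^esub> A = \<one>\<^bsub>SL2R\<^esub>"
    by (intro bexI[of _ "mat22 (A $ 2 $ 2) (- A $ 1 $ 2) (- A $ 2 $ 1) (A $ 1 $ 1)"])
      (auto simp: SL2R_carrier mat2_eq_iff algebra_simps)
qed (auto simp: matrix_mul_assoc)

interpretation SL: group SL2R by (rule group_SL2R)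

abbreviation sinv :: "mat2 \<Rightarrow> mat2" where "sinv A \<equiv> inv\<^bsub>SL2R\<^esub> A"

lemma sinv_eq:
  assumes "A \<in> carrier SL2R"
  shows "sinv A = mat22 (A $ 2 $ 2) (- A $ 1 $ 2) (- A $ 2 $ 1) (A $ 1 $ 1)"
  using assms
  by (intro SL.inv_equality) (auto simp: SL2R_carrier mat2_eq_iff algebra_simps)

lemma sinv_carrier [simp]: "A \<in> carrier SL2R \<Longrightarrow> sinv A \<in> carrier SL2R"
  by (rule SL.inv_closed)

lemma sinv_cancel [simp]:
  assumes "A \<in> carrier SL2R"
  shows "sinv A ** A = I2" "A ** sinv A = I2"
  using SL.l_inv[OF assms] SL.r_inv[OF assms] by simp_all

lemma sinv_cancel_assoc [simp]:
  assumes "A \<in> carrier SL2R"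
  shows "sinv A ** (A ** B) = B" "A ** (sinv A ** B) = B"
    "B ** A ** sinv A = B" "B ** sinv A ** A = B"
  using assms
  by (simp_all add: matrix_mul_assoc) (simp_all add: matrix_mul_assoc[symmetric])

lemma sinv_mult:
  assumes "A \<in> carrier SL2R" "B \<in> carrier SL2R"
  shows "sinv (A ** B) = sinv B ** sinv A"
  using SL.inv_mult_group[OF assms] by simp

lemma sinv_neg: "A \<in> carrier SL2R \<Longrightarrow> sinv (- A) = - sinv A"
  by (simp add: sinv_eq mat2_eq_iff)

lemma sinv_sinv [simp]: "A \<in> carrier SL2R \<Longrightarrow> sinv (sinv A) = A"
  by (rule SL.inv_inv)

lemma sinv_one [simp]: "sinv I2 = I2"
  using SL.inv_one by simp

section \<open>Moebius action on the upper half plane\<close>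

lemma aut_nonzero [simp]:
  assumes "A \<in> carrier SL2R" "\<tau> \<in> UH"
  shows "aut A \<tau> \<noteq> 0"
proof
  assume "aut A \<tau> = 0"
  then have "A $ 2 $ 1 = 0" "A $ 2 $ 2 = 0"
    using assms(2) by (auto simp: aut_def complex_eq_iff UH_def)
  then show False using assms(1) by (simp add: SL2R_carrier)
qed

lemma Im_mob:
  assumes "A \<in> carrier SL2R"
  shows "Im (mob A \<tau>) = Im \<tau> / (cmod (aut A \<tau>))\<^sup>2"
proof -
  have "(A $ 1 $ 1 * Im \<tau>) * (A $ 2 $ 1 * Re \<tau> + A $ 2 $ 2) - (A $ 1 $ 1 * Re \<tau> + A $ 1 $ 2) * (A $ 2 $ 1 * Im \<tau>)
      = (A $ 1 $ 1 * A $ 2 $ 2 - A $ 1 $ 2 * A $ 2 $ 1) * Im \<tau>"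
    by (simp add: algebra_simps)
  also have "\<dots> = Im \<tau>" using assms by (simp add: SL2R_carrier)
  finally show ?thesis
    by (simp add: mob_def aut_def Im_divide cmod_power2 )
qed

lemma mob_UH [simp]:
  assumes "A \<in> carrier SL2R" "\<tau> \<in> UH"
  shows "mob A \<tau> \<in> UH"
  using assms aut_nonzero[OF assms] by (simp add: UH_def Im_mob)

lemma aut_mult:
  assumes "A \<in> carrier SL2R" "B \<in> carrier SL2R" "\<tau> \<in> UH"
  shows "aut (A ** B) \<tau> = aut A (mob B \<tau>) * aut B \<tau>"
  using aut_nonzero[OF assms(2,3)]
  by (simp add: mob_def aut_def[of A] aut_def[of "A ** B"] divide_simps) (simp add: aut_def algebra_simps)

lemma mob_mult:
  assumes "A \<in> carrier SL2R" "B \<in> carrier SL2R" "\<tau> \<in> UH"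
  shows "mob (A ** B) \<tau> = mob A (mob B \<tau>)"
proof -
  have "mob A (mob B \<tau>) = (of_real (A $ 1 $ 1) * mob B \<tau> + of_real (A $ 1 $ 2)) * aut B \<tau> /
      (aut A (mob B \<tau>) * aut B \<tau>)"
    using aut_nonzero[OF assms(2,3)] by (simp add: mob_def[of A])
  also have "(of_real (A $ 1 $ 1) * mob B \<tau> + of_real (A $ 1 $ 2)) * aut B \<tau> =
      of_real ((A ** B) $ 1 $ 1) * \<tau> + of_real ((A ** B) $ 1 $ 2)"
    using aut_nonzero[OF assms(2,3)]
    by (simp add: mob_def[of B] divide_simps) (simp add: aut_def algebra_simps)
  finally show ?thesis by (simp add: mob_def[of "A ** B"] aut_mult assms)
qed

lemma mob_one [simp]: "mob I2 \<tau> = \<tau>" and aut_one [simp]: "aut I2 \<tau> = 1"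
  by (simp_all add: mob_def aut_def)

lemma mob_sinv [simp]:
  assumes "A \<in> carrier SL2R" "\<tau> \<in> UH"
  shows "mob (sinv A) (mob A \<tau>) = \<tau>" "mob A (mob (sinv A) \<tau>) = \<tau>"
  using assms by (simp_all add: mob_mult[symmetric])

lemma slash_mult:
  assumes "A \<in> carrier SL2R" "B \<in> carrier SL2R" "\<tau> \<in> UH"
  shows "slash k (A ** B) f \<tau> = slash k B (slash k A f) \<tau>"
  using assms by (simp add: slash_def mob_mult aut_mult power_int_mult_distrib)

lemma vslash_mult:
  assumes "A \<in> carrier SL2R" "B \<in> carrier SL2R" "\<tau> \<in> UH"
  shows "vslash k (A ** B) X \<tau> = vslash k B (vslash k A X) \<tau>"
  using assms by (simp add: vslash_def mob_mult aut_mult power_int_mult_distrib smult_smult_assoc mult.commute)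

lemma aut_holomorphic [holomorphic_intros]: "aut A holomorphic_on S"
  unfolding aut_def by (intro holomorphic_intros)

lemma mob_holomorphic:
  assumes "A \<in> carrier SL2R"
  shows "mob A holomorphic_on UH"
  unfolding mob_def using assms by (intro holomorphic_intros) auto

lemma slash_holomorphic:
  assumes "A \<in> carrier SL2R" "f holomorphic_on UH"
  shows "slash k A f holomorphic_on UH"
proof -
  have "(f \<circ> mob A) holomorphic_on UH"
    using assms by (intro holomorphic_on_compose_gen[OF mob_holomorphic]) auto
  then show ?thesis
    unfolding slash_def using assms(1) by (intro holomorphic_intros) (auto simp: o_def)
qed

section \<open>Boundary points\<close>

lemma sinv_A_cusp_Pt: "sinv (mat22 x (-1) 1 0) = mat22 0 1 (-1) x"
  by (simp add: sinv_eq SL2R_carrier mat2_eq_iff)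

text \<open>\<open>A_cusp c\<close> sends infinity to c, and a matrix fixes infinity exactly when
  its lower left entry vanishes. This replaces the case distinction between finite points and
  infinity by one algebraic condition.\<close>

lemma act_iff:
  assumes "A \<in> carrier SL2R"
  shows "act A c = c' \<longleftrightarrow> (sinv (A_cusp c') ** A ** A_cusp c) $ 2 $ 1 = 0"
proof -
  \<comment> \<open>Numerator and denominator of the transform of x cannot both vanish, as det A =
    1. This excludes a spurious solution of the cleared equation when x is sent to infinity.\<close>
  have nz: False if "A $ 2 $ 2 + x * A $ 2 $ 1 = 0" "A $ 1 $ 2 + x * A $ 1 $ 1 = 0" for x
  proof -
    have "A $ 1 $ 1 * A $ 2 $ 2 - A $ 1 $ 2 * A $ 2 $ 1
        = A $ 1 $ 1 * (A $ 2 $ 2 + x * A $ 2 $ 1) - (A $ 1 $ 2 + x * A $ 1 $ 1) * A $ 2 $ 1"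
      by (simp add: algebra_simps)
    then show False using that assms by (simp add: SL2R_carrier)
  qed
  show ?thesis
  proof (cases "c = Infty \<or> c' = Infty \<or> act A c = c'")
    case True
    then show ?thesis using assms
      by (cases c; cases c')
        (auto simp: sinv_A_cusp_Pt SL2R_carrier A_cusp_Pt divide_simps algebra_simps
          simp del: A_cusp.simps(2) split: if_splits)
  next
    case False
    then obtain x y where [simp]: "c = Pt x" "c' = Pt y" by (cases c; cases c') auto
    have *: "(sinv (A_cusp c') ** A ** A_cusp c) $ 2 $ 1 =
        y * (A $ 2 $ 2 + x * A $ 2 $ 1) - (A $ 1 $ 2 + x * A $ 1 $ 1)"
      by (simp add: sinv_A_cusp_Pt A_cusp_Pt algebra_simps del: A_cusp.simps(2))
    show ?thesis
    proof (cases "A $ 2 $ 1 * x + A $ 2 $ 2 = 0")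
      case True
      then show ?thesis using nz[of x] unfolding * by (auto simp: algebra_simps)
    next
      case False
      then show ?thesis unfolding * by (auto simp: divide_simps algebra_simps)
    qed
  qed
qed

lemma upper_triangular_SL2R:
  assumes "U \<in> carrier SL2R" "U $ 2 $ 1 = 0"
  obtains \<alpha> \<beta> where "\<alpha> \<noteq> 0" "U = mat22 \<alpha> \<beta> 0 (1 / \<alpha>)"
proof -
  have "U $ 1 $ 1 * U $ 2 $ 2 = 1" using assms by (simp add: SL2R_carrier)
  then show ?thesis
    using assms by (intro that[of "U $ 1 $ 1" "U $ 1 $ 2"]) (auto simp: mat2_eq_iff divide_simps mult.commute)
qed

text \<open>In coordinates that put both c and c' at infinity, \<open>A\<close> becomes the affine
  map sigma -> alpha^2 sigma + alpha beta. All later comparisons of two cusps are made through this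
  pair.\<close>

lemma act_eq_obtain:
  assumes "A \<in> carrier SL2R" "act A c = c'"
  obtains \<alpha> \<beta> where "\<alpha> \<noteq> 0" "A ** A_cusp c = A_cusp c' ** mat22 \<alpha> \<beta> 0 (1 / \<alpha>)"
proof -
  obtain \<alpha> \<beta> where "\<alpha> \<noteq> 0" "sinv (A_cusp c') ** A ** A_cusp c = mat22 \<alpha> \<beta> 0 (1 / \<alpha>)"
    using upper_triangular_SL2R[of "sinv (A_cusp c') ** A ** A_cusp c"] assms
    by (auto simp: act_iff simp del: mat2_mult_nth)
  moreover have "A_cusp c' ** (sinv (A_cusp c') ** A ** A_cusp c) = A ** A_cusp c"
    by (simp add: matrix_mul_assoc[symmetric])
  ultimately show ?thesis using that by metis
qed

text \<open>Reduced by \<open>act_iff\<close> to the product of two upper triangular matrices, so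
  infinity needs no special treatment.\<close>

lemma act_mult:
  assumes "A \<in> carrier SL2R" "B \<in> carrier SL2R"
  shows "act (A ** B) c = act A (act B c)"
proof -
  obtain \<alpha> \<beta> where 1: "\<alpha> \<noteq> 0" "B ** A_cusp c = A_cusp (act B c) ** mat22 \<alpha> \<beta> 0 (1 / \<alpha>)"
    using act_eq_obtain[OF assms(2) refl] .
  obtain \<alpha>' \<beta>' where 2: "\<alpha>' \<noteq> 0"
      "A ** A_cusp (act B c) = A_cusp (act A (act B c)) ** mat22 \<alpha>' \<beta>' 0 (1 / \<alpha>')"
    using act_eq_obtain[OF assms(1) refl] .
  have "sinv (A_cusp (act A (act B c))) ** (A ** B) ** A_cusp c
      = sinv (A_cusp (act A (act B c))) ** A ** (B ** A_cusp c)"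
    by (simp add: matrix_mul_assoc)
  also have "\<dots> = sinv (A_cusp (act A (act B c))) ** (A ** A_cusp (act B c)) ** mat22 \<alpha> \<beta> 0 (1 / \<alpha>)"
    unfolding 1 by (simp add: matrix_mul_assoc)
  also have "\<dots> = mat22 \<alpha>' \<beta>' 0 (1 / \<alpha>') ** mat22 \<alpha> \<beta> 0 (1 / \<alpha>)"
    unfolding 2 by simp
  finally show ?thesis
    using assms by (simp add: act_iff del: mat2_mult_nth) simp
qed

lemma act_one [simp]: "act I2 c = c"
  by (cases c) auto

lemma act_sinv [simp]:
  assumes "A \<in> carrier SL2R"
  shows "act (sinv A) (act A c) = c" "act A (act (sinv A) c) = c"
  using assms by (simp_all add: act_mult[symmetric])

section \<open>Translations at a cusp\<close>

lemma transl_eq: "transl c x = A_cusp c ** mat22 1 x 0 1 ** sinv (A_cusp c)"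
  by (simp add: transl_def mat22_def)

lemma unip_SL2R [simp]: "mat22 1 x 0 1 \<in> carrier SL2R"
  by (simp add: SL2R_carrier)

lemma transl_SL2R [simp]: "transl c x \<in> carrier SL2R"
  by (simp add: transl_eq)

lemma transl_add: "transl c x ** transl c y = transl c (x + y)"
proof -
  have "transl c x ** transl c y = A_cusp c ** (mat22 1 x 0 1 ** mat22 1 y 0 1) ** sinv (A_cusp c)"
    by (simp add: transl_eq matrix_mul_assoc[symmetric])
  also have "mat22 1 x 0 1 ** mat22 1 y 0 1 = mat22 1 (x + y) 0 1"
    by (simp add: mat2_eq_iff)
  finally show ?thesis by (simp add: transl_eq)
qed

lemma unip_0 [simp]: "mat22 1 0 0 1 = I2"
  by (simp add: mat2_eq_iff)

lemma transl_0 [simp]: "transl c 0 = I2"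
  by (simp add: transl_eq)

lemma transl_uminus: "sinv (transl c x) = transl c (- x)"
  using transl_add[of c "-x" x] by (intro SL.inv_equality) auto

lemma transl_pow: "transl c x [^]\<^bsub>SL2R\<^esub> (n::nat) = transl c (of_nat n * x)"
  by (induction n) (auto simp: transl_add algebra_simps)

lemma transl_act [simp]: "act (transl c x) c = c"
  by (simp add: act_iff transl_eq matrix_mul_assoc[symmetric] del: mat2_mult_nth)

lemma transl_inj: "transl c x = transl c y \<longleftrightarrow> x = y"
proof
  assume "transl c x = transl c y"
  then have "sinv (A_cusp c) ** transl c x ** A_cusp c = sinv (A_cusp c) ** transl c y ** A_cusp c"
    by simp
  then have "mat22 1 x 0 1 = mat22 1 y 0 1" by (simp add: transl_eq matrix_mul_assoc[symmetric])
  then show "x = y" by (simp add: mat2_eq_iff)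
qed auto

text \<open>Moved to infinity, the two sides have diagonal entries 1 and -1. It follows that
  \<open>psl\<close> is injective on the translations at a fixed cusp.\<close>

lemma transl_neq_neg: "transl c x \<noteq> - transl c y"
proof
  assume "transl c x = - transl c y"
  then have "sinv (A_cusp c) ** transl c x ** A_cusp c = - (sinv (A_cusp c) ** transl c y ** A_cusp c)"
    by simp
  then have "mat22 1 x 0 1 = - mat22 1 y 0 1" by (simp add: transl_eq matrix_mul_assoc[symmetric])
  then show "False" by (simp add: mat2_eq_iff)
qed

lemma trace_mat2: "Determinants.trace A = A $ 1 $ 1 + A $ 2 $ 2" for A :: mat2
  by (simp add: trace_def sum_2)

lemma trace_conj:
  assumes "B \<in> carrier SL2R"
  shows "Determinants.trace (sinv B ** A ** B) = Determinants.trace A"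
  using assms by (metis matrix_mul_assoc matrix_mul_rid sinv_cancel(2) trace_mul_sym)

lemma parabolic_conj [simp]: "B \<in> carrier SL2R \<Longrightarrow> parabolic (sinv B ** A ** B) \<longleftrightarrow> parabolic A"
  "B \<in> carrier SL2R \<Longrightarrow> parabolic (B ** A ** sinv B) \<longleftrightarrow> parabolic A"
  using trace_conj[of B A] trace_conj[of "sinv B" A] by (auto simp: parabolic_def)

lemma parabolic_transl [simp]: "parabolic (transl c x)"
proof -
  have "parabolic (mat22 1 x 0 1)" by (simp add: parabolic_def trace_mat2)
  then show ?thesis by (simp add: transl_eq)
qed

text \<open>The affine map sigma -> alpha^2 sigma + alpha beta conjugates the translation by x into
  the translation by alpha^2 x. This is the source of every factor \<open>\<alpha>\<^sup>2\<close>
  between cusp widths.\<close>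

lemma transl_conj:
  assumes "\<alpha> \<noteq> 0" "B ** A_cusp c = A_cusp c' ** mat22 \<alpha> \<beta> 0 (1 / \<alpha>)" "B \<in> carrier SL2R"
  shows "B ** transl c x ** sinv B = transl c' (\<alpha>\<^sup>2 * x)"
proof -
  let ?U = "mat22 \<alpha> \<beta> 0 (1 / \<alpha>)"
  have U: "?U \<in> carrier SL2R" using assms(1) by (simp add: SL2R_carrier)
  have "B ** transl c x = A_cusp c' ** (?U ** mat22 1 x 0 1) ** sinv (A_cusp c)"
    by (simp add: transl_eq matrix_mul_assoc assms(2))
  also have "?U ** mat22 1 x 0 1 = mat22 1 (\<alpha>\<^sup>2 * x) 0 1 ** ?U"
    using assms(1) by (simp add: mat2_eq_iff power2_eq_square)
  also have "A_cusp c' ** (mat22 1 (\<alpha>\<^sup>2 * x) 0 1 ** ?U) ** sinv (A_cusp c) =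
    transl c' (\<alpha>\<^sup>2 * x) ** (A_cusp c' ** ?U ** sinv (A_cusp c))"
    by (simp add: transl_eq matrix_mul_assoc[symmetric])
  also have "A_cusp c' ** ?U ** sinv (A_cusp c) = B"
    unfolding assms(2)[symmetric] by simp
  finally show ?thesis using assms by simp
qed

text \<open>By Cayley-Hamilton the traces satisfy t(n+2) = 2 s t(n+1) - t(n), which 2 s^n solves
  because s^2 = 1.\<close>

lemma trace_pow_parabolic:
  assumes "A \<in> carrier SL2R" "Determinants.trace A = 2 * s" "s\<^sup>2 = 1"
  shows "Determinants.trace (A [^]\<^bsub>SL2R\<^esub> (n::nat)) = 2 * s ^ n"
proof -
  have cayley: "A ** A = (2 * s) *\<^sub>R A - I2"
  proof -
    have 1: "A $ 1 $ 1 * A $ 2 $ 2 = 1 + A $ 1 $ 2 * A $ 2 $ 1" "2 * s = A $ 1 $ 1 + A $ 2 $ 2"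
      using assms by (auto simp: SL2R_carrier trace_mat2)
    show ?thesis unfolding 1(2) using 1(1) by (simp add: mat2_eq_iff algebra_simps)
  qed
  show ?thesis
  proof (induction n rule: induct_nat_012)
    case 0
    then show ?case by (simp add: trace_mat2)
  next
    case 1
    then show ?case using assms by simp
  next
    case (ge2 n)
    let ?B = "A [^]\<^bsub>SL2R\<^esub> n"
    have "A [^]\<^bsub>SL2R\<^esub> Suc (Suc n) = ?B ** (A ** A)" by (simp add: matrix_mul_assoc)
    also have "\<dots> = (2 * s) *\<^sub>R (?B ** A) - ?B"
      unfolding cayley by (simp add: mat2_eq_iff algebra_simps)
    finally have "Determinants.trace (A [^]\<^bsub>SL2R\<^esub> Suc (Suc n)) =
        Determinants.trace ((2 * s) *\<^sub>R (?B ** A) - ?B)"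
      by (rule arg_cong)
    also have "\<dots> = 2 * s * Determinants.trace (A [^]\<^bsub>SL2R\<^esub> Suc n) - Determinants.trace ?B"
      by (simp add: trace_mat2 ring_distribs)
    also have "\<dots> = 2 * s ^ Suc (Suc n)"
      unfolding ge2 using assms(3) by (simp add: power2_eq_square)
    finally show ?case .
  qed
qed

lemma parabolic_pow:
  assumes "A \<in> carrier SL2R" "parabolic A"
  shows "parabolic (A [^]\<^bsub>SL2R\<^esub> (n::nat))"
proof -
  define s where "s = Determinants.trace A / 2"
  have "s = 1 \<or> s = -1" using assms(2) unfolding parabolic_def s_def by linarith
  then have "s\<^sup>2 = 1" "\<bar>s\<bar> = 1" by auto
  then show ?thesis
    using trace_pow_parabolic[of A s n] assms(1) by (simp add: parabolic_def s_def abs_mult power_abs)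
qed

section \<open>Jordan normal forms\<close>

lemma jordan_nf_exists_complex:
  assumes "A \<in> carrier_mat n n"
  shows "\<exists>bs. jordan_nf (A :: complex Matrix.mat) bs"
  using jordan_nf_exists[OF assms] char_poly_factorized[OF assms] by blast

text \<open>Multiplication by an invertible matrix keeps the kernel, and from the row echelon form a
  finite basis can be read off.\<close>

lemma (in kernel) finite_kernel_basis_exists: "\<exists>S. finite S \<and> Ker.basis S"
proof -
  define B where "B = gauss_jordan_single A"
  obtain P Q where B: "B = P * A" "P \<in> carrier_mat nr nr" "Q \<in> carrier_mat nr nr" "Q * P = 1\<^sub>m nr"
    "B \<in> carrier_mat nr nc" "row_echelon_form B"
    using gauss_jordan_single[OF A B_def[symmetric]] by blast
  have "mat_kernel B = mat_kernel A"
    unfolding B(1) by (rule mat_kernel_mult_eq[OF A B(2-4)])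
  then show ?thesis
    using find_base_vectors(3)[OF B(6,5)] by (metis List.finite_set)
qed

text \<open>A basis of the smaller kernel stays independent in the larger one and has as many
  elements as its dimension, hence spans it.\<close>

lemma mat_kernel_eq_of_kernel_dim_eq:
  fixes A B :: "'a::field Matrix.mat"
  assumes A: "A \<in> carrier_mat n n" and B: "B \<in> carrier_mat n n"
    and sub: "mat_kernel A \<subseteq> mat_kernel B" and dim: "kernel_dim A = kernel_dim B"
  shows "mat_kernel A = mat_kernel B"
proof -
  interpret KA: kernel n n A by unfold_locales (rule A)
  interpret KB: kernel n n B by unfold_locales (rule B)
  obtain S where S: "finite S" "KA.Ker.basis S" using KA.finite_kernel_basis_exists by blast
  have SA: "S \<subseteq> mat_kernel A" and gen: "KA.Ker.span S = mat_kernel A" and li: "\<not> KA.Ker.lin_dep S"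
    using S(2) unfolding KA.Ker.basis_def by auto
  have SB: "S \<subseteq> mat_kernel B" using SA sub by blast
  have li': "\<not> KB.Ker.lin_dep S" using li KA.lindep_same[OF SA] KB.lindep_same[OF SB] by simp
  obtain S' where "finite S'" "KB.Ker.basis S'" using KB.finite_kernel_basis_exists by blast
  then have fd: "KB.Ker.fin_dim" unfolding KB.Ker.fin_dim_def KB.Ker.basis_def by auto
  have "card S = KB.dim" using KA.Ker.dim_basis[OF S] dim by simp
  then have "KB.Ker.basis S"
    using KB.Ker.dim_li_is_basis[OF fd S(1) SB li'] by simp
  then have "KB.Ker.span S = mat_kernel B" unfolding KB.Ker.basis_def by auto
  then show ?thesis using gen KA.span_same[OF SA] KB.span_same[OF SB] by simp
qed

lemma kernel_dim_cong:
  assumes "A \<in> carrier_mat n n" "B \<in> carrier_mat n n" "mat_kernel A = mat_kernel B"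
  shows "kernel_dim A = kernel_dim B"
  using assms unfolding kernel_dim_def by simp

lemma pow_mat_mult_vec_add:
  assumes "A \<in> carrier_mat n n" "v \<in> carrier_vec n"
  shows "A ^\<^sub>m (i + j) *\<^sub>v v = A ^\<^sub>m i *\<^sub>v (A ^\<^sub>m j *\<^sub>v v)"
  using assms
proof (induction j arbitrary: v)
  case (Suc j)
  have "A ^\<^sub>m (i + Suc j) *\<^sub>v v = A ^\<^sub>m (i + j) *\<^sub>v (A *\<^sub>v v)"
    using Suc.prems by (simp add: assoc_mult_mat_vec[of _ n n _ n])
  also have "\<dots> = A ^\<^sub>m i *\<^sub>v (A ^\<^sub>m j *\<^sub>v (A *\<^sub>v v))"
    using Suc by simp
  also have "A ^\<^sub>m j *\<^sub>v (A *\<^sub>v v) = A ^\<^sub>m Suc j *\<^sub>v v"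
    using Suc.prems by (simp add: assoc_mult_mat_vec[of _ n n _ n])
  finally show ?case .
qed simp

lemma pow_mat_Suc_mult_vec:
  assumes "A \<in> carrier_mat n n" "v \<in> carrier_vec n"
  shows "A ^\<^sub>m Suc k *\<^sub>v v = A *\<^sub>v (A ^\<^sub>m k *\<^sub>v v)"
  using pow_mat_mult_vec_add[OF assms, of 1 k] assms by (simp add: left_mult_one_mat[of _ n n])

lemma mult_mat_zero_vec:
  fixes A :: "'a::comm_ring_1 Matrix.mat"
  shows "A \<in> carrier_mat nr nc \<Longrightarrow> A *\<^sub>v 0\<^sub>v nc = 0\<^sub>v nr"
  by (auto intro!: eq_vecI)

text \<open>If all blocks for \<open>l\<close> had size at most j, the kernels of the j-th and k-th
  powers of T - l would have equal dimension by the block formula, so they would coincide, and v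
  would lie in the smaller one. A single vector thus certifies a large block without any Jordan
  basis.\<close>

lemma jordan_block_size_gt:
  fixes T :: "complex Matrix.mat"
  assumes T: "T \<in> carrier_mat n n" and jnf: "jordan_nf T bs" and v: "v \<in> carrier_vec n"
    and z: "char_matrix T l ^\<^sub>m k *\<^sub>v v = 0\<^sub>v n" and nz: "char_matrix T l ^\<^sub>m j *\<^sub>v v \<noteq> 0\<^sub>v n"
  shows "\<exists>s. (s, l) \<in> set bs \<and> j < s"
proof (rule ccontr)
  assume "\<not> ?thesis"
  then have small: "s \<le> j" if "(s, l) \<in> set bs" for s using that by force
  let ?C = "char_matrix T l"
  have C: "?C \<in> carrier_mat n n" using T by simp
  have zero: "?C ^\<^sub>m i *\<^sub>v 0\<^sub>v n = 0\<^sub>v n" for i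
    using C by auto
  have "j < k"
  proof (rule ccontr)
    assume "\<not> j < k"
    then have "?C ^\<^sub>m j *\<^sub>v v = ?C ^\<^sub>m (j - k) *\<^sub>v (?C ^\<^sub>m k *\<^sub>v v)"
      using pow_mat_mult_vec_add[OF C v, of "j - k" k] by simp
    then show False using z nz zero by simp
  qed
  have "dim_gen_eigenspace T l j = dim_gen_eigenspace T l k"
    unfolding dim_gen_eigenspace[OF jnf] using small \<open>j < k\<close>
    by (intro arg_cong[of _ _ sum_list] map_cong refl) (force simp: min_def)
  then have "kernel_dim (?C ^\<^sub>m j) = kernel_dim (?C ^\<^sub>m k)"
    by (simp add: dim_gen_eigenspace_def)
  moreover have "mat_kernel (?C ^\<^sub>m j) \<subseteq> mat_kernel (?C ^\<^sub>m k)"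
  proof
    fix w assume w: "w \<in> mat_kernel (?C ^\<^sub>m j)"
    then have "w \<in> carrier_vec n" "?C ^\<^sub>m j *\<^sub>v w = 0\<^sub>v n" using mat_kernelD[OF pow_carrier_mat[OF C]] by auto
    then show "w \<in> mat_kernel (?C ^\<^sub>m k)"
      using pow_mat_mult_vec_add[OF C, of w "k - j" j] \<open>j < k\<close> zero
      by (intro mat_kernelI[OF pow_carrier_mat[OF C]]) auto
  qed
  ultimately have "mat_kernel (?C ^\<^sub>m j) = mat_kernel (?C ^\<^sub>m k)"
    using C by (intro mat_kernel_eq_of_kernel_dim_eq) auto
  moreover have "v \<in> mat_kernel (?C ^\<^sub>m k)"
    using v z by (intro mat_kernelI[OF pow_carrier_mat[OF C]])
  ultimately show False
    using nz mat_kernelD[OF pow_carrier_mat[OF C]] by blast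
qed

text \<open>Without such a vector the kernels of the k-th and (k+1)-st powers would agree; but in
  the dimension formula the given block contributes k to one and k + 1 to the other, and no block
  contributes less to the second.\<close>

lemma jordan_chain_exists:
  fixes T :: "complex Matrix.mat"
  assumes T: "T \<in> carrier_mat n n" and jnf: "jordan_nf T bs" and mem: "(Suc k, l) \<in> set bs"
  shows "\<exists>v\<in>carrier_vec n. char_matrix T l ^\<^sub>m Suc k *\<^sub>v v = 0\<^sub>v n \<and> char_matrix T l ^\<^sub>m k *\<^sub>v v \<noteq> 0\<^sub>v n"
proof (rule ccontr)
  assume neg: "\<not> ?thesis"
  let ?C = "char_matrix T l"
  have C: "?C ^\<^sub>m i \<in> carrier_mat n n" for i using T by simp
  have zero: "?C *\<^sub>v 0\<^sub>v n = 0\<^sub>v n" using char_matrix_closed[OF T, of l] by auto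
  have "mat_kernel (?C ^\<^sub>m k) = mat_kernel (?C ^\<^sub>m Suc k)"
  proof (intro equalityI subsetI)
    fix w assume "w \<in> mat_kernel (?C ^\<^sub>m k)"
    then have w: "w \<in> carrier_vec n" "?C ^\<^sub>m k *\<^sub>v w = 0\<^sub>v n" using mat_kernelD[OF C] by auto
    have "?C ^\<^sub>m Suc k *\<^sub>v w = ?C *\<^sub>v (?C ^\<^sub>m k *\<^sub>v w)"
      using pow_mat_mult_vec_add[of ?C n w 1 k] T w by (simp add: left_mult_one_mat[of _ n n])
    then show "w \<in> mat_kernel (?C ^\<^sub>m Suc k)"
      using w zero by (intro mat_kernelI[OF C]) auto
  next
    fix w assume "w \<in> mat_kernel (?C ^\<^sub>m Suc k)"
    then have w: "w \<in> carrier_vec n" "?C ^\<^sub>m Suc k *\<^sub>v w = 0\<^sub>v n" using mat_kernelD[OF C] by blast+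
    then show "w \<in> mat_kernel (?C ^\<^sub>m k)" using neg by (intro mat_kernelI[OF C]) auto
  qed
  then have "kernel_dim (?C ^\<^sub>m k) = kernel_dim (?C ^\<^sub>m Suc k)"
    by (rule kernel_dim_cong[OF C C])
  then have eq: "dim_gen_eigenspace T l k = dim_gen_eigenspace T l (Suc k)"
    by (simp add: dim_gen_eigenspace_def)
  obtain xs ys where bs: "bs = xs @ (Suc k, l) # ys" using split_list[OF mem] by blast
  have "sum_list (map (min k) zs) \<le> sum_list (map (min (Suc k)) zs)" for zs :: "nat list"
    by (rule sum_list_mono) simp
  from this[of "map fst (filter (\<lambda>(n, e). e = l) xs)"] this[of "map fst (filter (\<lambda>(n, e). e = l) ys)"]
  have "dim_gen_eigenspace T l k < dim_gen_eigenspace T l (Suc k)"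
    unfolding dim_gen_eigenspace[OF jnf] by (simp add: bs)
  then show False using eq by simp
qed

section \<open>Diagonalizability as the absence of Jordan chains of length two\<close>

lemma char_matrix_mult_vec:
  assumes "A \<in> carrier_mat n n" "v \<in> carrier_vec n"
  shows "char_matrix A l *\<^sub>v v = A *\<^sub>v v - l \<cdot>\<^sub>v v"
proof -
  have "char_matrix A l *\<^sub>v v = A *\<^sub>v v + (- l) \<cdot>\<^sub>v v"
    unfolding char_matrix_def
    by (rule eq_vecI, insert assms, auto simp: add_scalar_prod_distrib[of _ n])
  also have "\<dots> = A *\<^sub>v v - l \<cdot>\<^sub>v v" using assms by auto
  finally show ?thesis .
qed

lemma jordan_matrix_diagonal:
  assumes "\<And>s l. (s, l) \<in> set bs \<Longrightarrow> s = 1"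
  shows "diagonal_mat (jordan_matrix bs)"
  using assms
proof (induction bs)
  case Nil
  then show ?case by (simp add: diagonal_mat_def jordan_matrix_def)
next
  case (Cons b bs)
  obtain l where [simp]: "b = (1, l)" using Cons.prems by (metis list.set_intros(1) surj_pair)
  have "diagonal_mat (jordan_matrix bs)" using Cons by auto
  then show ?case
    unfolding diagonal_mat_def by (auto simp: jordan_matrix_Cons)
qed

text \<open>The right-hand side forbids a chain v, x = (A - l) v with (A - l) x = 0. In an
  eigenbasis such a chain gives (D_ii - l) v_i = x_i and (D_ii - l) x_i = 0, hence x_i = 0.
  Conversely, the last two nonzero vectors of the chain of a block of size at least 2 violate the
  condition. In this form the property passes easily to blocks, inverses and square roots.\<close>

lemma diagonalizable_iff:
  assumes A: "A \<in> carrier_mat n n"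
  shows "diagonalizable A \<longleftrightarrow> (\<forall>l. \<forall>v\<in>carrier_vec n. \<forall>x\<in>carrier_vec n.
    A *\<^sub>v v = l \<cdot>\<^sub>v v + x \<longrightarrow> A *\<^sub>v x = l \<cdot>\<^sub>v x \<longrightarrow> x = 0\<^sub>v n)"
proof
  assume "diagonalizable A"
  then obtain D P Q where D: "diagonal_mat D" and wit: "similar_mat_wit A D P Q"
    unfolding diagonalizable_def similar_mat_def by blast
  note w = similar_mat_witD2[OF A wit]
  have "Q * A = (Q * P) * D * Q"
    unfolding w(3) using w(5-7) by (simp add: assoc_mult_mat[of _ n n _ n _ n])
  then have QA: "Q * A = D * Q" using w by simp
  have Di: "vec_index (D *\<^sub>v y) i = D $$ (i, i) * vec_index y i" if "y \<in> carrier_vec n" "i < n" for y i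
  proof -
    have "vec_index (D *\<^sub>v y) i = (\<Sum>j = 0..<n. D $$ (i, j) * vec_index y j)"
      using w(5) that by (simp add: scalar_prod_def)
    also have "\<dots> = (\<Sum>j = 0..<n. if j = i then D $$ (i, i) * vec_index y i else 0)"
      using D w(5) that by (intro sum.cong) (auto simp: diagonal_mat_def)
    finally show ?thesis using that by simp
  qed
  show "\<forall>l. \<forall>v\<in>carrier_vec n. \<forall>x\<in>carrier_vec n.
    A *\<^sub>v v = l \<cdot>\<^sub>v v + x \<longrightarrow> A *\<^sub>v x = l \<cdot>\<^sub>v x \<longrightarrow> x = 0\<^sub>v n"
  proof (intro allI ballI impI)
    fix l v x assume v: "v \<in> carrier_vec n" and x: "x \<in> carrier_vec n"
      and Av: "A *\<^sub>v v = l \<cdot>\<^sub>v v + x" and Ax: "A *\<^sub>v x = l \<cdot>\<^sub>v x"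
    have Qc: "Q *\<^sub>v y \<in> carrier_vec n" if "y \<in> carrier_vec n" for y using mult_mat_vec_carrier[OF w(7) that] .
    have DQ: "D *\<^sub>v (Q *\<^sub>v y) = Q *\<^sub>v (A *\<^sub>v y)" if "y \<in> carrier_vec n" for y
      using assoc_mult_mat_vec[OF w(5,7) that] assoc_mult_mat_vec[OF w(7) A that] QA by simp
    have "D *\<^sub>v (Q *\<^sub>v v) = l \<cdot>\<^sub>v (Q *\<^sub>v v) + Q *\<^sub>v x" "D *\<^sub>v (Q *\<^sub>v x) = l \<cdot>\<^sub>v (Q *\<^sub>v x)"
      using v x w(7)
      by (simp_all add: DQ Av Ax mult_add_distrib_mat_vec[of _ n n] mult_mat_vec[of _ n n])
    then have "D $$ (i, i) * vec_index (Q *\<^sub>v v) i = l * vec_index (Q *\<^sub>v v) i + vec_index (Q *\<^sub>v x) i"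
      "D $$ (i, i) * vec_index (Q *\<^sub>v x) i = l * vec_index (Q *\<^sub>v x) i" if "i < n" for i
      using Di[OF Qc[OF v] that] Di[OF Qc[OF x] that] carrier_matD(1)[OF w(7)] that
      by (auto simp del: index_mult_mat_vec)
    then have "vec_index (Q *\<^sub>v x) i = 0" if "i < n" for i
      using that by (metis add_cancel_left_right mult_cancel_right)
    then have "Q *\<^sub>v x = 0\<^sub>v n" using carrier_matD(1)[OF w(7)] by (intro eq_vecI) (auto simp del: index_mult_mat_vec)
    moreover have "P *\<^sub>v (Q *\<^sub>v x) = x"
      using assoc_mult_mat_vec[OF w(6,7) x] w(1) x by simp
    ultimately show "x = 0\<^sub>v n" using mult_mat_zero_vec[OF w(6)] by simp
  qed
next
  assume semi: "\<forall>l. \<forall>v\<in>carrier_vec n. \<forall>x\<in>carrier_vec n.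
    A *\<^sub>v v = l \<cdot>\<^sub>v v + x \<longrightarrow> A *\<^sub>v x = l \<cdot>\<^sub>v x \<longrightarrow> x = 0\<^sub>v n"
  obtain bs where bs: "jordan_nf A bs" using jordan_nf_exists_complex[OF A] by blast
  have "s = 1" if mem: "(s, l) \<in> set bs" for s l
  proof (rule ccontr)
    assume "s \<noteq> 1"
    moreover have "s \<noteq> 0" using bs mem unfolding jordan_nf_def by force
    ultimately obtain k where s: "s = Suc (Suc k)" by (metis One_nat_def not0_implies_Suc)
    let ?C = "char_matrix A l"
    have C: "?C \<in> carrier_mat n n" using A by simp
    obtain v where v: "v \<in> carrier_vec n" "?C ^\<^sub>m Suc (Suc k) *\<^sub>v v = 0\<^sub>v n" "?C ^\<^sub>m Suc k *\<^sub>v v \<noteq> 0\<^sub>v n"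
      using jordan_chain_exists[OF A bs mem[unfolded s]] by blast
    have Cv: "?C ^\<^sub>m i *\<^sub>v v \<in> carrier_vec n" for i using mult_mat_vec_carrier[OF pow_carrier_mat[OF C] v(1)] .
    have step: "?C ^\<^sub>m Suc i *\<^sub>v v = A *\<^sub>v (?C ^\<^sub>m i *\<^sub>v v) - l \<cdot>\<^sub>v (?C ^\<^sub>m i *\<^sub>v v)" for i
      unfolding pow_mat_Suc_mult_vec[OF C v(1)] by (rule char_matrix_mult_vec[OF A Cv])
    have minus: "y = l \<cdot>\<^sub>v x + (y - l \<cdot>\<^sub>v x)" if "x \<in> carrier_vec n" "y \<in> carrier_vec n" for x y :: "complex Matrix.vec"
      using that by (intro eq_vecI) auto
    have 1: "A *\<^sub>v (?C ^\<^sub>m i *\<^sub>v v) = l \<cdot>\<^sub>v (?C ^\<^sub>m i *\<^sub>v v) + ?C ^\<^sub>m Suc i *\<^sub>v v" for i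
      unfolding step by (rule minus[OF Cv mult_mat_vec_carrier[OF A Cv]])
    from 1[of "Suc k"] have 2: "A *\<^sub>v (?C ^\<^sub>m Suc k *\<^sub>v v) = l \<cdot>\<^sub>v (?C ^\<^sub>m Suc k *\<^sub>v v)"
      unfolding v(2) using Cv[of "Suc k"] by (metis right_zero_vec smult_carrier_vec)
    have "?C ^\<^sub>m Suc k *\<^sub>v v = 0\<^sub>v n" using semi Cv 1[of k] 2 by blast
    then show False using v(3) by simp
  qed
  then show "diagonalizable A"
    using bs jordan_matrix_diagonal unfolding diagonalizable_def jordan_nf_def by blast
qed

lemma diagonalizable_similar:
  assumes "similar_mat A B" "diagonalizable B"
  shows "diagonalizable A"
  using assms similar_mat_trans unfolding diagonalizable_def by blast

text \<open>A chain of length two for \<open>B\<close> at \<open>l\<close> is turned into one for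
  its inverse \<open>A\<close> at 1 / l. It serves for negative powers of the generator at a
  cusp.\<close>

lemma diagonalizable_inverse:
  assumes A: "A \<in> carrier_mat n n" and B: "B \<in> carrier_mat n n" and AB: "A * B = 1\<^sub>m n"
    and diag: "diagonalizable A"
  shows "diagonalizable B"
  unfolding diagonalizable_iff[OF B]
proof (intro allI ballI impI)
  fix l v x assume v: "v \<in> carrier_vec n" and x: "x \<in> carrier_vec n"
    and Bv: "B *\<^sub>v v = l \<cdot>\<^sub>v v + x" and Bx: "B *\<^sub>v x = l \<cdot>\<^sub>v x"
  have AB': "A *\<^sub>v (B *\<^sub>v y) = y" if "y \<in> carrier_vec n" for y
    using assoc_mult_mat_vec[OF A B that] AB that by simp
  have Av: "A *\<^sub>v v \<in> carrier_vec n" and Ax: "A *\<^sub>v x \<in> carrier_vec n" using A v x by auto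
  have lAx: "l \<cdot>\<^sub>v (A *\<^sub>v x) = x" using AB'[OF x] mult_mat_vec[OF A x, of l] by (simp add: Bx)
  have lAv: "l \<cdot>\<^sub>v (A *\<^sub>v v) + A *\<^sub>v x = v"
    using AB'[OF v] v x mult_mat_vec[OF A v, of l] mult_add_distrib_mat_vec[OF A, of "l \<cdot>\<^sub>v v" x] by (simp add: Bv)
  show "x = 0\<^sub>v n"
  proof (cases "l = 0")
    case True
    have "0 \<cdot>\<^sub>v y = 0\<^sub>v n" if "y \<in> carrier_vec n" for y :: "complex Matrix.vec"
      using that by (auto intro!: eq_vecI)
    then show ?thesis using lAx Ax True by simp
  next
    case False
    have Ax': "A *\<^sub>v x = inverse l \<cdot>\<^sub>v x"
      using arg_cong[OF lAx, of "smult_vec (inverse l)"] False by (simp add: smult_smult_assoc)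
    \<comment> \<open>From (l + N)^-1 = l^-1 - l^-2 N on a chain of length two, where N v =
      x.\<close>
    define y where "y = (- inverse l * inverse l) \<cdot>\<^sub>v x"
    have y: "y \<in> carrier_vec n" using x by (simp add: y_def)
    have "A *\<^sub>v v = inverse l \<cdot>\<^sub>v (v - A *\<^sub>v x)"
      using False Av Ax by (subst lAv[symmetric]) (auto intro!: eq_vecI simp del: index_mult_mat_vec)
    also have "\<dots> = inverse l \<cdot>\<^sub>v v + y"
      unfolding Ax' y_def using v x by (intro eq_vecI) (auto simp: algebra_simps)
    finally have "A *\<^sub>v v = inverse l \<cdot>\<^sub>v v + y" .
    moreover have "A *\<^sub>v y = inverse l \<cdot>\<^sub>v y"
      unfolding y_def mult_mat_vec[OF A x] Ax' by (simp add: smult_smult_assoc mult.assoc)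
    ultimately have "y = 0\<^sub>v n" using diag v y unfolding diagonalizable_iff[OF A] by blast
    then have y0: "vec_index y i = vec_index (0\<^sub>v n) i" for i by simp
    have "vec_index x i = 0" if "i < n" for i using y0[of i] that x False by (simp add: y_def)
    then show ?thesis using x by (intro eq_vecI) auto
  qed
qed

text \<open>On a chain of length two (l + N)^2 = l^2 + 2 l N, so A^2 has a chain with second vector
  2 l x. For l = 0 the left inverse \<open>B\<close> already forces x = 0.\<close>

lemma diagonalizable_of_square:
  assumes A: "A \<in> carrier_mat n n" and B: "B \<in> carrier_mat n n" and BA: "B * A = 1\<^sub>m n"
    and diag: "diagonalizable (A * A)"
  shows "diagonalizable A"
  unfolding diagonalizable_iff[OF A]
proof (intro allI ballI impI)
  fix l v x assume v: "v \<in> carrier_vec n" and x: "x \<in> carrier_vec n"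
    and Av: "A *\<^sub>v v = l \<cdot>\<^sub>v v + x" and Ax: "A *\<^sub>v x = l \<cdot>\<^sub>v x"
  have AA: "A * A *\<^sub>v y = A *\<^sub>v (A *\<^sub>v y)" if "y \<in> carrier_vec n" for y
    by (rule assoc_mult_mat_vec[OF A A that])
  define y where "y = (2 * l) \<cdot>\<^sub>v x"
  have y: "y \<in> carrier_vec n" using x by (simp add: y_def)
  have "A * A *\<^sub>v v = l \<cdot>\<^sub>v (l \<cdot>\<^sub>v v + x) + l \<cdot>\<^sub>v x"
    unfolding AA[OF v] Av using v x mult_add_distrib_mat_vec[OF A, of "l \<cdot>\<^sub>v v" x] mult_mat_vec[OF A v, of l]
    by (simp add: Av Ax)
  also have "\<dots> = (l * l) \<cdot>\<^sub>v v + y"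
    using v x by (intro eq_vecI) (auto simp: y_def algebra_simps)
  finally have "A * A *\<^sub>v v = (l * l) \<cdot>\<^sub>v v + y" .
  moreover have "A * A *\<^sub>v y = (l * l) \<cdot>\<^sub>v y"
    unfolding AA[OF y] using mult_mat_vec[OF A x]
    by (simp add: y_def Ax smult_smult_assoc mult_ac)
  ultimately have "y = 0\<^sub>v n"
    using diag v y unfolding diagonalizable_iff[OF mult_carrier_mat[OF A A]] by blast
  then have y0: "vec_index y i = vec_index (0\<^sub>v n) i" for i by simp
  show "x = 0\<^sub>v n"
  proof (cases "l = 0")
    case True
    have "x = B *\<^sub>v (A *\<^sub>v x)" using assoc_mult_mat_vec[OF B A x] BA x by simp
    also have "A *\<^sub>v x = 0\<^sub>v n" unfolding Ax True using x by (auto intro!: eq_vecI)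
    finally show ?thesis using mult_mat_zero_vec[OF B] by simp
  next
    case False
    have "vec_index x i = 0" if "i < n" for i using y0[of i] that x False by (simp add: y_def)
    then show ?thesis using x by (intro eq_vecI) auto
  qed
qed

lemma diagonalizable_pow:
  assumes "diagonalizable A"
  shows "diagonalizable (A ^\<^sub>m k)"
proof -
  obtain D P Q where D: "diagonal_mat D" and wit: "similar_mat_wit A D P Q"
    using assms unfolding diagonalizable_def similar_mat_def by blast
  obtain n where Dc: "D \<in> carrier_mat n n" using similar_mat_witD[OF refl wit] by blast
  have "diagonal_mat (D ^\<^sub>m k)"
  proof (induction k)
    case 0
    then show ?case using Dc by (auto simp: diagonal_mat_def)
  next
    case (Suc k)
    have Dk: "D ^\<^sub>m k \<in> carrier_mat n n" using Dc by simp
    have "(D ^\<^sub>m k) $$ (i, x) * D $$ (x, j) = 0" if "i < n" "j < n" "i \<noteq> j" "x < n" for i j x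
      using that Dc Dk Suc D by (cases "x = j") (auto simp: diagonal_mat_def)
    then have "(D ^\<^sub>m k * D) $$ (i, j) = 0" if "i < n" "j < n" "i \<noteq> j" for i j
      using that Dc Dk by (auto simp: scalar_prod_def intro!: sum.neutral)
    then show ?case using Dc by (auto simp: diagonal_mat_def)
  qed
  then show ?thesis
    using similar_mat_wit_pow[OF wit] unfolding diagonalizable_def similar_mat_def by blast
qed

section \<open>Logarithmic q-series\<close>

lemma mu_exp:
  assumes "0 \<le> x" "x < 1"
  shows "mu (exp (2 * of_real pi * \<i> * of_real x)) = x"
proof -
  have "y = x" if y: "0 \<le> y" "y < 1" "exp (2 * of_real pi * \<i> * of_real x) = exp (2 * of_real pi * \<i> * of_real y)" for y
  proof -
    obtain n :: int where "2 * of_real pi * \<i> * of_real x = 2 * of_real pi * \<i> * of_real y + of_int (2 * n) * (of_real pi * \<i>)"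
      using y(3) unfolding exp_eq by (auto simp: mult.assoc)
    then have "2 * of_real pi * \<i> * of_real x = 2 * of_real pi * \<i> * (of_real (y + of_int n) :: complex)"
      by (simp add: algebra_simps)
    then have "of_real x = (of_real (y + of_int n) :: complex)"
      by (subst (asm) mult_cancel_left) simp
    then have "x = y + of_int n" using of_real_eq_iff by blast
    then show "y = x" using y assms by auto
  qed
  then show ?thesis
    unfolding mu_def using assms by (intro the_equality conjI refl) blast+
qed

lemma mu_cis:
  assumes "cmod l = 1"
  shows "0 \<le> mu l" "mu l < 1" "exp (2 * of_real pi * \<i> * of_real (mu l)) = l"
proof -
  define x where "x = frac (Arg l / (2 * pi))"
  have x: "0 \<le> x" "x < 1" by (auto simp: x_def frac_lt_1)
  have "l = exp (\<i> * of_real (Arg l))" 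
    using Arg_eq[of l] assms by (metis norm_zero mult_1 of_real_1 zero_neq_one)
  also have "Arg l = 2 * pi * x + 2 * pi * of_int \<lfloor>Arg l / (2 * pi)\<rfloor>"
    by (simp add: x_def frac_def field_simps)
  also have "exp (\<i> * of_real (2 * pi * x + 2 * pi * of_int \<lfloor>Arg l / (2 * pi)\<rfloor>)) =
     exp (2 * of_real pi * \<i> * of_real x) * exp (of_int \<lfloor>Arg l / (2 * pi)\<rfloor> * (2 * of_real pi * \<i>))"
    by (simp add: exp_add[symmetric] algebra_simps)
  also have "exp (of_int \<lfloor>Arg l / (2 * pi)\<rfloor> * (2 * of_real pi * \<i>)) = 1"
    using exp_integer_2pi[of "of_int \<lfloor>Arg l / (2 * pi)\<rfloor>"] by (simp add: mult_ac)
  finally have l: "l = exp (2 * of_real pi * \<i> * of_real x)" by simp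
  then have "mu l = x" using mu_exp x by simp
  then show "0 \<le> mu l" "mu l < 1" "exp (2 * of_real pi * \<i> * of_real (mu l)) = l"
    using x l by auto
qed

text \<open>Functions of \<open>log q\<close>, with \<open>log q\<close> ranging over the left half plane, that are Laurent series in
  \<open>q\<close> with finite principal part.\<close>

definition q_laurent :: "(complex \<Rightarrow> complex) \<Rightarrow> bool" where
  "q_laurent f \<longleftrightarrow> (\<exists>(a :: int \<Rightarrow> complex) M. (\<forall>n. n < - M \<longrightarrow> a n = 0) \<and>
     (\<forall>z. Re z < 0 \<longrightarrow> ((\<lambda>n. a n * exp z powi n) has_sum f z) UNIV))"

lemma q_laurent_0: "q_laurent (\<lambda>z. 0)"
  unfolding q_laurent_def by (intro exI[of _ "\<lambda>_. 0"]) auto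

lemma q_laurent_cmult:
  assumes "q_laurent f"
  shows "q_laurent (\<lambda>z. c * f z)"
proof -
  obtain a M where "\<forall>n. n < - M \<longrightarrow> a n = 0" "\<forall>z. Re z < 0 \<longrightarrow> ((\<lambda>n. a n * exp z powi n) has_sum f z) UNIV"
    using assms unfolding q_laurent_def by blast
  then show ?thesis
    unfolding q_laurent_def
    by (intro exI[of _ "\<lambda>n. c * a n"] exI[of _ M]) (auto simp: mult.assoc intro: has_sum_cmult_right)
qed

lemma q_laurent_add:
  assumes "q_laurent f" "q_laurent g"
  shows "q_laurent (\<lambda>z. f z + g z)"
proof -
  obtain a M where 1: "\<forall>n. n < - M \<longrightarrow> a n = 0" "\<forall>z. Re z < 0 \<longrightarrow> ((\<lambda>n. a n * exp z powi n) has_sum f z) UNIV"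
    using assms(1) unfolding q_laurent_def by blast
  obtain b N where 2: "\<forall>n. n < - N \<longrightarrow> b n = 0" "\<forall>z. Re z < 0 \<longrightarrow> ((\<lambda>n. b n * exp z powi n) has_sum g z) UNIV"
    using assms(2) unfolding q_laurent_def by blast
  show ?thesis
    unfolding q_laurent_def using 1 2
    by (intro exI[of _ "\<lambda>n. a n + b n"] exI[of _ "max M N"]) (auto simp: ring_distribs intro: has_sum_add)
qed

text \<open>With w = z / N + i d, the term of exponent N n + r is exp (r z / N) times exp (n z)
  times a phase. Collecting the terms with the same r leaves a Laurent series in exp z; the phase
  coming from d only changes the coefficients.\<close>

lemma q_laurent_residue_classes:
  assumes f: "q_laurent f" and N: "N > (0::nat)"
  shows "\<exists>g. (\<forall>r<N. q_laurent (g r)) \<and> (\<forall>z. Re z < 0 \<longrightarrow>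
    f (z / of_nat N + \<i> * of_real d) = (\<Sum>r<N. exp (of_nat r / of_nat N * z) * g r z))"
proof -
  obtain a M where a: "\<forall>n. n < - M \<longrightarrow> a n = 0"
    and hs: "\<forall>z. Re z < 0 \<longrightarrow> ((\<lambda>n. a n * exp z powi n) has_sum f z) UNIV"
    using f unfolding q_laurent_def by blast
  define b where "b r n = a (of_nat N * n + of_nat r) * exp (of_int (of_nat N * n + of_nat r) * (\<i> * of_real d))" for r n
  define g where "g r z = (\<Sum>\<^sub>\<infinity>n. b r n * exp z powi n)" for r z
  \<comment> \<open>Division with remainder by N, as a bijection between exponents and pairs of
    residue and quotient.\<close>
  define h where "h = (\<lambda>(r, n). int N * n + int r)"
  have bij: "bij_betw h ({..<N} \<times> UNIV) UNIV"
  proof (rule bij_betwI[where g = "\<lambda>k. (nat (k mod int N), k div int N)"])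
    show "(\<lambda>k. (nat (k mod int N), k div int N)) \<in> UNIV \<rightarrow> {..<N} \<times> UNIV"
      using N by (auto simp: nat_less_iff)
    fix x assume "x \<in> {..<N} \<times> (UNIV :: int set)"
    then show "(nat (h x mod int N), h x div int N) = x"
      by (cases x) (auto simp: h_def)
  qed (use N in \<open>auto simp: h_def\<close>)
  have main: "((\<lambda>n. b r n * exp z powi n) has_sum g r z) UNIV"
      "f (z / of_nat N + \<i> * of_real d) = (\<Sum>r<N. exp (of_nat r / of_nat N * z) * g r z)"
    if z: "Re z < 0" "r < N" for z r
  proof -
    define w where "w = z / of_nat N + \<i> * of_real d"
    have "Re w < 0" using z N by (simp add: w_def divide_neg_pos)
    then have "((\<lambda>n. a n * exp w powi n) has_sum f w) UNIV" using hs by blast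
    then have sum_h: "((\<lambda>x. a (h x) * exp w powi h x) has_sum f w) ({..<N} \<times> UNIV)"
      using has_sum_reindex_bij_betw[OF bij] by fastforce
    have summand: "a (h (r, n)) * exp w powi h (r, n) = exp (of_nat r / of_nat N * z) * (b r n * exp z powi n)" for r n
    proof -
      have "exp w powi h (r, n) = exp (of_nat r / of_nat N * z + of_int n * z + of_int (h (r, n)) * (\<i> * of_real d))"
        using N by (simp add: exp_power_int w_def h_def field_simps)
      then show ?thesis by (simp add: exp_add exp_power_int b_def h_def mult_ac)
    qed
    have "(\<lambda>x. a (h x) * exp w powi h x) =
        (\<lambda>(r, n). exp (of_nat r / of_nat N * z) * (b r n * exp z powi n))"
      using summand by (simp only: fun_eq_iff split_paired_All case_prod_conv) blast
    with sum_h have sum: "((\<lambda>(r, n). exp (of_nat r / of_nat N * z) * (b r n * exp z powi n)) has_sum f w) ({..<N} \<times> UNIV)"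
      by (simp only:)
    have hs_r: "((\<lambda>n. b r n * exp z powi n) has_sum g r z) UNIV" if "r < N" for r
    proof -
      have "(\<lambda>(r, n). exp (of_nat r / of_nat N * z) * (b r n * exp z powi n)) summable_on ({r} \<times> UNIV)"
        using sum that by (intro summable_on_subset_banach[OF has_sum_imp_summable]) auto
      moreover have range_eq: "{r} \<times> UNIV = range (\<lambda>n :: int. (r, n))" by auto
      ultimately have "(\<lambda>n. exp (of_nat r / of_nat N * z) * (b r n * exp z powi n)) summable_on UNIV"
        using summable_on_reindex[of "\<lambda>n. (r, n)" UNIV "\<lambda>(r, n). exp (of_nat r / of_nat N * z) * (b r n * exp z powi n)"]
        by (simp add: inj_on_def o_def range_eq)
      then have "(\<lambda>n. b r n * exp z powi n) summable_on UNIV"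
        by (subst (asm) summable_on_cmult_right') simp_all
      then show ?thesis by (simp add: g_def)
    qed
    then show "((\<lambda>n. b r n * exp z powi n) has_sum g r z) UNIV" using z by blast
    have "((\<lambda>r. exp (of_nat r / of_nat N * z) * g r z) has_sum f w) {..<N}"
      by (rule has_sum_SigmaD[OF sum]) (auto intro: has_sum_cmult_right hs_r)
    then show "f (z / of_nat N + \<i> * of_real d) = (\<Sum>r<N. exp (of_nat r / of_nat N * z) * g r z)"
      unfolding w_def using has_sum_finite_iff[of "{..<N}"] by blast
  qed
  have "q_laurent (g r)" if "r < N" for r
  proof -
    \<comment> \<open>One bound serves all residues: N n + r < N (n + 1) <= n + 1, the last step
      because n + 1 is negative.\<close>
    have "b r n = 0" if "n < - \<bar>M\<bar> - 1" for n
    proof -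
      have "int N * n + int r < int N * (n + 1)" using \<open>r < N\<close> by (simp add: algebra_simps)
      also have "\<dots> \<le> 1 * (n + 1)" using N that by (intro mult_right_mono_neg) auto
      also have "\<dots> \<le> - M" using that by simp
      finally show ?thesis using a by (simp add: b_def)
    qed
    then show ?thesis
      unfolding q_laurent_def using main(1)[OF _ that]
      by (intro exI[of _ "b r"] exI[of _ "\<bar>M\<bar> + 1"]) auto
  qed
  then show ?thesis using main(2) N by (intro exI[of _ g]) auto
qed

section \<open>Sums of powers of log q times Laurent series\<close>

abbreviation log_sum ::
    "(nat \<times> complex) list \<Rightarrow> (nat \<Rightarrow> nat \<Rightarrow> complex \<Rightarrow> complex) \<Rightarrow> complex \<Rightarrow> complex" where
  "log_sum bs f z \<equiv> \<Sum>i<length bs. \<Sum>j<fst (bs ! i). z ^ j * exp (of_real (mu (snd (bs ! i))) * z) * f i j z"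

text \<open>One component of a logarithmic expansion, as a function of z = log q on the left half
  plane. Only the existence of coefficients is asked, so slots provided by \<open>bs\<close> may
  stay empty; this makes the condition closed under sums and monotone in the blocks.\<close>

definition log_series :: "(nat \<times> complex) list \<Rightarrow> (complex \<Rightarrow> complex) \<Rightarrow> bool" where
  "log_series bs F \<longleftrightarrow> (\<exists>f. (\<forall>i<length bs. \<forall>j<fst (bs ! i). q_laurent (f i j)) \<and>
     (\<forall>z. Re z < 0 \<longrightarrow> F z = log_sum bs f z))"

lemma log_series_cong:
  assumes "\<And>z. Re z < 0 \<Longrightarrow> F z = G z" "log_series bs F"
  shows "log_series bs G"
  using assms unfolding log_series_def by auto

lemma log_series_cmult:
  assumes "log_series bs F"
  shows "log_series bs (\<lambda>z. c * F z)"
proof -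
  obtain f where "\<forall>i<length bs. \<forall>j<fst (bs ! i). q_laurent (f i j)"
    "\<forall>z. Re z < 0 \<longrightarrow> F z = log_sum bs f z"
    using assms unfolding log_series_def by blast
  then show ?thesis
    unfolding log_series_def
    by (intro exI[of _ "\<lambda>i j z. c * f i j z"]) (auto intro: q_laurent_cmult simp: sum_distrib_left mult_ac)
qed

lemma log_series_add:
  assumes "log_series bs F" "log_series bs G"
  shows "log_series bs (\<lambda>z. F z + G z)"
proof -
  obtain f where "\<forall>i<length bs. \<forall>j<fst (bs ! i). q_laurent (f i j)"
    "\<forall>z. Re z < 0 \<longrightarrow> F z = log_sum bs f z"
    using assms(1) unfolding log_series_def by blast
  moreover obtain g where "\<forall>i<length bs. \<forall>j<fst (bs ! i). q_laurent (g i j)"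
    "\<forall>z. Re z < 0 \<longrightarrow> G z = log_sum bs g z"
    using assms(2) unfolding log_series_def by blast
  ultimately show ?thesis
    unfolding log_series_def
    by (intro exI[of _ "\<lambda>i j z. f i j z + g i j z"]) (auto intro: q_laurent_add simp: sum.distrib ring_distribs)
qed

lemma log_series_0: "log_series bs (\<lambda>z. 0)"
  unfolding log_series_def by (intro exI[of _ "\<lambda>i j z. 0"]) (auto intro: q_laurent_0)

lemma log_series_sum:
  assumes "\<And>x. x \<in> S \<Longrightarrow> log_series bs (F x)"
  shows "log_series bs (\<lambda>z. \<Sum>x\<in>S. F x z)"
  using assms
  by (induction S rule: infinite_finite_induct) (auto intro: log_series_0 log_series_add)

text \<open>The block size enters only through \<open>j < s\<close>, so any sufficiently large block
  can carry the term; all other slots receive 0.\<close>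

lemma log_series_monomial:
  assumes "(s, l) \<in> set bs" "j < s" "q_laurent f"
  shows "log_series bs (\<lambda>z. z ^ j * exp (of_real (mu l) * z) * f z)"
proof -
  obtain i where i: "i < length bs" "bs ! i = (s, l)" using assms(1) by (metis in_set_conv_nth)
  define g where "g i' j' = (if i' = i \<and> j' = j then f else (\<lambda>z. 0))" for i' j'
  have "(\<Sum>i'<length bs. \<Sum>j'<fst (bs ! i'). z ^ j' * exp (of_real (mu (snd (bs ! i'))) * z) * g i' j' z)
      = (\<Sum>i'<length bs. if i' = i then z ^ j * exp (of_real (mu l) * z) * f z else 0)" for z
  proof (intro sum.cong refl)
    fix i' assume "i' \<in> {..<length bs}"
    have "(\<Sum>j'<fst (bs ! i'). z ^ j' * exp (of_real (mu (snd (bs ! i'))) * z) * g i' j' z)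
      = (\<Sum>j'<fst (bs ! i'). if j' = j then z ^ j * exp (of_real (mu (snd (bs ! i'))) * z) * g i' j z else 0)"
      by (intro sum.cong) (auto simp: g_def)
    also have "\<dots> = (if i' = i then z ^ j * exp (of_real (mu l) * z) * f z else 0)"
      using i assms(2) by (auto simp: g_def)
    finally show "(\<Sum>j'<fst (bs ! i'). z ^ j' * exp (of_real (mu (snd (bs ! i'))) * z) * g i' j' z)
      = (if i' = i then z ^ j * exp (of_real (mu l) * z) * f z else 0)" .
  qed
  then show ?thesis
    unfolding log_series_def using i assms(3)
    by (intro exI[of _ g]) (auto simp: g_def q_laurent_0)
qed

text \<open>Under z -> z / N + i d the power z^j becomes a polynomial with degrees p <= j, which fit
  into any block of size at least s. The factor exp (mu z) combines with exp (r z / N) from the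
  residue class r to the exponent (mu + r) / N.\<close>

lemma log_series_rescale:
  assumes F: "log_series bs F" and N: "N > (0::nat)"
    and unimod: "\<And>s l. (s, l) \<in> set bs \<Longrightarrow> cmod l = 1"
    and blocks: "\<And>s l r. (s, l) \<in> set bs \<Longrightarrow> r < N \<Longrightarrow>
      \<exists>s'\<ge>s. (s', exp (2 * of_real pi * \<i> * of_real ((mu l + of_nat r) / of_nat N))) \<in> set bs'"
  shows "log_series bs' (\<lambda>z. F (z / of_nat N + \<i> * of_real d))"
proof -
  obtain f where f': "\<forall>i<length bs. \<forall>j<fst (bs ! i). q_laurent (f i j)"
    and Feq: "\<forall>z. Re z < 0 \<longrightarrow> F z = log_sum bs f z"
    using F unfolding log_series_def by blast
  have f: "q_laurent (f i j)" if "i < length bs" "j < fst (bs ! i)" for i j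
    using f' that by blast
  define split where "split f' g \<longleftrightarrow> (\<forall>r<N. q_laurent (g r)) \<and> (\<forall>z. Re z < 0 \<longrightarrow>
    f' (z / of_nat N + \<i> * of_real d) = (\<Sum>r<N. exp (of_nat r / of_nat N * z) * g r z))"
    for f' :: "complex \<Rightarrow> complex" and g
  have "\<forall>i j. \<exists>g. i < length bs \<longrightarrow> j < fst (bs ! i) \<longrightarrow> split (f i j) g"
    using q_laurent_residue_classes[OF f N] unfolding split_def by blast
  then obtain g where "\<forall>i j. i < length bs \<longrightarrow> j < fst (bs ! i) \<longrightarrow> split (f i j) (g i j)"
    by metis
  then have g: "\<And>i j r. i < length bs \<Longrightarrow> j < fst (bs ! i) \<Longrightarrow> r < N \<Longrightarrow> q_laurent (g i j r)"
    "\<And>i j z. i < length bs \<Longrightarrow> j < fst (bs ! i) \<Longrightarrow> Re z < 0 \<Longrightarrow>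
       f i j (z / of_nat N + \<i> * of_real d) = (\<Sum>r<N. exp (of_nat r / of_nat N * z) * g i j r z)"
    by (auto simp: split_def)
  \<comment> \<open>The coefficient of z^p in (z / N + i d)^j, times the constant part of exp (mu (z
    / N + i d)).\<close>
  define C where "C i j p = of_nat (j choose p) * (\<i> * of_real d) ^ (j - p) / of_nat N ^ p *
      exp (of_real (mu (snd (bs ! i))) * (\<i> * of_real d))" for i j p
  define G where "G = (\<lambda>z. \<Sum>i<length bs. \<Sum>j<fst (bs ! i). \<Sum>r<N. \<Sum>p\<le>j.
     C i j p * (z ^ p * exp (of_real ((mu (snd (bs ! i)) + of_nat r) / of_nat N) * z) * g i j r z))"
  have "log_series bs' G"
    unfolding G_def
  proof (intro log_series_sum log_series_cmult)
    fix i j r p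
    assume *: "i \<in> {..<length bs}" "j \<in> {..<fst (bs ! i)}" "r \<in> {..<N}" "p \<in> {..j}"
    obtain s l where sl: "bs ! i = (s, l)" by force
    have mem: "(s, l) \<in> set bs" using * sl by (metis lessThan_iff nth_mem)
    define x where "x = (mu l + of_nat r) / of_nat N"
    \<comment> \<open>From mu l < 1 and r + 1 <= N the new exponent stays in [0, 1). So it is
      exactly the value of \<open>mu\<close> at the new eigenvalue, and no integral shift of the
      Laurent series is required.\<close>
    have "of_nat r + 1 \<le> (of_nat N :: real)" using * by (metis Suc_leI lessThan_iff of_nat_Suc of_nat_le_iff add.commute)
    then have "0 \<le> x" "x < 1"
      using mu_cis(1,2)[OF unimod[OF mem]] N by (auto simp: x_def divide_simps)
    then have mu: "mu (exp (2 * of_real pi * \<i> * of_real x)) = x" by (rule mu_exp)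
    obtain s' where s': "s' \<ge> s" "(s', exp (2 * of_real pi * \<i> * of_real x)) \<in> set bs'"
      using blocks[OF mem, of r] * by (auto simp: x_def)
    have "q_laurent (g i j r)" using g(1) * by auto
    from log_series_monomial[OF s'(2) _ this, of p]
    show "log_series bs' (\<lambda>z. z ^ p * exp (of_real ((mu (snd (bs ! i)) + of_nat r) / of_nat N) * z) * g i j r z)"
      unfolding mu using * s' by (simp add: sl x_def)
  qed
  moreover have "G z = F (z / of_nat N + \<i> * of_real d)" if z: "Re z < 0" for z
  proof -
    define w where "w = z / of_nat N + \<i> * of_real d"
    have "Re w < 0" using z N by (simp add: w_def divide_neg_pos)
    then have "F w = (\<Sum>i<length bs. \<Sum>j<fst (bs ! i).
        w ^ j * exp (of_real (mu (snd (bs ! i))) * w) * f i j w)" using Feq by blast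
    also have "\<dots> = (\<Sum>i<length bs. \<Sum>j<fst (bs ! i). \<Sum>r<N. \<Sum>p\<le>j.
     C i j p * (z ^ p * exp (of_real ((mu (snd (bs ! i)) + of_nat r) / of_nat N) * z) * g i j r z))"
    proof (intro sum.cong refl)
      fix i j assume ij: "i \<in> {..<length bs}" "j \<in> {..<fst (bs ! i)}"
      define x where "x = mu (snd (bs ! i))"
      have 1: "w ^ j = (\<Sum>p\<le>j. of_nat (j choose p) * (z / of_nat N) ^ p * (\<i> * of_real d) ^ (j - p))"
        unfolding w_def by (rule binomial_ring)
      have 2: "f i j w = (\<Sum>r<N. exp (of_nat r / of_nat N * z) * g i j r z)"
        using g(2) ij z unfolding w_def by auto
      have 3: "exp (of_real x * w) * exp (of_nat r / of_nat N * z) =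
        exp (of_real x * (\<i> * of_real d)) * exp (of_real ((x + of_nat r) / of_nat N) * z)" for r
        unfolding exp_add[symmetric] w_def by (simp add: field_simps add_divide_distrib)
      have "w ^ j * exp (of_real x * w) * f i j w = (\<Sum>r<N. \<Sum>p\<le>j.
          of_nat (j choose p) * (z / of_nat N) ^ p * (\<i> * of_real d) ^ (j - p) *
          (exp (of_real x * w) * exp (of_nat r / of_nat N * z)) * g i j r z)"
        unfolding 1 2 sum_distrib_left sum_distrib_right
        by (simp only: mult.assoc)
      also have "\<dots> = (\<Sum>r<N. \<Sum>p\<le>j.
         C i j p * (z ^ p * exp (of_real ((x + of_nat r) / of_nat N) * z) * g i j r z))"
        unfolding 3 unfolding C_def x_def by (intro sum.cong refl) (simp add: power_divide mult_ac)
      finally show "w ^ j * exp (of_real (mu (snd (bs ! i))) * w) * f i j w = (\<Sum>r<N. \<Sum>p\<le>j.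
         C i j p * (z ^ p * exp (of_real ((mu (snd (bs ! i)) + of_nat r) / of_nat N) * z) * g i j r z))"
        unfolding x_def .
    qed
    finally show ?thesis unfolding w_def G_def by simp
  qed
  ultimately show ?thesis using log_series_cong[of G "\<lambda>z. F (z / of_nat N + \<i> * of_real d)"] by blast
qed

section \<open>The projective group\<close>

lemma psl_eq: "psl A = {A, - A}"
  by (auto simp: psl_def r_coset_def)

lemma psl_eq_iff: "psl A = psl B \<longleftrightarrow> A = B \<or> A = - B"
  by (auto simp: psl_eq doubleton_eq_iff)

lemma psl_mult: "psl A <#>\<^bsub>SL2R\<^esub> psl B = psl (A ** B)"
  by (auto simp: psl_eq set_mult_def)

lemma group_PSL2R: "group PSL2R"
proof -
  have "subgroup {I2, - I2} SL2R"
    by (rule SL.subgroupI) (auto simp: sinv_neg)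
  then have "{I2, - I2} \<lhd> SL2R"
    by (auto simp: SL.normal_inv_iff)
  then show ?thesis
    unfolding PSL2R_def by (rule normal.factorgroup_is_group)
qed

lemma PSL2R_simps [simp]:
  "carrier PSL2R = psl ` carrier SL2R" "x \<otimes>\<^bsub>PSL2R\<^esub> y = x <#>\<^bsub>SL2R\<^esub> y" "\<one>\<^bsub>PSL2R\<^esub> = psl I2"
  by (auto simp: PSL2R_def FactGroup_def RCOSETS_def psl_def psl_eq[unfolded psl_def])

interpretation PSL: group PSL2R by (rule group_PSL2R)

lemma psl_inv:
  assumes "A \<in> carrier SL2R"
  shows "inv\<^bsub>PSL2R\<^esub> (psl A) = psl (sinv A)"
  using assms by (intro PSL.inv_equality) (auto simp: psl_mult)

lemma psl_transl_nat_pow: "psl (transl c x) [^]\<^bsub>PSL2R\<^esub> (n::nat) = psl (transl c (of_nat n * x))"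
  by (induction n) (auto simp: psl_mult transl_add algebra_simps)

lemma psl_transl_int_pow: "psl (transl c x) [^]\<^bsub>PSL2R\<^esub> (n::int) = psl (transl c (of_int n * x))"
  by (simp add: int_pow_def2 psl_transl_nat_pow psl_inv transl_uminus)

lemma generate_psl_transl:
  "generate PSL2R {psl (transl c x)} = {psl (transl c (of_int n * x)) | n. True}"
  by (subst PSL.generate_pow) (auto simp: psl_transl_int_pow)

lemma psl_transl_eq_iff: "psl (transl c x) = psl (transl c y) \<longleftrightarrow> x = y"
  using transl_neq_neg by (auto simp: psl_eq_iff transl_inj)

section \<open>Stabilizers of cusps in discrete groups\<close>

text \<open>Pulls the isolation of the identity in the quotient topology back to a metric gap among
  matrices, which can then be compared with translation lengths.\<close>

lemma discrete_subgroup_imp: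
  assumes K: "subgroup K SL2R" and disc: "discrete_subgroup (psl ` K)"
  shows "\<exists>e>0. \<forall>A\<in>K. dist A I2 < e \<longrightarrow> A = I2"
proof -
  have I: "I2 \<in> K" using subgroup.one_closed[OF K] by simp
  have "openin (subtopology PSL2R_topology (psl ` K)) {psl I2}"
    using disc I unfolding discrete_subgroup_def by simp
  then obtain U where U: "openin PSL2R_topology U" "{psl I2} = U \<inter> psl ` K"
    unfolding openin_subtopology by blast
  define V where "V = {A \<in> carrier SL2R. psl A \<in> U}"
  have "openin (top_of_set (carrier SL2R)) V"
    using U(1) by (simp add: openin_PSL2R_topology V_def)
  moreover have "I2 \<in> V" using U(2) by (auto simp: V_def)
  ultimately have "\<exists>e>0. \<forall>A\<in>carrier SL2R. dist A I2 < e \<longrightarrow> A \<in> V"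
    by (simp add: openin_euclidean_subtopology_iff)
  then obtain e where e: "e > 0" "\<And>A. A \<in> carrier SL2R \<Longrightarrow> dist A I2 < e \<Longrightarrow> A \<in> V"
    by blast
  show ?thesis
  \<comment> \<open>The neighbourhood upstairs may contain \<open>- I2\<close>, which has the same
    image as \<open>I2\<close>. Radius at most 1 excludes it, since the upper left entries differ by
    2.\<close>
  proof (intro exI[of _ "min e 1"] conjI ballI impI)
    fix A assume A: "A \<in> K" "dist A I2 < min e 1"
    then have "psl A \<in> U \<inter> psl ` K" using e(2)[of A] subgroup.subset[OF K] by (auto simp: V_def)
    then have "A = I2 \<or> A = - I2" using U(2) by (metis psl_eq_iff singletonD)
    moreover have "A \<noteq> - I2"
    proof
      assume "A = - I2"
      have "\<bar>(A - I2) $ 1 $ 1\<bar> \<le> norm ((A - I2) $ 1)" by (rule component_le_norm_cart)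
      also have "\<dots> \<le> norm (A - I2)" by (rule Finite_Cartesian_Product.norm_nth_le)
      finally show False using A(2) \<open>A = - I2\<close> by (simp add: dist_norm)
    qed
    ultimately show "A = I2" by blast
  qed (use e in auto)
qed

text \<open>Elements less than \<open>e\<close> apart coincide, so the infimum of the positive
  elements is attained. Division by it with remainder leaves a nonnegative element below the
  minimum, hence 0.\<close>

lemma real_discrete_subgroup:
  fixes S :: "real set"
  assumes diff: "\<And>x y. x \<in> S \<Longrightarrow> y \<in> S \<Longrightarrow> x - y \<in> S"
    and gap: "e > 0" "\<And>x. x \<in> S \<Longrightarrow> \<bar>x\<bar> < e \<Longrightarrow> x = 0"
    and nontriv: "x0 \<in> S" "x0 \<noteq> 0"
  shows "\<exists>h>0. \<forall>x. x \<in> S \<longleftrightarrow> (\<exists>n::int. x = of_int n * h)"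
proof -
  have zero: "0 \<in> S" using diff[OF nontriv(1) nontriv(1)] by simp
  have uminus: "- x \<in> S" if "x \<in> S" for x using diff[OF zero that] by simp
  have add: "x + y \<in> S" if "x \<in> S" "y \<in> S" for x y using diff[OF that(1) uminus[OF that(2)]] by simp
  define P where "P = {x \<in> S. x > 0}"
  have "\<bar>x0\<bar> \<in> P" using nontriv uminus[of x0] by (auto simp: P_def abs_if)
  then have ne: "P \<noteq> {}" by blast
  have bdd: "bdd_below P" unfolding P_def by (intro bdd_belowI[of _ 0]) auto
  define h where "h = Inf P"
  obtain b where b: "b \<in> P" "b < h + e"
    using cInf_lessD[OF ne, of "h + e"] gap(1) unfolding h_def by auto
  have hb: "h \<le> b" unfolding h_def by (rule cInf_lower[OF b(1) bdd])
  have "h = b"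
  proof (rule ccontr)
    assume "h \<noteq> b"
    then obtain b' where b': "b' \<in> P" "b' < b"
      using hb cInf_lessD[OF ne, of b] unfolding h_def by auto
    have "h \<le> b'" unfolding h_def by (rule cInf_lower[OF b'(1) bdd])
    then have "b - b' = 0" using b b' gap(2)[of "b - b'"] diff[of b b'] by (auto simp: P_def)
    then show False using b' by simp
  qed
  then have h: "h \<in> S" "h > 0" using b by (auto simp: P_def)
  have nat: "of_nat n * h \<in> S" for n
    by (induction n) (auto simp: zero algebra_simps intro: add h)
  have int: "of_int n * h \<in> S" for n
    by (cases n) (use nat uminus[OF nat] in \<open>auto simp del: of_nat_Suc\<close>)
  have "\<exists>n::int. x = of_int n * h" if "x \<in> S" for x
  proof (intro exI)
    define y where "y = x - of_int \<lfloor>x / h\<rfloor> * h"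
    have "0 \<le> y" "y < h"
      using floor_divide_lower[OF h(2), of x] floor_divide_upper[OF h(2), of x]
      by (auto simp: y_def algebra_simps)
    moreover have "y \<in> S" unfolding y_def by (rule diff[OF that int])
    ultimately have "y = 0" using cInf_lower[OF _ bdd, of y] unfolding h_def P_def by force
    then show "x = of_int \<lfloor>x / h\<rfloor> * h" by (simp add: y_def)
  qed
  then show ?thesis using h int by blast
qed

text \<open>The distance of \<open>transl c x\<close> from \<open>I2\<close> is therefore |x| times
  a constant depending on c, so a gap for matrices becomes a gap for translation lengths.\<close>

lemma transl_affine: "\<exists>M. \<forall>x. transl c x = I2 + x *\<^sub>R M"
proof (intro exI allI)
  fix x
  have "mat22 1 x 0 1 = I2 + x *\<^sub>R mat22 0 1 0 0" by (simp add: mat2_eq_iff)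
  then have "transl c x = A_cusp c ** (I2 + x *\<^sub>R mat22 0 1 0 0) ** sinv (A_cusp c)"
    by (simp only: transl_eq)
  also have "\<dots> = A_cusp c ** sinv (A_cusp c) + x *\<^sub>R (A_cusp c ** mat22 0 1 0 0 ** sinv (A_cusp c))"
    by (simp add: mat2_eq_iff algebra_simps del: sinv_cancel)
  finally show "transl c x = I2 + x *\<^sub>R (A_cusp c ** mat22 0 1 0 0 ** sinv (A_cusp c))" by simp
qed

lemma transl_of_unimodular_multiplier:
  assumes "\<gamma> \<in> carrier SL2R" "\<alpha> = 1 \<or> \<alpha> = -1" "\<gamma> ** A_cusp c = A_cusp c ** mat22 \<alpha> \<beta> 0 (1 / \<alpha>)"
  shows "\<exists>x. \<gamma> = transl c x \<or> \<gamma> = - transl c x"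
proof -
  have "\<gamma> = A_cusp c ** mat22 \<alpha> \<beta> 0 (1 / \<alpha>) ** sinv (A_cusp c)"
    using assms(1) by (simp flip: assms(3))
  moreover have "mat22 (-1) \<beta> 0 (-1) = - mat22 1 (- \<beta>) 0 1"
    by (simp add: mat2_eq_iff)
  ultimately have "\<gamma> = transl c \<beta> \<or> \<gamma> = - transl c (- \<beta>)"
    using assms(2) by (auto simp: transl_eq)
  then show ?thesis by blast
qed

text \<open>The triangular form at c has trace alpha + 1 / alpha. That this equals 2 or -2 means
  (alpha - 1)^2 = 0 or (alpha + 1)^2 = 0.\<close>

lemma parabolic_fixing_cusp:
  assumes "\<gamma> \<in> carrier SL2R" "parabolic \<gamma>" "act \<gamma> c = c"
  shows "\<exists>x. \<gamma> = transl c x \<or> \<gamma> = - transl c x"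
proof -
  obtain \<alpha> \<beta> where U: "\<alpha> \<noteq> 0" "\<gamma> ** A_cusp c = A_cusp c ** mat22 \<alpha> \<beta> 0 (1 / \<alpha>)"
    using act_eq_obtain[OF assms(1,3)] .
  have "sinv (A_cusp c) ** \<gamma> ** A_cusp c = sinv (A_cusp c) ** (A_cusp c ** mat22 \<alpha> \<beta> 0 (1 / \<alpha>))"
    using U(2) by (simp add: matrix_mul_assoc[symmetric])
  then have "sinv (A_cusp c) ** \<gamma> ** A_cusp c = mat22 \<alpha> \<beta> 0 (1 / \<alpha>)" by simp
  then have "parabolic (mat22 \<alpha> \<beta> 0 (1 / \<alpha>))"
    using assms(2) parabolic_conj(1)[OF A_cusp_SL2R, of c \<gamma>] by simp
  then have "\<bar>\<alpha> + 1 / \<alpha>\<bar> = 2" by (simp add: parabolic_def trace_mat2)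
  then have "\<alpha> + 1 / \<alpha> = 2 \<or> \<alpha> + 1 / \<alpha> = -2" by linarith
  then have "(\<alpha> - 1)\<^sup>2 = 0 \<or> (\<alpha> + 1)\<^sup>2 = 0"
    using U(1) by (auto simp: field_simps power2_eq_square)
  then have "\<alpha> = 1 \<or> \<alpha> = -1" by auto
  then show ?thesis using transl_of_unimodular_multiplier assms(1) U(2) by blast
qed

text \<open>The meaning of the width h on the level of matrices instead of their projective classes:
  it records the sign that a stabilizing element may carry. The proofs use this in place of the
  description operator in \<open>cusp_width\<close>; the two are matched by
  \<open>cusp_width_cuspidal\<close>.\<close>

definition cuspidal :: "mat2 set \<Rightarrow> boundary \<Rightarrow> real \<Rightarrow> bool" where
  "cuspidal K c h \<longleftrightarrow> h > 0 \<and> (\<forall>x. transl c x \<in> K \<longleftrightarrow> (\<exists>n::int. x = of_int n * h)) \<and>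
     (\<forall>\<gamma>\<in>K. act \<gamma> c = c \<longrightarrow> (\<exists>x. \<gamma> = transl c x \<or> \<gamma> = - transl c x))"

lemma subgroup_neg_mem:
  assumes "subgroup K SL2R" "- I2 \<in> K" 
  shows "- A \<in> K \<longleftrightarrow> A \<in> K"
  using subgroup.m_closed[OF assms, of A] subgroup.m_closed[OF assms, of "- A"] by auto

text \<open>The translation lengths at c form a discrete subgroup of the reals. A stabilizing
  element with alpha^2 different from 1 would shrink them indefinitely by conjugation, so only
  translations up to sign fix c.\<close>

lemma cuspidal_exists:
  assumes K: "subgroup K SL2R" and neg: "- I2 \<in> K" and disc: "discrete_subgroup (psl ` K)"
    and cusp: "is_cusp K c"
  shows "\<exists>h. cuspidal K c h"
proof -
  have sub: "A \<in> carrier SL2R" if "A \<in> K" for A using subgroup.mem_carrier[OF K that] .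
  note negK = subgroup_neg_mem[OF K neg]
  have mulK: "A ** B \<in> K" if "A \<in> K" "B \<in> K" for A B using subgroup.m_closed[OF K that] by simp
  have invK: "sinv A \<in> K" if "A \<in> K" for A using subgroup.m_inv_closed[OF K that] by simp
  define S where "S = {x. transl c x \<in> K}"
  obtain e M where e: "e > 0" "\<And>A. A \<in> K \<Longrightarrow> dist A I2 < e \<Longrightarrow> A = I2" and M: "\<And>x. transl c x = I2 + x *\<^sub>R M"
    using discrete_subgroup_imp[OF K disc] transl_affine by metis
  \<comment> \<open>The norm of \<open>M\<close> converts translation length into matrix distance;
    adding 1 keeps the denominator positive.\<close>
  define d where "d = e / (norm M + 1)"
  have "d > 0" using e by (simp add: d_def add_nonneg_pos)
  have gap: "x = 0" if "x \<in> S" "\<bar>x\<bar> < d" for x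
  proof -
    have "dist (transl c x) I2 = \<bar>x\<bar> * norm M" by (simp add: M dist_norm)
    also have "\<dots> \<le> \<bar>x\<bar> * (norm M + 1)" by (simp add: mult_left_mono)
    also have "\<dots> < e"
      using that pos_less_divide_eq[of "norm M + 1" "\<bar>x\<bar>" e] by (simp add: d_def add_nonneg_pos)
    finally have "transl c x = I2" using that by (intro e) (auto simp: S_def)
    then show "x = 0" by (metis transl_0 transl_inj)
  qed
  obtain \<gamma> where \<gamma>: "\<gamma> \<in> K" "parabolic \<gamma>" "psl \<gamma> \<noteq> psl I2" "act \<gamma> c = c"
    using cusp by (auto simp: is_cusp_def)
  obtain x0 where x0: "\<gamma> = transl c x0 \<or> \<gamma> = - transl c x0"
    using parabolic_fixing_cusp[OF sub] \<gamma> by blast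
  then have x0S: "x0 \<in> S" using \<gamma>(1) negK by (auto simp: S_def)
  have "x0 \<noteq> 0" using x0 \<gamma>(3) by (auto simp: psl_eq_iff)
  have "\<exists>h>0. \<forall>x. x \<in> S \<longleftrightarrow> (\<exists>n::int. x = of_int n * h)"
  proof (rule real_discrete_subgroup[OF _ \<open>d > 0\<close> gap x0S \<open>x0 \<noteq> 0\<close>])
    fix x y assume "x \<in> S" "y \<in> S"
    then have "transl c x ** sinv (transl c y) \<in> K" by (auto simp: S_def intro: mulK invK)
    then show "x - y \<in> S" by (simp add: transl_uminus transl_add S_def)
  qed
  moreover have "\<exists>x. \<eta> = transl c x \<or> \<eta> = - transl c x" if \<eta>: "\<eta> \<in> K" "act \<eta> c = c" for \<eta>
  proof -
    obtain \<alpha> \<beta> where U: "\<alpha> \<noteq> 0" "\<eta> ** A_cusp c = A_cusp c ** mat22 \<alpha> \<beta> 0 (1 / \<alpha>)"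
      using act_eq_obtain[OF sub[OF \<eta>(1)] \<eta>(2)] .
    note conj = transl_conj[OF U sub[OF \<eta>(1)]]
    have conj': "sinv \<eta> ** transl c x ** \<eta> = transl c (inverse (\<alpha>\<^sup>2) * x)" for x
    proof -
      have "sinv \<eta> ** transl c x ** \<eta> = sinv \<eta> ** (\<eta> ** transl c (inverse (\<alpha>\<^sup>2) * x) ** sinv \<eta>) ** \<eta>"
        using U(1) by (simp add: conj mult.assoc[symmetric])
      also have "\<dots> = transl c (inverse (\<alpha>\<^sup>2) * x)"
        using sub[OF \<eta>(1)] by (simp add: matrix_mul_assoc[symmetric])
      finally show ?thesis .
    qed
    \<comment> \<open>Iterating a contraction of \<open>S\<close> produces nonzero translation
      lengths below the gap \<open>d\<close>.\<close>
    have contr: False if r: "0 < r" "r < 1" "\<And>x. x \<in> S \<Longrightarrow> r * x \<in> S" for r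
    proof -
      have mem: "r ^ n * x0 \<in> S" for n
        by (induction n) (auto simp: mult.assoc x0S intro: r)
      have "(\<lambda>n. r ^ n * x0) \<longlonglongrightarrow> 0"
        using r by (intro tendsto_mult_left_zero LIMSEQ_realpow_zero) auto
      then have "eventually (\<lambda>n. dist (r ^ n * x0) 0 < d) sequentially" using \<open>d > 0\<close> by (rule tendstoD)
      then obtain n where "\<bar>r ^ n * x0\<bar> < d" by (auto simp: eventually_sequentially)
      then show False using gap[OF mem] r \<open>x0 \<noteq> 0\<close> by simp
    qed
    have "\<alpha>\<^sup>2 = 1"
    proof (rule ccontr)
      assume "\<alpha>\<^sup>2 \<noteq> 1"
      \<comment> \<open>Conjugation by \<eta> contracts lengths in the first case, conjugation by
        its inverse in the second.\<close>
      then consider "\<alpha>\<^sup>2 < 1" | "inverse (\<alpha>\<^sup>2) < 1"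
        by (metis linorder_neqE_linordered_idom inverse_less_1_iff)
      then show False
      proof cases
        case 1
        show False
        proof (rule contr[OF _ 1])
          fix x assume "x \<in> S"
          then have "\<eta> ** transl c x ** sinv \<eta> \<in> K" using \<eta> by (auto simp: S_def intro: mulK invK)
          then show "\<alpha>\<^sup>2 * x \<in> S" by (simp add: conj S_def)
        qed (use U in simp)
      next
        case 2
        show False
        proof (rule contr[OF _ 2])
          fix x assume "x \<in> S"
          then have "sinv \<eta> ** transl c x ** \<eta> \<in> K" using \<eta> by (auto simp: S_def intro: mulK invK)
          then show "inverse (\<alpha>\<^sup>2) * x \<in> S" by (simp only: conj' S_def mem_Collect_eq)
        qed (use U in simp)
      qed
    qed
    then have "\<alpha> = 1 \<or> \<alpha> = -1" by (simp add: power2_eq_1_iff)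
    then show ?thesis using transl_of_unimodular_multiplier sub[OF \<eta>(1)] U(2) by blast
  qed
  ultimately show ?thesis unfolding cuspidal_def S_def by blast
qed

lemma stab_cuspidal:
  assumes "subgroup K SL2R" "- I2 \<in> K" "cuspidal K c h"
  shows "stab K c = {psl (transl c (of_int n * h)) | n. True}"
proof -
  have tr: "transl c x \<in> K \<longleftrightarrow> (\<exists>n::int. x = of_int n * h)" for x
    using assms(3) by (auto simp: cuspidal_def)
  show ?thesis
  proof (intro equalityI subsetI)
    fix p assume "p \<in> stab K c"
    then obtain \<gamma> where \<gamma>: "\<gamma> \<in> K" "act \<gamma> c = c" "p = psl \<gamma>" by (auto simp: stab_def)
    then obtain x where x: "\<gamma> = transl c x \<or> \<gamma> = - transl c x" using assms(3) unfolding cuspidal_def by blast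
    then have "transl c x \<in> K" using \<gamma>(1) subgroup_neg_mem[OF assms(1,2)] by auto
    moreover have "p = psl (transl c x)" using x \<gamma>(3) by (auto simp: psl_eq_iff)
    ultimately show "p \<in> {psl (transl c (of_int n * h)) | n. True}" using tr by auto
  next
    fix p assume "p \<in> {psl (transl c (of_int n * h)) | n. True}"
    then show "p \<in> stab K c" using tr by (auto simp: stab_def)
  qed
qed

text \<open>Two positive generators are integral multiples of each other, and positive integers with
  product 1 are 1. This settles uniqueness in the description operator.\<close>

lemma cusp_width_cuspidal:
  assumes K: "subgroup K SL2R" "- I2 \<in> K" and c: "cuspidal K c h"
  shows "cusp_width K c = h"
  unfolding cusp_width_def
proof (rule the_equality)
  have h: "h > 0" using c by (simp add: cuspidal_def)
  show "h > 0 \<and> generate PSL2R {psl (transl c h)} = stab K c"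
    using h by (simp add: generate_psl_transl stab_cuspidal[OF K c])
  fix h' assume h': "h' > 0 \<and> generate PSL2R {psl (transl c h')} = stab K c"
  then have eq: "{psl (transl c (of_int n * h')) | n. True} = {psl (transl c (of_int n * h)) | n. True}"
    by (simp add: generate_psl_transl stab_cuspidal[OF K c])
  have "psl (transl c (of_int 1 * h')) \<in> {psl (transl c (of_int n * h)) | n. True}"
    unfolding eq[symmetric] by blast
  then obtain n where n: "h' = of_int n * h" by (auto simp: psl_transl_eq_iff)
  have "psl (transl c (of_int 1 * h)) \<in> {psl (transl c (of_int n * h')) | n. True}"
    unfolding eq by blast
  then obtain n' where n': "h = of_int n' * h'" by (auto simp: psl_transl_eq_iff)
  have pos: "n > 0" "n' > 0" using n n' h h' by (metis of_int_0_less_iff zero_less_mult_pos2)+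
  have "h = of_int n' * (of_int n * h)" using n n' by metis
  then have "of_int (n' * n) = (1::real)" using h by simp
  then have "n' * n = 1" by (simp only: of_int_eq_1_iff)
  then have "n = 1" using pos by (simp add: zmult_eq_1_iff)
  then show "h' = h" using n by simp
qed

lemma t_cusp_cuspidal:
  assumes "subgroup K SL2R" "- I2 \<in> K" "cuspidal K c h"
  shows "t_cusp K c = transl c h"
  by (simp add: t_cusp_def cusp_width_cuspidal[OF assms])

section \<open>Cusps and widths of a conjugate group\<close>

abbreviation conj_by :: "mat2 \<Rightarrow> mat2 set \<Rightarrow> mat2 set" where
  "conj_by B K \<equiv> (\<lambda>\<gamma>. sinv B ** \<gamma> ** B) ` K"

lemma is_cusp_conj:
  assumes "B \<in> carrier SL2R" "K \<subseteq> carrier SL2R"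
  shows "is_cusp (conj_by B K) c \<longleftrightarrow> is_cusp K (act B c)"
proof -
  have 1: "psl (sinv B ** \<gamma> ** B) = psl I2 \<longleftrightarrow> psl \<gamma> = psl I2" if "\<gamma> \<in> carrier SL2R" for \<gamma>
  proof -
    have "sinv B ** \<gamma> ** B = C \<longleftrightarrow> \<gamma> = B ** C ** sinv B" for C
      using assms(1) that by (auto simp: matrix_mul_assoc[symmetric])
    from this[of I2] this[of "- I2"] show ?thesis using assms(1) by (simp add: psl_eq_iff)
  qed
  have 2: "act (sinv B ** \<gamma> ** B) c = c \<longleftrightarrow> act \<gamma> (act B c) = act B c" if "\<gamma> \<in> carrier SL2R" for \<gamma>
    using assms(1) that by (simp add: act_mult) (metis act_sinv)
  show ?thesis unfolding is_cusp_def using assms 1 2 by (simp add: subset_iff)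
qed

lemma conj_mem_iff:
  assumes "B \<in> carrier SL2R" "A \<in> carrier SL2R"
  shows "A \<in> conj_by B K \<longleftrightarrow> B ** A ** sinv B \<in> K"
proof
  assume "B ** A ** sinv B \<in> K"
  then show "A \<in> conj_by B K"
    using assms by (intro image_eqI[of _ _ "B ** A ** sinv B"]) (simp_all add: matrix_mul_assoc[symmetric])
next
  assume "A \<in> conj_by B K"
  then show "B ** A ** sinv B \<in> K"
    using assms by (auto simp: matrix_mul_assoc[symmetric])
qed

text \<open>By \<open>transl_conj\<close> the translation by x at c corresponds to the translation
  by alpha^2 x at c', so the width is divided by alpha^2.\<close>

lemma cuspidal_conj:
  assumes B: "B \<in> carrier SL2R" and U: "\<alpha> \<noteq> 0" "B ** A_cusp c = A_cusp c' ** mat22 \<alpha> \<beta> 0 (1 / \<alpha>)"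
    and K: "K \<subseteq> carrier SL2R" and act: "act B c = c'" and cusp: "cuspidal K c' h"
  shows "cuspidal (conj_by B K) c (h / \<alpha>\<^sup>2)"
proof -
  note conj = transl_conj[OF U B]
  note mem = conj_mem_iff[OF B]
  have "transl c x \<in> conj_by B K \<longleftrightarrow> (\<exists>n::int. x = of_int n * (h / \<alpha>\<^sup>2))" for x
    using cusp U(1) by (simp add: mem conj cuspidal_def field_simps)
  moreover have "\<exists>x. A = transl c x \<or> A = - transl c x"
    if A: "A \<in> conj_by B K" "act A c = c" for A
  proof -
    obtain \<gamma> where \<gamma>: "\<gamma> \<in> K" "A = sinv B ** \<gamma> ** B" using A by blast
    have "\<gamma> \<in> carrier SL2R" using \<gamma> K by blast
    then have "act \<gamma> c' = c'" using A(2) B act unfolding \<gamma>(2) by (simp add: act_mult) (metis act_sinv(2))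
    then obtain x where "\<gamma> = transl c' x \<or> \<gamma> = - transl c' x" using cusp \<gamma>(1) unfolding cuspidal_def by blast
    moreover have "sinv B ** transl c' x ** B = transl c (x / \<alpha>\<^sup>2)"
      using conj[of "x / \<alpha>\<^sup>2"] U(1) B by (metis (no_types, lifting) matrix_mul_assoc nonzero_mult_div_cancel_left sinv_cancel_assoc(1,4) times_divide_eq_right zero_eq_power2)
    ultimately show ?thesis unfolding \<gamma>(2) by auto
  qed
  ultimately show ?thesis using cusp U(1) unfolding cuspidal_def by simp
qed

text \<open>Both stabilizers are infinite cyclic, generated by the translations by w and by N w. So
  the index that counts the representatives attached to one cusp of \<open>H\<close> is the ratio of
  the two widths.\<close>

lemma card_rcosets_stab:
  assumes G: "subgroup G SL2R" "- I2 \<in> G" "cuspidal G c w"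
    and H: "subgroup H SL2R" "- I2 \<in> H" "cuspidal H c (of_nat N * w)"
  shows "card (rcosets\<^bsub>PSL2R\<lparr>carrier := stab G c\<rparr>\<^esub> (stab H c)) = N"
proof -
  have w: "w > 0" using G(3) by (simp add: cuspidal_def)
  have N: "N > 0" using H(3) w by (auto simp: cuspidal_def zero_less_mult_iff)
  define C where "C j = range (\<lambda>n::int. psl (transl c (of_int (n * int N + j) * w)))" for j
  have "stab H c = range (\<lambda>n::int. psl (transl c (of_int n * (of_nat N * w))))"
    unfolding stab_cuspidal[OF H] by auto
  then have C: "stab H c #>\<^bsub>PSL2R\<^esub> psl (transl c (of_int j * w)) = C j" for j
    by (simp add: r_coset_def C_def psl_mult transl_add algebra_simps UNION_singleton_eq_range image_image)
  have eq: "C i = C j \<longleftrightarrow> i mod int N = j mod int N" for i j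
  proof
    assume "C i = C j"
    moreover have "psl (transl c (of_int (0 * int N + i) * w)) \<in> C i" unfolding C_def by blast
    ultimately obtain n where "of_int (0 * int N + i) * w = of_int (n * int N + j) * w"
      unfolding C_def by (auto simp: psl_transl_eq_iff)
    then have "0 * int N + i = n * int N + j" using w by (metis less_irrefl mult_cancel_right of_int_eq_iff)
    then have "i = n * int N + j" by simp
    then show "i mod int N = j mod int N" by simp
  next
    assume "i mod int N = j mod int N"
    then obtain k where k: "i = j + int N * k" by (metis mod_eqE)
    have shift: "n * int N + i = (n + k) * int N + j" "n * int N + j = (n - k) * int N + i" for n
      unfolding k by (simp_all add: algebra_simps)
    show "C i = C j"
      unfolding C_def using shift by (metis (no_types, lifting) image_subset_iff rangeI subset_antisym)
  qed
  have "rcosets\<^bsub>PSL2R\<lparr>carrier := stab G c\<rparr>\<^esub> (stab H c) = range C"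
    unfolding RCOSETS_def by (auto simp: stab_cuspidal[OF G] C)
  also have "\<dots> = C ` {0..<int N}"
  proof (intro equalityI subsetI)
    fix x assume "x \<in> range C"
    then obtain j where "x = C j" by blast
    then have "x = C (j mod int N)" by (simp add: eq)
    then show "x \<in> C ` {0..<int N}" using N by auto
  qed auto
  also have "card \<dots> = N"
    by (subst card_image) (auto simp: inj_on_def eq)
  finally show ?thesis .
qed

section \<open>Expansions at cusps\<close>

text \<open>\<open>log_arg h\<close> recovers \<open>A\<^sub>c\<^sup>-\<^sup>1 \<tau>\<close> from \<open>log q\<^sub>c\<close> when \<open>h\<close> is the width of the cusp \<open>c\<close>.\<close>

definition log_arg :: "real \<Rightarrow> complex \<Rightarrow> complex" where
  "log_arg h z = of_real h * z / (2 * of_real pi * \<i>)"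

lemma log_arg_UH [simp]:
  assumes "h > 0" "Re z < 0"
  shows "log_arg h z \<in> UH"
proof -
  have "log_arg h z = - \<i> * of_real (h / (2 * pi)) * z"
    by (simp add: log_arg_def field_simps)
  then have "Im (log_arg h z) = - (h / (2 * pi)) * Re z" by simp
  also have "\<dots> > 0" using assms by (intro mult_neg_neg) auto
  finally show ?thesis by (simp add: UH_def)
qed

text \<open>With tau = c - 1 / sigma the prefactor (tau - c)^(-k) of the expansion equals (-1)^k
  sigma^k, while slashing by \<open>A_cusp c\<close> contributes sigma^(-k). This sign is what
  remains when the two are multiplied.\<close>

definition cusp_sign :: "int \<Rightarrow> boundary \<Rightarrow> complex" where
  "cusp_sign k c = (case c of Infty \<Rightarrow> 1 | Pt _ \<Rightarrow> (- 1) powi k)"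

lemma cusp_sign_square: "cusp_sign k c * cusp_sign k c = 1"
  by (cases c) (auto simp: cusp_sign_def simp flip: power_int_mult_distrib)

lemma eps_mob_A_cusp:
  assumes "\<sigma> \<in> UH"
  shows "eps k c (mob (A_cusp c) \<sigma>) = cusp_sign k c * aut (A_cusp c) \<sigma> powi k"
proof (cases c)
  case (Pt x)
  have nz: "\<sigma> \<noteq> 0" using assms by (auto simp: UH_def)
  have "mob (A_cusp c) \<sigma> - of_real x = (- 1) * inverse \<sigma>"
    using nz by (simp add: Pt A_cusp_Pt mob_def aut_def field_simps del: A_cusp.simps)
  moreover have "((- 1 :: complex) * inverse \<sigma>) powi (- k) = (- 1) powi (- k) * inverse \<sigma> powi (- k)"
    by (rule power_int_mult_distrib)
  moreover have "(- 1 :: complex) powi (- k) = (- 1) powi k"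
    by (simp add: power_int_minus flip: power_int_inverse)
  moreover have "inverse \<sigma> powi (- k) = \<sigma> powi k"
    by (simp add: power_int_minus power_int_inverse)
  ultimately show ?thesis
    by (simp add: Pt A_cusp_Pt cusp_sign_def aut_def del: A_cusp.simps)
qed (auto simp: cusp_sign_def)

lemma log_q_mob:
  assumes "cusp_width K c = h" "h > 0" "Re z < 0"
  shows "log_q K c (mob (A_cusp c) (log_arg h z)) = z"
  using assms by (simp add: log_q_def) (simp add: log_arg_def)

lemma log_q_Re:
  assumes "cusp_width K c = h" "h > 0" "\<tau> \<in> UH"
  shows "Re (log_q K c \<tau>) < 0" "mob (A_cusp c) (log_arg h (log_q K c \<tau>)) = \<tau>"
proof -
  have eq: "log_arg h (log_q K c \<tau>) = mob (sinv (A_cusp c)) \<tau>"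
    using assms by (simp add: log_arg_def log_q_def)
  then show "mob (A_cusp c) (log_arg h (log_q K c \<tau>)) = \<tau>" using assms by simp
  have "Im (mob (sinv (A_cusp c)) \<tau>) > 0" using mob_UH[of "sinv (A_cusp c)" \<tau>] assms by (simp add: UH_def)
  moreover have "log_q K c \<tau> = \<i> * of_real (2 * pi / h) * mob (sinv (A_cusp c)) \<tau>"
    using assms by (simp add: log_q_def)
  ultimately show "Re (log_q K c \<tau>) < 0" using assms by simp
qed

lemma slash_A_cusp:
  assumes "\<sigma> \<in> UH" "f (mob (A_cusp c) \<sigma>) = eps k c (mob (A_cusp c) \<sigma>) * v"
  shows "slash k (A_cusp c) f \<sigma> = cusp_sign k c * v"
  using assms by (simp add: slash_def eps_mob_A_cusp power_int_minus)

text \<open>The substitution tau = A_c (\<open>log_arg h z\<close>) makes log q equal to z and turns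
  the prefactor \<open>eps\<close> into the automorphy factor of \<open>A_cusp c\<close>, up to
  \<open>cusp_sign\<close>, which the coefficients absorb. Afterwards each component can be treated
  on its own.\<close>

lemma log_expansion_iff:
  assumes h: "cusp_width K c = h" "h > 0" and X: "\<And>\<tau>. \<tau> \<in> UH \<Longrightarrow> X \<tau> \<in> carrier_vec m"
  shows "log_expansion K m k \<rho> X c \<longleftrightarrow> (\<exists>bs. jordan_nf (\<rho> (t_cusp K c)) bs \<and>
    (\<forall>r<m. log_series bs (\<lambda>z. slash k (A_cusp c) (\<lambda>\<tau>. vec_index (X \<tau>) r) (log_arg h z))))"
proof
  assume "log_expansion K m k \<rho> X c"
  then obtain bs M a where jnf: "jordan_nf (\<rho> (t_cusp K c)) bs"
    and a: "\<And>\<tau> r. \<tau> \<in> UH \<Longrightarrow> r < m \<Longrightarrow>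
           (\<forall>i<length bs. \<forall>j<fst (bs ! i).
              (\<lambda>n. vec_index (a i j n) r * q_cusp K c \<tau> powi n) summable_on {- M..}) \<and>
           vec_index (X \<tau>) r = eps k c \<tau> *
             (\<Sum>i<length bs. \<Sum>j<fst (bs ! i).
                log_q K c \<tau> ^ j * exp (of_real (mu (snd (bs ! i))) * log_q K c \<tau>) *
                (\<Sum>\<^sub>\<infinity>n\<in>{- M..}. vec_index (a i j n) r * q_cusp K c \<tau> powi n))"
    unfolding log_expansion_def by blast
  have "log_series bs (\<lambda>z. slash k (A_cusp c) (\<lambda>\<tau>. vec_index (X \<tau>) r) (log_arg h z))" if r: "r < m" for r
  proof -
    define f where "f i j z = cusp_sign k c * (\<Sum>\<^sub>\<infinity>n\<in>{- M..}. vec_index (a i j n) r * exp z powi n)" for i j z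
    have "q_laurent (f i j)" if "i < length bs" "j < fst (bs ! i)" for i j
    proof -
      have "((\<lambda>n. (if n < - M then 0 else cusp_sign k c * vec_index (a i j n) r) * exp z powi n) has_sum f i j z) UNIV"
        if z: "Re z < 0" for z
      proof -
        have "(\<lambda>n. vec_index (a i j n) r * exp z powi n) summable_on {- M..}"
          using a[of "mob (A_cusp c) (log_arg h z)" r] r z h \<open>i < length bs\<close> \<open>j < fst (bs ! i)\<close>
          by (simp add: q_cusp_def log_q_mob)
        then have "((\<lambda>n. cusp_sign k c * (vec_index (a i j n) r * exp z powi n)) has_sum f i j z) {- M..}"
          unfolding f_def by (intro has_sum_cmult_right has_sum_infsum)
        then show ?thesis
          by (rule has_sum_cong_neutral[THEN iffD1, rotated -1]) auto
      qed
      then show ?thesis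
        unfolding q_laurent_def
        by (intro exI[of _ "\<lambda>n. if n < - M then 0 else cusp_sign k c * vec_index (a i j n) r"] exI[of _ M]) auto
    qed
    moreover have "slash k (A_cusp c) (\<lambda>\<tau>. vec_index (X \<tau>) r) (log_arg h z) = log_sum bs f z" if z: "Re z < 0" for z
    proof -
      let ?\<tau> = "mob (A_cusp c) (log_arg h z)"
      have UH: "?\<tau> \<in> UH" using z h by simp
      have "slash k (A_cusp c) (\<lambda>\<tau>. vec_index (X \<tau>) r) (log_arg h z) =
          cusp_sign k c * (\<Sum>i<length bs. \<Sum>j<fst (bs ! i).
                z ^ j * exp (of_real (mu (snd (bs ! i))) * z) *
                (\<Sum>\<^sub>\<infinity>n\<in>{- M..}. vec_index (a i j n) r * exp z powi n))"
        using conjunct2[OF a[OF UH r]] z h by (intro slash_A_cusp) (auto simp: q_cusp_def log_q_mob)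
      then show ?thesis by (simp add: f_def sum_distrib_left mult_ac)
    qed
    ultimately show ?thesis unfolding log_series_def by (intro exI[of _ f]) blast
  qed
  then show "\<exists>bs. jordan_nf (\<rho> (t_cusp K c)) bs \<and>
    (\<forall>r<m. log_series bs (\<lambda>z. slash k (A_cusp c) (\<lambda>\<tau>. vec_index (X \<tau>) r) (log_arg h z)))"
    using jnf by blast
next
  assume "\<exists>bs. jordan_nf (\<rho> (t_cusp K c)) bs \<and>
    (\<forall>r<m. log_series bs (\<lambda>z. slash k (A_cusp c) (\<lambda>\<tau>. vec_index (X \<tau>) r) (log_arg h z)))"
  then obtain bs where jnf: "jordan_nf (\<rho> (t_cusp K c)) bs"
    and ls: "\<And>r. r < m \<Longrightarrow> log_series bs (\<lambda>z. slash k (A_cusp c) (\<lambda>\<tau>. vec_index (X \<tau>) r) (log_arg h z))"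
    by blast
  have "\<forall>r. \<exists>f. r < m \<longrightarrow> (\<forall>i<length bs. \<forall>j<fst (bs ! i). q_laurent (f i j)) \<and>
     (\<forall>z. Re z < 0 \<longrightarrow> slash k (A_cusp c) (\<lambda>\<tau>. vec_index (X \<tau>) r) (log_arg h z) =
       log_sum bs f z)"
    using ls unfolding log_series_def by blast
  from choice[OF this] obtain f where f: "\<And>r i j. r < m \<Longrightarrow> i < length bs \<Longrightarrow> j < fst (bs ! i) \<Longrightarrow> q_laurent (f r i j)"
    "\<And>r z. r < m \<Longrightarrow> Re z < 0 \<Longrightarrow> slash k (A_cusp c) (\<lambda>\<tau>. vec_index (X \<tau>) r) (log_arg h z) =
       log_sum bs (f r) z"
    by blast
  define coeffs where "coeffs f a M \<longleftrightarrow> (\<forall>n. n < - M \<longrightarrow> a n = 0) \<and>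
     (\<forall>z. Re z < 0 \<longrightarrow> ((\<lambda>n. a n * exp z powi n) has_sum f z) UNIV)"
    for f and a :: "int \<Rightarrow> complex" and M :: int
  have "\<forall>r i j. \<exists>a M. r < m \<longrightarrow> i < length bs \<longrightarrow> j < fst (bs ! i) \<longrightarrow> coeffs (f r i j) a M"
    using f(1) unfolding q_laurent_def coeffs_def by blast
  then obtain a M where "\<forall>r i j. r < m \<longrightarrow> i < length bs \<longrightarrow> j < fst (bs ! i) \<longrightarrow> coeffs (f r i j) (a r i j) (M r i j)"
    by metis
  then have a: "\<And>n. n < - M r i j \<Longrightarrow> a r i j n = 0"
    "\<And>z. Re z < 0 \<Longrightarrow> ((\<lambda>n. a r i j n * exp z powi n) has_sum f r i j z) UNIV"
    if "r < m" "i < length bs" "j < fst (bs ! i)" for r i j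
    using that unfolding coeffs_def by blast+
  \<comment> \<open>The definition wants one order of pole for all components, blocks and powers of
    the logarithm. The sum of the finitely many absolute values bounds each of them.\<close>
  define N where "N = (\<Sum>r<m. \<Sum>i<length bs. \<Sum>j<fst (bs ! i). \<bar>M r i j\<bar>)"
  have N: "M r i j \<le> N" if "r < m" "i < length bs" "j < fst (bs ! i)" for r i j
  proof -
    have "\<bar>M r i j\<bar> \<le> (\<Sum>j<fst (bs ! i). \<bar>M r i j\<bar>)"
      using that by (intro member_le_sum) auto
    also have "\<dots> \<le> (\<Sum>i<length bs. \<Sum>j<fst (bs ! i). \<bar>M r i j\<bar>)"
      using that by (intro member_le_sum[of i _ "\<lambda>i. \<Sum>j<fst (bs ! i). \<bar>M r i j\<bar>"]) (auto intro: sum_nonneg)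
    also have "\<dots> \<le> N"
      unfolding N_def using that
      by (intro member_le_sum[of r _ "\<lambda>r. \<Sum>i<length bs. \<Sum>j<fst (bs ! i). \<bar>M r i j\<bar>"]) (auto intro: sum_nonneg)
    finally show ?thesis by simp
  qed
  \<comment> \<open>The scalar series of the components are reassembled into coefficient vectors;
    the sign is put back here.\<close>
  define b where "b i j n = Matrix.vec m (\<lambda>r. cusp_sign k c * a r i j n)" for i j n
  have hs: "((\<lambda>n. vec_index (b i j n) r * exp z powi n) has_sum cusp_sign k c * f r i j z) {- N..}"
    if *: "r < m" "i < length bs" "j < fst (bs ! i)" and z: "Re z < 0" for r i j z
  proof -
    have "((\<lambda>n. cusp_sign k c * (a r i j n * exp z powi n)) has_sum cusp_sign k c * f r i j z) UNIV"
      using a(2)[OF * z] by (rule has_sum_cmult_right)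
    then show ?thesis
      by (rule has_sum_cong_neutral[THEN iffD1, rotated -1]) (use a(1)[OF *] N[OF *] * in \<open>auto simp: b_def\<close>)
  qed
  have "(\<forall>i<length bs. \<forall>j<fst (bs ! i).
              (\<lambda>n. vec_index (b i j n) r * q_cusp K c \<tau> powi n) summable_on {- N..}) \<and>
           vec_index (X \<tau>) r = eps k c \<tau> *
             (\<Sum>i<length bs. \<Sum>j<fst (bs ! i).
                log_q K c \<tau> ^ j * exp (of_real (mu (snd (bs ! i))) * log_q K c \<tau>) *
                (\<Sum>\<^sub>\<infinity>n\<in>{- N..}. vec_index (b i j n) r * q_cusp K c \<tau> powi n))"
    if \<tau>: "\<tau> \<in> UH" and r: "r < m" for \<tau> r
  proof -
    define z where "z = log_q K c \<tau>"
    note z = log_q_Re[OF h \<tau>, folded z_def]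
    have UH: "log_arg h z \<in> UH" using z h by simp
    have s0: "cusp_sign k c \<noteq> 0" using cusp_sign_square[of k c] by auto
    have "slash k (A_cusp c) (\<lambda>\<tau>. vec_index (X \<tau>) r) (log_arg h z) = aut (A_cusp c) (log_arg h z) powi (- k) * vec_index (X \<tau>) r"
      by (simp add: slash_def z)
    moreover have "aut (A_cusp c) (log_arg h z) powi k \<noteq> 0" using UH by simp
    ultimately have "vec_index (X \<tau>) r = aut (A_cusp c) (log_arg h z) powi k *
        slash k (A_cusp c) (\<lambda>\<tau>. vec_index (X \<tau>) r) (log_arg h z)"
      by (simp add: power_int_minus)
    also have "aut (A_cusp c) (log_arg h z) powi k = eps k c \<tau> * cusp_sign k c"
      using eps_mob_A_cusp[OF UH, of k c] z cusp_sign_square[of k c] by (simp add: mult_ac)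
    also have "eps k c \<tau> * cusp_sign k c * slash k (A_cusp c) (\<lambda>\<tau>. vec_index (X \<tau>) r) (log_arg h z) =
      eps k c \<tau> * (\<Sum>i<length bs. \<Sum>j<fst (bs ! i). z ^ j * exp (of_real (mu (snd (bs ! i))) * z) * (cusp_sign k c * f r i j z))"
      unfolding f(2)[OF r z(1)] by (simp add: sum_distrib_left mult_ac)
    also have "(\<Sum>i<length bs. \<Sum>j<fst (bs ! i). z ^ j * exp (of_real (mu (snd (bs ! i))) * z) * (cusp_sign k c * f r i j z))
      = (\<Sum>i<length bs. \<Sum>j<fst (bs ! i). z ^ j * exp (of_real (mu (snd (bs ! i))) * z) *
           (\<Sum>\<^sub>\<infinity>n\<in>{- N..}. vec_index (b i j n) r * exp z powi n))"
      using infsumI[OF hs[OF r _ _ z(1)]] by (intro sum.cong refl) auto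
    finally show ?thesis
      using hs[OF r _ _ z(1)] by (auto simp: q_cusp_def z_def[symmetric] dest: has_sum_imp_summable)
  qed
  then show "log_expansion K m k \<rho> X c"
    unfolding log_expansion_def using jnf
    by (intro exI[of _ bs] exI[of _ N] exI[of _ b]) (auto simp: b_def)
qed

text \<open>Slashing by B and then by A_c is slashing by A_c' and then by the triangular matrix U.
  In the coordinates log q the map sigma -> alpha^2 sigma + alpha beta reads z -> z / N + i d,
  because h' = N alpha^2 h. The lift uses general N, a mere change of coordinates uses N =
  1.\<close>

lemma log_series_slash_transfer:
  assumes B: "B \<in> carrier SL2R" and U: "\<alpha> \<noteq> 0" "B ** A_cusp c = A_cusp c' ** mat22 \<alpha> \<beta> 0 (1 / \<alpha>)"
    and h: "h > 0" "h' > 0" "h' = of_nat N * \<alpha>\<^sup>2 * h"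
    and F: "log_series bs (\<lambda>z. slash k (A_cusp c') f (log_arg h' z))"
    and unimod: "\<And>s l. (s, l) \<in> set bs \<Longrightarrow> cmod l = 1"
    and blocks: "\<And>s l r. (s, l) \<in> set bs \<Longrightarrow> r < N \<Longrightarrow>
      \<exists>s'\<ge>s. (s', exp (2 * of_real pi * \<i> * of_real ((mu l + of_nat r) / of_nat N))) \<in> set bs'"
  shows "log_series bs' (\<lambda>z. slash k (A_cusp c) (slash k B f) (log_arg h z))"
proof -
  have N: "N > 0" using h by (intro Nat.gr0I) auto
  \<comment> \<open>Chosen so that \<open>log_arg h'\<close> sends i d to the translation part alpha
    beta of U.\<close>
  define d where "d = 2 * pi * \<alpha> * \<beta> / h'"
  let ?U = "mat22 \<alpha> \<beta> 0 (1 / \<alpha>)"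
  have Uc: "?U \<in> carrier SL2R" using U(1) by (simp add: SL2R_carrier)
  have "log_series bs' (\<lambda>z. slash k (A_cusp c') f (log_arg h' (z / of_nat N + \<i> * of_real d)))"
    by (rule log_series_rescale[OF F N unimod blocks])
  then have "log_series bs' (\<lambda>z. of_real (1 / \<alpha>) powi (- k) *
      slash k (A_cusp c') f (log_arg h' (z / of_nat N + \<i> * of_real d)))"
    by (rule log_series_cmult)
  then show ?thesis
  proof (rule log_series_cong[rotated])
    fix z assume z: "Re z < 0"
    have UH: "log_arg h z \<in> UH" using h z by simp
    have "slash k (A_cusp c) (slash k B f) (log_arg h z) = slash k (A_cusp c' ** ?U) f (log_arg h z)"
      using B UH by (simp add: slash_mult[symmetric] U(2))
    also have "\<dots> = slash k ?U (slash k (A_cusp c') f) (log_arg h z)"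
      using Uc UH by (simp add: slash_mult)
    also have "\<dots> = of_real (1 / \<alpha>) powi (- k) * slash k (A_cusp c') f (mob ?U (log_arg h z))"
      by (simp add: slash_def aut_def)
    also have "mob ?U (log_arg h z) = log_arg h' (z / of_nat N + \<i> * of_real d)"
    proof -
      have 1: "of_real h' / (2 * of_real pi * \<i>) * (\<i> * of_real d) = (of_real (\<alpha> * \<beta>) :: complex)"
        using h(2) by (simp add: d_def)
      have 2: "of_real h' / (2 * of_real pi * \<i>) * (z / of_nat N) = of_real (\<alpha>\<^sup>2 * h) * z / (2 * of_real pi * \<i>)"
        using N unfolding h(3) by (simp add: field_simps)
      have "log_arg h' (z / of_nat N + \<i> * of_real d) = of_real h' / (2 * of_real pi * \<i>) * (z / of_nat N)
          + of_real h' / (2 * of_real pi * \<i>) * (\<i> * of_real d)"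
        by (simp add: log_arg_def ring_distribs add_divide_distrib)
      also have "\<dots> = of_real \<alpha> * (of_real \<alpha> * log_arg h z + of_real \<beta>)"
        unfolding 1 2 by (simp add: log_arg_def power2_eq_square ring_distribs)
      also have "\<dots> = mob ?U (log_arg h z)"
        using U(1) by (simp add: mob_def aut_def)
      finally show ?thesis by simp
    qed
    finally show "of_real (1 / \<alpha>) powi (- k) *
      slash k (A_cusp c') f (log_arg h' (z / of_nat N + \<i> * of_real d)) =
      slash k (A_cusp c) (slash k B f) (log_arg h z)" by simp
  qed
qed

section \<open>Induced representations\<close>

text \<open>Lets identities between induced matrices be verified on vectors, one coset block at a
  time.\<close>

lemma mat_eq_of_mult_vec:
  fixes A B :: "'a::comm_ring_1 Matrix.mat"
  assumes "A \<in> carrier_mat nr nc" "B \<in> carrier_mat nr nc"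
    and "\<And>v. v \<in> carrier_vec nc \<Longrightarrow> A *\<^sub>v v = B *\<^sub>v v"
  shows "A = B"
proof (rule eq_matI)
  fix i j assume ij: "i < dim_row B" "j < dim_col B"
  have "vec_index (A *\<^sub>v unit_vec nc j) i = vec_index (B *\<^sub>v unit_vec nc j) i"
    using assms(3) by simp
  then show "A $$ (i, j) = B $$ (i, j)"
    using assms(1,2) ij by (simp add: scalar_prod_right_unit[of _ nc])
qed (use assms in auto)

lemma sum_blocks: "(\<Sum>s<d * m. f s) = (\<Sum>b<d. \<Sum>t<m. f (b * m + t))" for f :: "nat \<Rightarrow> 'a::comm_monoid_add"
proof -
  have "(\<Sum>s<d * m. f s) = (\<Sum>b<d. sum f {b * m..<b * m + m})" by (rule sum.nat_group[symmetric])
  also have "\<dots> = (\<Sum>b<d. \<Sum>t<m. f (b * m + t))"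
  proof (rule sum.cong[OF refl])
    fix b
    show "sum f {b * m..<b * m + m} = (\<Sum>t<m. f (b * m + t))"
      using sum.shift_bounds_nat_ivl[of f 0 "b * m" m] by (simp add: atLeast0LessThan add.commute)
  qed
  finally show ?thesis .
qed

lemma block_index_less: "a < d \<Longrightarrow> r < m \<Longrightarrow> a * m + r < d * m" for a d r m :: nat
proof -
  assume "a < d" "r < m"
  then have "a * m + r < (a + 1) * m" by simp
  also have "\<dots> \<le> d * m" using \<open>a < d\<close> by (intro mult_right_mono) auto
  finally show ?thesis .
qed

lemma GL_simps:
  "carrier (GL m) = Units (ring_mat TYPE(complex) m ())" "A \<otimes>\<^bsub>GL m\<^esub> B = A * B" "\<one>\<^bsub>GL m\<^esub> = 1\<^sub>m m"
  by (simp_all add: GL_def units_of_def ring_mat_def)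

lemma group_GL: "group (GL m)"
  unfolding GL_def by (intro monoid.units_group ring.is_monoid ring_mat)

lemma GL_I:
  assumes "A \<in> carrier_mat m m" "B \<in> carrier_mat m m" "A * B = 1\<^sub>m m" "B * A = 1\<^sub>m m"
  shows "A \<in> carrier (GL m)"
  using assms unfolding GL_simps Units_def by (auto simp: ring_mat_simps)

lemma representation_facts:
  assumes "subgroup K SL2R" "representation K m \<rho>"
  shows "\<And>A. A \<in> K \<Longrightarrow> \<rho> A \<in> carrier_mat m m"
    "\<And>A B. A \<in> K \<Longrightarrow> B \<in> K \<Longrightarrow> \<rho> (A ** B) = \<rho> A * \<rho> B"
    "\<rho> I2 = 1\<^sub>m m"
proof -
  have hom: "\<rho> \<in> hom (SL2R\<lparr>carrier := K\<rparr>) (GL m)" using assms(2) by (simp add: representation_def)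
  interpret group_hom "SL2R\<lparr>carrier := K\<rparr>" "GL m" \<rho>
    using hom SL.subgroup_imp_group[OF assms(1)] group_GL
    by (intro group_hom.intro group_hom_axioms.intro) auto
  show "\<rho> I2 = 1\<^sub>m m" using hom_one by (simp add: GL_simps)
  show "\<rho> A \<in> carrier_mat m m" if "A \<in> K" for A
    using hom_closed[of A] that by (simp add: GL_simps Units_def ring_mat_simps)
  show "\<rho> (A ** B) = \<rho> A * \<rho> B" if "A \<in> K" "B \<in> K" for A B
    using hom_mult[of A B] that by (simp add: GL_simps)
qed

section \<open>Projections onto and inclusions of the coset blocks\<close>

definition vec_block :: "nat \<Rightarrow> nat \<Rightarrow> complex Matrix.vec \<Rightarrow> complex Matrix.vec" where
  "vec_block m a v = Matrix.vec m (\<lambda>r. vec_index v (a * m + r))"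

definition block_vec :: "nat \<Rightarrow> nat \<Rightarrow> nat \<Rightarrow> complex Matrix.vec \<Rightarrow> complex Matrix.vec" where
  "block_vec d m a w = Matrix.vec (d * m) (\<lambda>p. if p div m = a then vec_index w (p mod m) else 0)"

lemma vec_block_carrier [simp]: "vec_block m a v \<in> carrier_vec m"
  by (simp add: vec_block_def)

lemma block_vec_carrier [simp]: "block_vec d m a w \<in> carrier_vec (d * m)"
  by (simp add: block_vec_def)

lemma vec_eq_of_blocks:
  assumes "v \<in> carrier_vec (d * m)" "w \<in> carrier_vec (d * m)"
    "\<And>a. a < d \<Longrightarrow> vec_block m a v = vec_block m a w"
  shows "v = w"
proof (rule eq_vecI)
  fix p assume "p < dim_vec w"
  then have p: "p < d * m" using assms by simp
  then have m: "m > 0" by (cases m) auto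
  have "p div m < d" using p by (simp add: less_mult_imp_div_less)
  then have "vec_index (vec_block m (p div m) v) (p mod m) = vec_index (vec_block m (p div m) w) (p mod m)"
    using assms(3) by simp
  then show "vec_index v p = vec_index w p" using m by (simp add: vec_block_def)
qed (use assms in auto)

lemma vec_block_add:
  assumes "v \<in> carrier_vec (d * m)" "w \<in> carrier_vec (d * m)" "a < d"
  shows "vec_block m a (v + w) = vec_block m a v + vec_block m a w"
  using assms block_index_less[OF assms(3)] by (auto simp: vec_block_def intro!: eq_vecI)

lemma vec_block_minus:
  assumes "v \<in> carrier_vec (d * m)" "w \<in> carrier_vec (d * m)" "a < d"
  shows "vec_block m a (v - w) = vec_block m a v - vec_block m a w"
  using assms block_index_less[OF assms(3)] by (auto simp: vec_block_def intro!: eq_vecI)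

lemma vec_block_smult:
  assumes "v \<in> carrier_vec (d * m)" "a < d"
  shows "vec_block m a (c \<cdot>\<^sub>v v) = c \<cdot>\<^sub>v vec_block m a v"
  using assms block_index_less[OF assms(2)] by (auto simp: vec_block_def intro!: eq_vecI)

lemma vec_block_block_vec:
  assumes "w \<in> carrier_vec m" "b < d"
  shows "vec_block m b (block_vec d m a w) = (if b = a then w else 0\<^sub>v m)"
  using assms block_index_less[OF assms(2)]
  by (auto simp: vec_block_def block_vec_def intro!: eq_vecI)

lemma vec_block_zero: "a < d \<Longrightarrow> vec_block m a (0\<^sub>v (d * m)) = 0\<^sub>v m"
  using block_index_less[of a d] by (auto simp: vec_block_def)

lemma l_coset_eq_iff:
  assumes H: "subgroup H SL2R" and A: "A \<in> carrier SL2R" and B: "B \<in> carrier SL2R"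
  shows "A <#\<^bsub>SL2R\<^esub> H = B <#\<^bsub>SL2R\<^esub> H \<longleftrightarrow> sinv A ** B \<in> H"
proof
  assume eq: "A <#\<^bsub>SL2R\<^esub> H = B <#\<^bsub>SL2R\<^esub> H"
  have "B \<in> B <#\<^bsub>SL2R\<^esub> H"
    using subgroup.one_closed[OF H] by (auto simp: l_coset_def intro!: bexI[of _ I2])
  then have "B \<in> A <#\<^bsub>SL2R\<^esub> H" using eq by simp
  then obtain h where "h \<in> H" "B = A ** h" by (auto simp: l_coset_def)
  then show "sinv A ** B \<in> H" using A by simp
next
  assume h: "sinv A ** B \<in> H"
  have "A ** x = B ** (sinv (sinv A ** B) ** x)" "B ** x = A ** (sinv A ** B ** x)" for x :: mat2
    using A B by (simp_all add: sinv_mult matrix_mul_assoc[symmetric])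
  moreover have "sinv (sinv A ** B) ** x \<in> H" "sinv A ** B ** x \<in> H" if "x \<in> H" for x
    using subgroup.m_closed[OF H] subgroup.m_inv_closed[OF H] h that by auto
  ultimately show "A <#\<^bsub>SL2R\<^esub> H = B <#\<^bsub>SL2R\<^esub> H"
    unfolding l_coset_def by simp blast
qed

text \<open>The scaling \<open>u\<close> is kept free: the constant 1 yields the induced matrices of
  (a), the multiplier of the power of Delta those of the lift.\<close>

locale induced_representation =
  fixes G H :: "mat2 set" and m :: nat and \<rho> :: "mat2 \<Rightarrow> complex Matrix.mat"
    and gs :: "mat2 list" and u :: "mat2 \<Rightarrow> complex"
  assumes G: "subgroup G SL2R" and H: "subgroup H SL2R" and HG: "H \<subseteq> G"
    and rep: "representation H m \<rho>" and reps: "left_coset_reps G H gs"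
    and u_nonzero: "\<And>a. a < length gs \<Longrightarrow> u (gs ! a) \<noteq> 0"
begin

abbreviation d :: nat where "d \<equiv> length gs"

abbreviation R :: "mat2 \<Rightarrow> complex Matrix.mat" where "R \<equiv> rescaled_induced u H m \<rho> gs"

lemma G_SL [simp]: "A \<in> G \<Longrightarrow> A \<in> carrier SL2R"
  using subgroup.mem_carrier[OF G] .

lemma H_G [simp]: "A \<in> H \<Longrightarrow> A \<in> G"
  using HG by blast

lemma G_closed [simp]: "A \<in> G \<Longrightarrow> B \<in> G \<Longrightarrow> A ** B \<in> G" "A \<in> G \<Longrightarrow> sinv A \<in> G" "I2 \<in> G"
  using subgroup.m_closed[OF G] subgroup.m_inv_closed[OF G] subgroup.one_closed[OF G] by auto

lemma H_closed [simp]: "A \<in> H \<Longrightarrow> B \<in> H \<Longrightarrow> A ** B \<in> H" "A \<in> H \<Longrightarrow> sinv A \<in> H" "I2 \<in> H"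
  using subgroup.m_closed[OF H] subgroup.m_inv_closed[OF H] subgroup.one_closed[OF H] by auto

lemma G_pow [simp]: "A \<in> G \<Longrightarrow> A [^]\<^bsub>SL2R\<^esub> (n::nat) \<in> G"
  by (induction n) auto

lemma gs_G [simp]: "a < d \<Longrightarrow> gs ! a \<in> G"
  using reps by (auto simp: left_coset_reps_def)

lemmas \<rho>_carrier [simp] = representation_facts(1)[OF H rep]
  and \<rho>_mult = representation_facts(2)[OF H rep]
  and \<rho>_one = representation_facts(3)[OF H rep]

lemma reps_unique:
  assumes "a < d" "b < d" "sinv (gs ! a) ** gs ! b \<in> H"
  shows "a = b"
proof -
  have "gs ! a <#\<^bsub>SL2R\<^esub> H = gs ! b <#\<^bsub>SL2R\<^esub> H" using assms by (simp add: l_coset_eq_iff[OF H])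
  then show ?thesis
    using reps assms by (auto simp: left_coset_reps_def bij_betw_def inj_on_def)
qed

lemma reps_exist:
  assumes "A \<in> G"
  shows "\<exists>a<d. sinv (gs ! a) ** A \<in> H"
proof -
  have "A <#\<^bsub>SL2R\<^esub> H \<in> (\<lambda>a. gs ! a <#\<^bsub>SL2R\<^esub> H) ` {..<d}"
    using reps assms by (auto simp: left_coset_reps_def bij_betw_def)
  then obtain a where "a < d" "gs ! a <#\<^bsub>SL2R\<^esub> H = A <#\<^bsub>SL2R\<^esub> H" by force
  then show ?thesis using assms l_coset_eq_iff[OF H, of "gs ! a" A] by auto
qed

text \<open>It satisfies \<open>\<gamma> ** gs ! b = gs ! a ** trans \<gamma> a b\<close>, so
  membership in \<open>H\<close> says that \<gamma> sends the coset of \<open>gs ! b\<close> to that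
  of \<open>gs ! a\<close>. For fixed \<gamma> this is a permutation of the indices.\<close>

definition trans :: "mat2 \<Rightarrow> nat \<Rightarrow> nat \<Rightarrow> mat2" where
  "trans \<gamma> a b = sinv (gs ! a) ** \<gamma> ** gs ! b"

lemma trans_G [simp]: "\<gamma> \<in> G \<Longrightarrow> a < d \<Longrightarrow> b < d \<Longrightarrow> trans \<gamma> a b \<in> G"
  by (simp add: trans_def)

lemma trans_mult:
  assumes "\<gamma> \<in> G" "\<delta> \<in> G" "a < d" "b < d" "c < d"
  shows "trans (\<gamma> ** \<delta>) a c = trans \<gamma> a b ** trans \<delta> b c"
  using assms by (simp add: trans_def matrix_mul_assoc[symmetric])

lemma trans_sinv:
  assumes "\<gamma> \<in> G" "a < d" "b < d"
  shows "trans (sinv \<gamma>) a b = sinv (trans \<gamma> b a)"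
  using assms by (simp add: trans_def sinv_mult matrix_mul_assoc)

lemma trans_exists_row:
  assumes "\<gamma> \<in> G" "b < d"
  shows "\<exists>a<d. trans \<gamma> a b \<in> H"
  using reps_exist[of "\<gamma> ** gs ! b"] assms by (simp add: trans_def matrix_mul_assoc)

lemma trans_exists_col:
  assumes "\<gamma> \<in> G" "a < d"
  shows "\<exists>b<d. trans \<gamma> a b \<in> H"
proof -
  obtain b where b: "b < d" "trans (sinv \<gamma>) b a \<in> H"
    using trans_exists_row[of "sinv \<gamma>" a] assms by auto
  then have "sinv (trans (sinv \<gamma>) b a) \<in> H" by (intro H_closed)
  then show ?thesis using b assms by (auto simp: trans_sinv)
qed

lemma trans_unique_col:
  assumes "\<gamma> \<in> G" "a < d" "b < d" "c < d" "trans \<gamma> a b \<in> H" "trans \<gamma> a c \<in> H"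
  shows "b = c"
proof (rule reps_unique)
  have "sinv (gs ! b) ** gs ! c = sinv (trans \<gamma> a b) ** trans \<gamma> a c"
    using assms by (simp add: trans_def sinv_mult matrix_mul_assoc[symmetric])
  then show "sinv (gs ! b) ** gs ! c \<in> H" using assms by simp
qed (use assms in auto)

lemma trans_unique_row:
  assumes "\<gamma> \<in> G" "a < d" "b < d" "c < d" "trans \<gamma> b a \<in> H" "trans \<gamma> c a \<in> H"
  shows "b = c"
  using assms trans_unique_col[of "sinv \<gamma>" a b c] by (simp add: trans_sinv)

lemma R_carrier [simp]: "R \<gamma> \<in> carrier_mat (d * m) (d * m)"
  unfolding rescaled_induced_def induced_def
  by (intro mult_carrier_mat[of _ _ "d * m"] mat_diag_dim) simp

lemma R_index:
  assumes "a < d" "b < d" "r < m" "t < m"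
  shows "R \<gamma> $$ (a * m + r, b * m + t) =
    u (gs ! a) / u (gs ! b) * (if trans \<gamma> a b \<in> H then \<rho> (trans \<gamma> a b) $$ (r, t) else 0)"
proof -
  have I: "induced H m \<rho> gs \<gamma> \<in> carrier_mat (d * m) (d * m)" unfolding induced_def by simp
  show ?thesis
    unfolding rescaled_induced_def
    using I assms block_index_less[OF assms(1,3)] block_index_less[OF assms(2,4)]
    by (simp add: mat_diag_mult_left[OF I] mat_diag_mult_right[of _ "d * m"])
      (simp add: induced_def Let_def trans_def divide_inverse)
qed

text \<open>Block row a has a single nonzero block, at the one b that \<gamma> sends to a.
  Computations with \<open>R\<close> go through this rule rather than through entries.\<close>

lemma vec_block_R:
  assumes "\<gamma> \<in> G" "a < d" "b < d" "trans \<gamma> a b \<in> H" "v \<in> carrier_vec (d * m)"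
  shows "vec_block m a (R \<gamma> *\<^sub>v v) = (u (gs ! a) / u (gs ! b)) \<cdot>\<^sub>v (\<rho> (trans \<gamma> a b) *\<^sub>v vec_block m b v)"
proof (rule eq_vecI)
  fix r assume "r < dim_vec ((u (gs ! a) / u (gs ! b)) \<cdot>\<^sub>v (\<rho> (trans \<gamma> a b) *\<^sub>v vec_block m b v))"
  then have r: "r < m" using \<rho>_carrier[OF assms(4)] by simp
  note ar = block_index_less[OF assms(2) r]
  have "vec_index (vec_block m a (R \<gamma> *\<^sub>v v)) r = (\<Sum>s<d * m. R \<gamma> $$ (a * m + r, s) * vec_index v s)"
    using r ar assms(5) carrier_matD[OF R_carrier[of \<gamma>]]
    by (simp add: vec_block_def scalar_prod_def atLeast0LessThan)
  also have "\<dots> = (\<Sum>b'<d. \<Sum>t<m. R \<gamma> $$ (a * m + r, b' * m + t) * vec_index v (b' * m + t))"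
    by (rule sum_blocks)
  also have "\<dots> = (\<Sum>b'<d. if b' = b then \<Sum>t<m. u (gs ! a) / u (gs ! b) * (\<rho> (trans \<gamma> a b) $$ (r, t) * vec_index v (b * m + t)) else 0)"
  proof (intro sum.cong refl)
    fix b' assume b': "b' \<in> {..<d}"
    then have "trans \<gamma> a b' \<in> H \<longleftrightarrow> b' = b" using trans_unique_col assms by auto
    then show "(\<Sum>t<m. R \<gamma> $$ (a * m + r, b' * m + t) * vec_index v (b' * m + t)) =
        (if b' = b then \<Sum>t<m. u (gs ! a) / u (gs ! b) * (\<rho> (trans \<gamma> a b) $$ (r, t) * vec_index v (b * m + t)) else 0)"
      using b' assms(2) r by (auto simp: R_index intro!: sum.cong sum.neutral)
  qed
  also have "\<dots> = (\<Sum>t<m. u (gs ! a) / u (gs ! b) * (\<rho> (trans \<gamma> a b) $$ (r, t) * vec_index v (b * m + t)))"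
    using assms(3) by simp
  also have "\<dots> = vec_index ((u (gs ! a) / u (gs ! b)) \<cdot>\<^sub>v (\<rho> (trans \<gamma> a b) *\<^sub>v vec_block m b v)) r"
    using r carrier_matD[OF \<rho>_carrier[OF assms(4)]]
    by (simp add: scalar_prod_def vec_block_def sum_distrib_left atLeast0LessThan)
  finally show "vec_index (vec_block m a (R \<gamma> *\<^sub>v v)) r = \<dots>" .
qed (use carrier_matD[OF \<rho>_carrier[OF assms(4)]] in \<open>simp add: vec_block_def\<close>)

lemma R_mult_vec_carrier [simp]: "v \<in> carrier_vec (d * m) \<Longrightarrow> R \<gamma> *\<^sub>v v \<in> carrier_vec (d * m)"
  by (rule mult_mat_vec_carrier[OF R_carrier])

text \<open>Each block row follows one path of indices a, b, c along which \<open>trans\<close> is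
  multiplicative; the ratios of \<open>u\<close> telescope.\<close>

lemma R_mult:
  assumes "\<gamma> \<in> G" "\<delta> \<in> G"
  shows "R (\<gamma> ** \<delta>) = R \<gamma> * R \<delta>"
proof (rule mat_eq_of_mult_vec[of _ "d * m" "d * m"])
  fix v :: "complex Matrix.vec" assume v: "v \<in> carrier_vec (d * m)"
  have "R (\<gamma> ** \<delta>) *\<^sub>v v = R \<gamma> *\<^sub>v (R \<delta> *\<^sub>v v)"
  proof (rule vec_eq_of_blocks)
    fix a assume a: "a < d"
    obtain b where b: "b < d" "trans \<gamma> a b \<in> H" using trans_exists_col[OF assms(1) a] by blast
    obtain c where c: "c < d" "trans \<delta> b c \<in> H" using trans_exists_col[OF assms(2) b(1)] by blast
    have mult: "trans (\<gamma> ** \<delta>) a c = trans \<gamma> a b ** trans \<delta> b c" using trans_mult assms a b c by blast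
    then have "trans (\<gamma> ** \<delta>) a c \<in> H" using b c by simp
    then have "vec_block m a (R (\<gamma> ** \<delta>) *\<^sub>v v) =
        (u (gs ! a) / u (gs ! c)) \<cdot>\<^sub>v (\<rho> (trans \<gamma> a b) * \<rho> (trans \<delta> b c) *\<^sub>v vec_block m c v)"
      using vec_block_R[of "\<gamma> ** \<delta>" a c v] assms a c v b by (simp add: mult \<rho>_mult)
    also have "\<dots> = (u (gs ! a) / u (gs ! c)) \<cdot>\<^sub>v (\<rho> (trans \<gamma> a b) *\<^sub>v (\<rho> (trans \<delta> b c) *\<^sub>v vec_block m c v))"
      using b c by (simp add: assoc_mult_mat_vec[of _ m m _ m])
    also have "\<dots> = vec_block m a (R \<gamma> *\<^sub>v (R \<delta> *\<^sub>v v))"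
      using assms a b c v u_nonzero mult_mat_vec_carrier[OF \<rho>_carrier[OF c(2)] vec_block_carrier[of m c v]]
      by (simp add: vec_block_R[of \<gamma> a b] vec_block_R[of \<delta> b c] mult_mat_vec[of _ m m] smult_smult_assoc)
    finally show "vec_block m a (R (\<gamma> ** \<delta>) *\<^sub>v v) = vec_block m a (R \<gamma> *\<^sub>v (R \<delta> *\<^sub>v v))" .
  qed (use v in auto)
  then show "R (\<gamma> ** \<delta>) *\<^sub>v v = R \<gamma> * R \<delta> *\<^sub>v v"
    using v by (simp add: assoc_mult_mat_vec[OF R_carrier R_carrier])
qed (use mult_carrier_mat[OF R_carrier R_carrier] in auto)

lemma trans_one: "a < d \<Longrightarrow> trans I2 a a = I2"
  by (simp add: trans_def)

lemma R_one: "R I2 = 1\<^sub>m (d * m)"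
proof (rule mat_eq_of_mult_vec[of _ "d * m" "d * m"])
  fix v :: "complex Matrix.vec" assume v: "v \<in> carrier_vec (d * m)"
  have "R I2 *\<^sub>v v = v"
    by (rule vec_eq_of_blocks) (use v u_nonzero in \<open>auto simp: vec_block_R[OF _ _ _ _ v] trans_one \<rho>_one\<close>)
  then show "R I2 *\<^sub>v v = 1\<^sub>m (d * m) *\<^sub>v v" using v by simp
qed auto

lemma R_pow:
  assumes "\<gamma> \<in> G"
  shows "R (\<gamma> [^]\<^bsub>SL2R\<^esub> (n::nat)) = R \<gamma> ^\<^sub>m n"
  using carrier_matD[OF R_carrier[of \<gamma>]] assms by (induction n) (simp_all add: R_one R_mult)

lemma representation_R: "representation G (d * m) R"
  unfolding representation_def
proof (rule homI)
  fix \<gamma> assume "\<gamma> \<in> carrier (SL2R\<lparr>carrier := G\<rparr>)"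
  then have \<gamma>: "\<gamma> \<in> G" by simp
  show "R \<gamma> \<in> carrier (GL (d * m))"
    by (rule GL_I[of _ _ "R (sinv \<gamma>)"]) (use \<gamma> in \<open>simp_all flip: R_mult add: R_one\<close>)
qed (auto simp: R_mult GL_simps)

text \<open>If \<gamma> fixes the coset of \<open>gs ! a\<close>, then no other coset is sent to or
  from it, so the block is invariant; the two factors \<open>u\<close> cancel.\<close>

lemma R_block_vec:
  assumes "\<gamma> \<in> G" "a < d" "trans \<gamma> a a \<in> H" "w \<in> carrier_vec m"
  shows "R \<gamma> *\<^sub>v block_vec d m a w = block_vec d m a (\<rho> (trans \<gamma> a a) *\<^sub>v w)"
proof (rule vec_eq_of_blocks)
  have hw: "\<rho> (trans \<gamma> a a) *\<^sub>v w \<in> carrier_vec m"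
    using \<rho>_carrier[OF assms(3)] assms(4) by (rule mult_mat_vec_carrier)
  fix b assume b: "b < d"
  obtain c where c: "c < d" "trans \<gamma> b c \<in> H" using trans_exists_col[OF assms(1) b] by blast
  have ba: "b = a \<longleftrightarrow> c = a"
    using trans_unique_col[OF assms(1,2) c(1) assms(2)] trans_unique_row[OF assms(1,2) b assms(2)] c assms by auto
  have "vec_block m b (R \<gamma> *\<^sub>v block_vec d m a w) =
      (u (gs ! b) / u (gs ! c)) \<cdot>\<^sub>v (\<rho> (trans \<gamma> b c) *\<^sub>v vec_block m c (block_vec d m a w))"
    using assms b c by (intro vec_block_R) auto
  also have "\<dots> = vec_block m b (block_vec d m a (\<rho> (trans \<gamma> a a) *\<^sub>v w))"
    using assms b c ba u_nonzero hw \<rho>_carrier[OF c(2)]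
    by (cases "b = a") (auto simp: vec_block_block_vec mult_mat_zero_vec[OF \<rho>_carrier[OF c(2)]])
  finally show "vec_block m b (R \<gamma> *\<^sub>v block_vec d m a w) =
      vec_block m b (block_vec d m a (\<rho> (trans \<gamma> a a) *\<^sub>v w))" .
qed auto

end

section \<open>Eigenvalues and Jordan blocks of induced matrices\<close>

lemma pow_mat_eigenvector:
  fixes A :: "complex Matrix.mat"
  assumes "A \<in> carrier_mat n n" "v \<in> carrier_vec n" "A *\<^sub>v v = l \<cdot>\<^sub>v v"
  shows "A ^\<^sub>m k *\<^sub>v v = l ^ k \<cdot>\<^sub>v v"
proof (induction k)
  case (Suc k)
  have "A ^\<^sub>m Suc k *\<^sub>v v = A ^\<^sub>m k *\<^sub>v (A *\<^sub>v v)"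
    using assms by (simp add: assoc_mult_mat_vec[of _ n n _ n])
  also have "\<dots> = l \<cdot>\<^sub>v (A ^\<^sub>m k *\<^sub>v v)"
    unfolding assms(3) by (rule mult_mat_vec[OF pow_carrier_mat[OF assms(1)] assms(2)])
  finally show ?case by (simp add: Suc smult_smult_assoc)
qed (use assms in auto)

context induced_representation
begin

lemma char_matrix_R_block_vec:
  assumes "\<gamma> \<in> G" "a < d" "trans \<gamma> a a \<in> H" "w \<in> carrier_vec m"
  shows "char_matrix (R \<gamma>) l *\<^sub>v block_vec d m a w = block_vec d m a (char_matrix (\<rho> (trans \<gamma> a a)) l *\<^sub>v w)"
proof -
  have hw: "\<rho> (trans \<gamma> a a) *\<^sub>v w \<in> carrier_vec m"
    using \<rho>_carrier[OF assms(3)] assms(4) by (rule mult_mat_vec_carrier)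
  have sub: "block_vec d m a x - l \<cdot>\<^sub>v block_vec d m a w = block_vec d m a (x - l \<cdot>\<^sub>v w)"
    if "x \<in> carrier_vec m" for x
    by (rule vec_eq_of_blocks[of _ d m])
      (use that assms in \<open>auto simp: vec_block_minus[of _ d] vec_block_smult[of _ d] vec_block_block_vec\<close>)
  show ?thesis
    using assms hw
    by (simp add: char_matrix_mult_vec[OF R_carrier] char_matrix_mult_vec[OF \<rho>_carrier] R_block_vec sub)
qed

lemma block_vec_eq_zero_iff:
  assumes "w \<in> carrier_vec m" "a < d"
  shows "block_vec d m a w = 0\<^sub>v (d * m) \<longleftrightarrow> w = 0\<^sub>v m"
proof
  assume "block_vec d m a w = 0\<^sub>v (d * m)"
  then have "vec_block m a (block_vec d m a w) = vec_block m a (0\<^sub>v (d * m))" by simp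
  then show "w = 0\<^sub>v m" using assms by (simp add: vec_block_block_vec vec_block_zero)
next
  assume w: "w = 0\<^sub>v m"
  show "block_vec d m a w = 0\<^sub>v (d * m)"
    by (rule vec_eq_of_blocks[of _ d m]) (use assms w in \<open>auto simp: vec_block_block_vec vec_block_zero\<close>)
qed

lemma diagonalizable_block:
  assumes "\<gamma> \<in> G" "a < d" "trans \<gamma> a a \<in> H" "diagonalizable (R \<gamma>)"
  shows "diagonalizable (\<rho> (trans \<gamma> a a))"
  unfolding diagonalizable_iff[OF \<rho>_carrier[OF assms(3)]]
proof (intro allI ballI impI)
  let ?e = "block_vec d m a"
  fix l w x assume w: "w \<in> carrier_vec m" and x: "x \<in> carrier_vec m"
    and "\<rho> (trans \<gamma> a a) *\<^sub>v w = l \<cdot>\<^sub>v w + x" "\<rho> (trans \<gamma> a a) *\<^sub>v x = l \<cdot>\<^sub>v x"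
  moreover have "?e (l \<cdot>\<^sub>v w + x) = l \<cdot>\<^sub>v ?e w + ?e x"
    by (rule vec_eq_of_blocks[of _ d m])
      (use w x in \<open>auto simp: vec_block_add[of _ d] vec_block_smult[of _ d] vec_block_block_vec\<close>)
  moreover have "?e (l \<cdot>\<^sub>v x) = l \<cdot>\<^sub>v ?e x"
    by (rule vec_eq_of_blocks[of _ d m])
      (use x in \<open>auto simp: vec_block_smult[of _ d] vec_block_block_vec\<close>)
  ultimately have "R \<gamma> *\<^sub>v ?e w = l \<cdot>\<^sub>v ?e w + ?e x" "R \<gamma> *\<^sub>v ?e x = l \<cdot>\<^sub>v ?e x"
    using R_block_vec[OF assms(1-3)] w x by simp_all
  then have "?e x = 0\<^sub>v (d * m)"
    using assms(4) block_vec_carrier unfolding diagonalizable_iff[OF R_carrier] by blast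
  then show "x = 0\<^sub>v m" by (simp add: block_vec_eq_zero_iff[OF x assms(2)])
qed

lemma diagonalizable_R_imp:
  assumes t: "t \<in> H" and diag: "diagonalizable (R t)"
  shows "diagonalizable (\<rho> t)"
proof -
  \<comment> \<open>The representative of the trivial coset lies in \<open>H\<close> but may differ
    from \<open>I2\<close>, which is why a conjugation inside \<open>H\<close> has to
    follow.\<close>
  obtain a where a: "a < d" "sinv (gs ! a) ** I2 \<in> H" using reps_exist[of I2] by auto
  have "sinv (sinv (gs ! a) ** I2) \<in> H" using a(2) by (rule H_closed)
  then have g: "gs ! a \<in> H" using a(1) by simp
  have mem: "trans t a a \<in> H" using g t by (simp add: trans_def)
  have "similar_mat (\<rho> t) (\<rho> (trans t a a))"
  proof (rule similar_matI)
    show "{\<rho> t, \<rho> (trans t a a), \<rho> (gs ! a), \<rho> (sinv (gs ! a))} \<subseteq> carrier_mat m m"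
      using g t mem by simp
    show "\<rho> (gs ! a) * \<rho> (sinv (gs ! a)) = 1\<^sub>m m" "\<rho> (sinv (gs ! a)) * \<rho> (gs ! a) = 1\<^sub>m m"
      using g by (simp_all add: \<rho>_one flip: \<rho>_mult)
    have "\<rho> (gs ! a) * \<rho> (trans t a a) * \<rho> (sinv (gs ! a)) = \<rho> (gs ! a ** trans t a a ** sinv (gs ! a))"
      using g mem by (simp add: \<rho>_mult)
    also have "gs ! a ** trans t a a ** sinv (gs ! a) = t"
      using g t by (simp add: trans_def matrix_mul_assoc[symmetric])
    finally show "\<rho> t = \<rho> (gs ! a) * \<rho> (trans t a a) * \<rho> (sinv (gs ! a))" by simp
  qed
  then show ?thesis
    using diagonalizable_block[OF _ a(1) mem diag] t diagonalizable_similar by auto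
qed

text \<open>Pigeonhole: two powers of \<gamma> send block a to the same block, and their quotient
  sends it back to itself.\<close>

lemma trans_pow_return:
  assumes "\<gamma> \<in> G" "a < d"
  shows "\<exists>n>0. trans (\<gamma> [^]\<^bsub>SL2R\<^esub> (n::nat)) a a \<in> H"
proof -
  have "\<forall>n. \<exists>b<d. trans (\<gamma> [^]\<^bsub>SL2R\<^esub> (n::nat)) b a \<in> H"
    using trans_exists_row assms by simp
  then obtain f where f: "\<And>n. f n < d" "\<And>n::nat. trans (\<gamma> [^]\<^bsub>SL2R\<^esub> n) (f n) a \<in> H" by metis
  have "finite (range f)" by (rule finite_subset[of _ "{..<d}"]) (use f in auto)
  then have "\<not> inj f" using finite_imageD by blast
  then obtain i j where ij: "i < j" "f i = f j" unfolding inj_on_def by (metis linorder_neqE_nat)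
  have "\<gamma> [^]\<^bsub>SL2R\<^esub> j = \<gamma> [^]\<^bsub>SL2R\<^esub> i ** \<gamma> [^]\<^bsub>SL2R\<^esub> (j - i)"
    using SL.nat_pow_mult[of \<gamma> i "j - i"] ij assms by simp
  then have "trans (\<gamma> [^]\<^bsub>SL2R\<^esub> j) (f i) a = trans (\<gamma> [^]\<^bsub>SL2R\<^esub> i) (f i) a ** trans (\<gamma> [^]\<^bsub>SL2R\<^esub> (j - i)) a a"
    using trans_mult assms f by simp
  then have "trans (\<gamma> [^]\<^bsub>SL2R\<^esub> (j - i)) a a =
     sinv (trans (\<gamma> [^]\<^bsub>SL2R\<^esub> i) (f i) a) ** trans (\<gamma> [^]\<^bsub>SL2R\<^esub> j) (f i) a"
    using assms f by simp
  also have "\<dots> \<in> H" using f[of i] f[of j] ij by simp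
  finally show ?thesis using ij by (intro exI[of _ "j - i"]) auto
qed

lemma trans_parabolic:
  assumes "\<gamma> \<in> G" "a < d"
  shows "parabolic (trans \<gamma> a a) \<longleftrightarrow> parabolic \<gamma>"
  using assms by (simp add: trans_def)

text \<open>An eigenvector has a nonzero block. The n-th power of \<gamma> returning to this block
  makes l^n an eigenvalue of \<rho> at a parabolic element of \<open>H\<close>, and |l^n| = 1 gives
  |l| = 1.\<close>

lemma unimodular_R:
  assumes "unimodular_at_parabolics H \<rho>"
  shows "unimodular_at_parabolics G R"
  unfolding unimodular_at_parabolics_def
proof (intro ballI impI allI)
  fix \<gamma> l assume \<gamma>: "\<gamma> \<in> G" "parabolic \<gamma>" and "eigenvalue (R \<gamma>) l"
  then obtain v where v: "v \<in> carrier_vec (d * m)" "v \<noteq> 0\<^sub>v (d * m)" "R \<gamma> *\<^sub>v v = l \<cdot>\<^sub>v v"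
    unfolding eigenvalue_def eigenvector_def using carrier_matD[OF R_carrier[of \<gamma>]] by auto
  obtain a where a: "a < d" "vec_block m a v \<noteq> 0\<^sub>v m"
    using vec_eq_of_blocks[OF v(1) zero_carrier_vec] v(2) vec_block_zero by metis
  obtain n :: nat where n: "n > 0" "trans (\<gamma> [^]\<^bsub>SL2R\<^esub> n) a a \<in> H"
    using trans_pow_return[OF \<gamma>(1) a(1)] by blast
  let ?h = "trans (\<gamma> [^]\<^bsub>SL2R\<^esub> n) a a"
  have "R (\<gamma> [^]\<^bsub>SL2R\<^esub> n) *\<^sub>v v = l ^ n \<cdot>\<^sub>v v"
    using R_pow[OF \<gamma>(1)] pow_mat_eigenvector[OF R_carrier v(1,3)] by simp
  then have "l ^ n \<cdot>\<^sub>v vec_block m a v = \<rho> ?h *\<^sub>v vec_block m a v"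
    using vec_block_R[of "\<gamma> [^]\<^bsub>SL2R\<^esub> n" a a v] \<gamma> a n v u_nonzero
    by (simp add: vec_block_smult[of _ d])
  then have "eigenvalue (\<rho> ?h) (l ^ n)"
    unfolding eigenvalue_def eigenvector_def using a carrier_matD[OF \<rho>_carrier[OF n(2)]]
    by (intro exI[of _ "vec_block m a v"]) simp
  moreover have "parabolic ?h"
    using \<gamma> a parabolic_pow[of \<gamma> n] by (simp add: trans_parabolic)
  ultimately have "cmod (l ^ n) = 1"
    using assms n(2) unfolding unimodular_at_parabolics_def by blast
  then show "cmod l = 1" using n(1) power_eq_imp_eq_base[of "cmod l" n 1] by (simp add: norm_power)
qed

lemma logarithmic_R:
  assumes "logarithmic H m \<rho>"
  shows "logarithmic G (d * m) R"
  using assms representation_R unimodular_R diagonalizable_R_imp H_G unfolding logarithmic_def by blast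

text \<open>As \<open>- I2\<close> is central, it fixes every coset and acts on every block by
  \<open>\<rho> (- I2)\<close>, so the scalar relation is inherited blockwise.\<close>

lemma R_neg_one:
  assumes neg: "- I2 \<in> H" and c: "\<rho> I2 = c \<cdot>\<^sub>m \<rho> (- I2)"
  shows "R I2 = c \<cdot>\<^sub>m R (- I2)"
proof (rule mat_eq_of_mult_vec[of _ "d * m" "d * m"])
  fix v :: "complex Matrix.vec" assume v: "v \<in> carrier_vec (d * m)"
  have smult: "(c \<cdot>\<^sub>m M) *\<^sub>v x = c \<cdot>\<^sub>v (M *\<^sub>v x)" if "M \<in> carrier_mat n n" "x \<in> carrier_vec n" for M n x
    using that by (auto intro!: eq_vecI)
  have "vec_block m a v = c \<cdot>\<^sub>v vec_block m a (R (- I2) *\<^sub>v v)" if a: "a < d" for a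
  proof -
    have tr: "trans (- I2) a a = - I2" using a by (simp add: trans_def)
    have "vec_block m a (R (- I2) *\<^sub>v v) = \<rho> (- I2) *\<^sub>v vec_block m a v"
      using vec_block_R[OF H_G[OF neg] a a _ v] neg tr u_nonzero[OF a] by simp
    then have "c \<cdot>\<^sub>v vec_block m a (R (- I2) *\<^sub>v v) = \<rho> I2 *\<^sub>v vec_block m a v"
      unfolding c using smult[OF \<rho>_carrier[OF neg] vec_block_carrier] by simp
    then show ?thesis by (simp add: \<rho>_one)
  qed
  then have "v = c \<cdot>\<^sub>v (R (- I2) *\<^sub>v v)"
    by (intro vec_eq_of_blocks[OF v]) (use v in \<open>simp_all add: vec_block_smult[of _ d]\<close>)
  then show "R I2 *\<^sub>v v = c \<cdot>\<^sub>m R (- I2) *\<^sub>v v"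
    using v smult[OF R_carrier v] by (simp add: R_one)
qed auto

end

section \<open>Lifting Jordan chains through (T^n - l^n) / (T - l)\<close>

lemma smult_zero_vec_right: "c \<cdot>\<^sub>v 0\<^sub>v n = (0\<^sub>v n :: complex Matrix.vec)"
  by (auto intro!: eq_vecI)

text \<open>\<open>geom_quot T l n\<close> is the quotient \<open>(T ^ n - l ^ n) / (T - l)\<close>.\<close>

fun geom_quot :: "complex Matrix.mat \<Rightarrow> complex \<Rightarrow> nat \<Rightarrow> complex Matrix.mat" where
  "geom_quot T l 0 = 0\<^sub>m (dim_row T) (dim_row T)"
| "geom_quot T l (Suc n) = l \<cdot>\<^sub>m geom_quot T l n + T ^\<^sub>m n"

lemma geom_quot_carrier [simp]:
  "T \<in> carrier_mat n n \<Longrightarrow> geom_quot T l k \<in> carrier_mat n n"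
  by (induction k) auto

lemma geom_quot_mult_vec:
  assumes T: "T \<in> carrier_mat n n" and v: "v \<in> carrier_vec n"
  shows "geom_quot T l 0 *\<^sub>v v = 0\<^sub>v n"
    "geom_quot T l (Suc k) *\<^sub>v v = l \<cdot>\<^sub>v (geom_quot T l k *\<^sub>v v) + T ^\<^sub>m k *\<^sub>v v"
proof -
  show "geom_quot T l 0 *\<^sub>v v = 0\<^sub>v n"
    using assms by (auto intro!: eq_vecI)
  have Q: "geom_quot T l k \<in> carrier_mat n n" "T ^\<^sub>m k \<in> carrier_mat n n" using T by auto
  have "(l \<cdot>\<^sub>m geom_quot T l k + T ^\<^sub>m k) *\<^sub>v v = l \<cdot>\<^sub>m geom_quot T l k *\<^sub>v v + T ^\<^sub>m k *\<^sub>v v"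
    using Q v by (intro add_mult_distrib_mat_vec[of _ n n]) auto
  also have "l \<cdot>\<^sub>m geom_quot T l k *\<^sub>v v = l \<cdot>\<^sub>v (geom_quot T l k *\<^sub>v v)"
    using Q v by (auto intro!: eq_vecI)
  finally show "geom_quot T l (Suc k) *\<^sub>v v = l \<cdot>\<^sub>v (geom_quot T l k *\<^sub>v v) + T ^\<^sub>m k *\<^sub>v v" by simp
qed

text \<open>The induction rests on l (T^k - l^k) + (T^(k+1) - l T^k) = T^(k+1) - l^(k+1). Having the
  product in both orders shows that the quotient commutes with T - l.\<close>

lemma char_matrix_geom_quot:
  assumes T: "T \<in> carrier_mat n n" and v: "v \<in> carrier_vec n"
  shows "char_matrix T l *\<^sub>v (geom_quot T l k *\<^sub>v v) = T ^\<^sub>m k *\<^sub>v v - l ^ k \<cdot>\<^sub>v v"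
    "geom_quot T l k *\<^sub>v (char_matrix T l *\<^sub>v v) = T ^\<^sub>m k *\<^sub>v v - l ^ k \<cdot>\<^sub>v v"
proof -
  let ?C = "char_matrix T l"
  let ?Q = "geom_quot T l"
  have C: "?C \<in> carrier_mat n n" using T by simp
  have Tk: "T ^\<^sub>m k *\<^sub>v x \<in> carrier_vec n" if "x \<in> carrier_vec n" for k x
    using mult_mat_vec_carrier[OF pow_carrier_mat[OF T] that] .
  have Qk: "?Q k *\<^sub>v x \<in> carrier_vec n" if "x \<in> carrier_vec n" for k x
    using mult_mat_vec_carrier[OF geom_quot_carrier[OF T] that] .
  have Tv: "T *\<^sub>v v \<in> carrier_vec n" using T v by auto
  have Suc_left: "T *\<^sub>v (T ^\<^sub>m k *\<^sub>v v) = T ^\<^sub>m Suc k *\<^sub>v v" for k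
    using pow_mat_mult_vec_add[OF T v, of 1 k] T by (simp add: left_mult_one_mat[of _ n n])
  have Suc_right: "T ^\<^sub>m k *\<^sub>v (T *\<^sub>v v) = T ^\<^sub>m Suc k *\<^sub>v v" for k
    using T v by (simp add: assoc_mult_mat_vec[of _ n n _ n])
  have step: "l \<cdot>\<^sub>v (x - l ^ k \<cdot>\<^sub>v v) + (y - l \<cdot>\<^sub>v x) = y - l ^ Suc k \<cdot>\<^sub>v v"
    if "x \<in> carrier_vec n" "y \<in> carrier_vec n" for x y k
    using that v by (intro eq_vecI) (auto simp: algebra_simps)
  show "?C *\<^sub>v (?Q k *\<^sub>v v) = T ^\<^sub>m k *\<^sub>v v - l ^ k \<cdot>\<^sub>v v"
  proof (induction k)
    case 0
    then show ?case
      using v mult_mat_zero_vec[OF C] T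
      by (simp add: geom_quot_mult_vec(1)[OF T v] del: geom_quot.simps)
  next
    case (Suc k)
    have "?C *\<^sub>v (?Q (Suc k) *\<^sub>v v) = ?C *\<^sub>v (l \<cdot>\<^sub>v (?Q k *\<^sub>v v)) + ?C *\<^sub>v (T ^\<^sub>m k *\<^sub>v v)"
      unfolding geom_quot_mult_vec(2)[OF T v] using Qk[OF v] Tk[OF v]
      by (intro mult_add_distrib_mat_vec[OF C]) auto
    also have "?C *\<^sub>v (l \<cdot>\<^sub>v (?Q k *\<^sub>v v)) = l \<cdot>\<^sub>v (?C *\<^sub>v (?Q k *\<^sub>v v))"
      by (rule mult_mat_vec[OF C Qk[OF v]])
    also have "?C *\<^sub>v (T ^\<^sub>m k *\<^sub>v v) = T ^\<^sub>m Suc k *\<^sub>v v - l \<cdot>\<^sub>v (T ^\<^sub>m k *\<^sub>v v)"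
      unfolding char_matrix_mult_vec[OF T Tk[OF v]] Suc_left ..
    finally show ?case unfolding Suc step[OF Tk[OF v] Tk[OF v]] .
  qed
  show "?Q k *\<^sub>v (?C *\<^sub>v v) = T ^\<^sub>m k *\<^sub>v v - l ^ k \<cdot>\<^sub>v v"
  proof (induction k)
    case 0
    have "?C *\<^sub>v v \<in> carrier_vec n" using C v by auto
    then show ?case using v T by (simp add: geom_quot_mult_vec(1)[OF T] del: geom_quot.simps)
  next
    case (Suc k)
    have Cv: "?C *\<^sub>v v \<in> carrier_vec n" using C v by auto
    have "T ^\<^sub>m k *\<^sub>v (?C *\<^sub>v v) = T ^\<^sub>m k *\<^sub>v (T *\<^sub>v v) - T ^\<^sub>m k *\<^sub>v (l \<cdot>\<^sub>v v)"
      unfolding char_matrix_mult_vec[OF T v] using Tv v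
      by (intro mult_minus_distrib_mat_vec[OF pow_carrier_mat[OF T]]) auto
    also have "T ^\<^sub>m k *\<^sub>v (l \<cdot>\<^sub>v v) = l \<cdot>\<^sub>v (T ^\<^sub>m k *\<^sub>v v)"
      by (rule mult_mat_vec[OF pow_carrier_mat[OF T] v])
    finally have eq: "T ^\<^sub>m k *\<^sub>v (?C *\<^sub>v v) = T ^\<^sub>m Suc k *\<^sub>v v - l \<cdot>\<^sub>v (T ^\<^sub>m k *\<^sub>v v)"
      unfolding Suc_right .
    show ?case
      unfolding geom_quot_mult_vec(2)[OF T Cv] Suc eq by (rule step[OF Tk[OF v] Tk[OF v]])
  qed
qed

lemma commuting_mat_vec_pow:
  assumes A: "A \<in> carrier_mat n n" and B: "B \<in> carrier_mat n n"
    and comm: "\<And>x. x \<in> carrier_vec n \<Longrightarrow> A *\<^sub>v (B *\<^sub>v x) = B *\<^sub>v (A *\<^sub>v x)"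
    and v: "v \<in> carrier_vec n"
  shows "A ^\<^sub>m k *\<^sub>v (B *\<^sub>v v) = B *\<^sub>v (A ^\<^sub>m k *\<^sub>v v)"
proof (induction k)
  case 0
  then show ?case using A B v mult_mat_vec_carrier[OF B v] by simp
next
  case (Suc k)
  have "A ^\<^sub>m k *\<^sub>v v \<in> carrier_vec n" using mult_mat_vec_carrier[OF pow_carrier_mat[OF A] v] .
  then show ?case
    using pow_mat_Suc_mult_vec[OF A v] pow_mat_Suc_mult_vec[OF A mult_mat_vec_carrier[OF B v]] Suc comm by simp
qed

context induced_representation
begin

text \<open>\<open>geom_quot T l k\<close> is the sum of l^(k-1-j) T^j over j < k. Applied to a
  vector in block a, only j = 0 contributes to block a, because no smaller positive power than the
  N-th returns there.\<close>

lemma geom_quot_R_block_vec: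
  assumes \<gamma>: "\<gamma> \<in> G" and a: "a < d" and w: "w \<in> carrier_vec m"
    and first: "\<And>j. 0 < j \<Longrightarrow> j < N \<Longrightarrow> trans (\<gamma> [^]\<^bsub>SL2R\<^esub> (j::nat)) a a \<notin> H" and k: "0 < k" "k \<le> N"
  shows "vec_block m a (geom_quot (R \<gamma>) l k *\<^sub>v block_vec d m a w) = l ^ (k - 1) \<cdot>\<^sub>v w"
  using k
proof (induction k)
  case (Suc k)
  let ?v = "block_vec d m a w"
  have Q: "geom_quot (R \<gamma>) l k *\<^sub>v ?v \<in> carrier_vec (d * m)"
    by (rule mult_mat_vec_carrier[OF geom_quot_carrier[OF R_carrier] block_vec_carrier])
  have "vec_block m a (geom_quot (R \<gamma>) l (Suc k) *\<^sub>v ?v) =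
      l \<cdot>\<^sub>v vec_block m a (geom_quot (R \<gamma>) l k *\<^sub>v ?v) + vec_block m a (R (\<gamma> [^]\<^bsub>SL2R\<^esub> k) *\<^sub>v ?v)"
    unfolding geom_quot_mult_vec(2)[OF R_carrier block_vec_carrier]
    using Q a by (simp add: vec_block_add[of _ d] vec_block_smult[of _ d] R_pow[OF \<gamma>, symmetric])
  also have "\<dots> = l ^ k \<cdot>\<^sub>v w"
  proof (cases "k = 0")
    case True
    then show ?thesis
      using a w geom_quot_mult_vec(1)[OF R_carrier block_vec_carrier]
      by (simp add: vec_block_zero vec_block_block_vec R_one smult_zero_vec_right del: geom_quot.simps)
  next
    case False
    obtain b where b: "b < d" "trans (\<gamma> [^]\<^bsub>SL2R\<^esub> k) a b \<in> H"
      using trans_exists_col[of "\<gamma> [^]\<^bsub>SL2R\<^esub> k" a] \<gamma> a by auto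
    have "b \<noteq> a" using first[of k] False Suc.prems b by auto
    then have "vec_block m a (R (\<gamma> [^]\<^bsub>SL2R\<^esub> k) *\<^sub>v ?v) = 0\<^sub>v m"
      using \<gamma> a b w mult_mat_zero_vec[OF \<rho>_carrier[OF b(2)]]
      by (simp add: vec_block_R[of _ a b] vec_block_block_vec smult_zero_vec_right)
    moreover have "l \<cdot>\<^sub>v vec_block m a (geom_quot (R \<gamma>) l k *\<^sub>v ?v) = l ^ k \<cdot>\<^sub>v w"
      using Suc False w by (cases k) (simp_all add: smult_smult_assoc)
    ultimately show ?thesis using w by simp
  qed
  finally show ?case by simp
qed simp

text \<open>With \<open>T = R \<gamma>\<close> and \<open>l = l' ^ N\<close>, the operator \<open>geom_quot T l' N ^ s\<close> maps the image of a
  Jordan chain of the \<open>a\<close>-th block for \<open>l\<close> to a Jordan chain of \<open>T\<close> for \<open>l'\<close>; it does not shrink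
  because \<open>geom_quot T l' N\<close> involves pairwise different blocks.\<close>

lemma jordan_block_R:
  assumes \<gamma>: "\<gamma> \<in> G" and a: "a < d" and N: "N > 0"
    and h: "trans (\<gamma> [^]\<^bsub>SL2R\<^esub> N) a a \<in> H"
    and first: "\<And>j. 0 < j \<Longrightarrow> j < N \<Longrightarrow> trans (\<gamma> [^]\<^bsub>SL2R\<^esub> (j::nat)) a a \<notin> H"
    and jnf: "jordan_nf (\<rho> (trans (\<gamma> [^]\<^bsub>SL2R\<^esub> N) a a)) bs" and mem: "(s, l' ^ N) \<in> set bs"
    and l': "l' \<noteq> 0" and jnf': "jordan_nf (R \<gamma>) bs'"
  shows "\<exists>s'\<ge>s. (s', l') \<in> set bs'"
proof -
  let ?h = "trans (\<gamma> [^]\<^bsub>SL2R\<^esub> N) a a"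
  have "s \<noteq> 0" using jnf mem unfolding jordan_nf_def by force
  then obtain k where k: "s = Suc k" by (cases s) auto
  define D where "D = char_matrix (\<rho> ?h) (l' ^ N)"
  define C where "C = char_matrix (R \<gamma>) l'"
  define Q where "Q = geom_quot (R \<gamma>) l' N"
  have D: "D \<in> carrier_mat m m" and C: "C \<in> carrier_mat (d * m) (d * m)" and Q: "Q \<in> carrier_mat (d * m) (d * m)"
    using h by (auto simp: D_def C_def Q_def)
  obtain w where w: "w \<in> carrier_vec m" "D ^\<^sub>m Suc k *\<^sub>v w = 0\<^sub>v m" "D ^\<^sub>m k *\<^sub>v w \<noteq> 0\<^sub>v m"
    using jordan_chain_exists[OF \<rho>_carrier[OF h] jnf mem[unfolded k]] by (auto simp: D_def)
  have CQ: "C *\<^sub>v (Q *\<^sub>v x) = Q *\<^sub>v (C *\<^sub>v x)" if "x \<in> carrier_vec (d * m)" for x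
    unfolding C_def Q_def char_matrix_geom_quot[OF R_carrier that] ..
  \<comment> \<open>Here C Q = T^N - l'^N, and T^N acts on block a through \<rho> at the returning
    element, so C Q restricts to \<open>D\<close>.\<close>
  have step: "C *\<^sub>v (Q *\<^sub>v block_vec d m a x) = block_vec d m a (D *\<^sub>v x)" if x: "x \<in> carrier_vec m" for x
  proof -
    have "C *\<^sub>v (Q *\<^sub>v block_vec d m a x) = char_matrix (R (\<gamma> [^]\<^bsub>SL2R\<^esub> N)) (l' ^ N) *\<^sub>v block_vec d m a x"
      unfolding C_def Q_def char_matrix_geom_quot[OF R_carrier block_vec_carrier]
      unfolding R_pow[OF \<gamma>, symmetric] char_matrix_mult_vec[OF R_carrier block_vec_carrier] ..
    also have "\<dots> = block_vec d m a (D *\<^sub>v x)"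
      unfolding D_def using \<gamma> by (intro char_matrix_R_block_vec a h x) auto
    finally show ?thesis .
  qed
  have Qpow: "Q ^\<^sub>m i *\<^sub>v x \<in> carrier_vec (d * m)" and Cpow: "C ^\<^sub>m i *\<^sub>v x \<in> carrier_vec (d * m)"
    if "x \<in> carrier_vec (d * m)" for i x
    using mult_mat_vec_carrier[OF pow_carrier_mat[OF Q] that] mult_mat_vec_carrier[OF pow_carrier_mat[OF C] that] .
  have Dpow: "D ^\<^sub>m i *\<^sub>v w \<in> carrier_vec m" for i
    using mult_mat_vec_carrier[OF pow_carrier_mat[OF D] w(1)] .
  have chain: "C ^\<^sub>m i *\<^sub>v (Q ^\<^sub>m i *\<^sub>v block_vec d m a w) = block_vec d m a (D ^\<^sub>m i *\<^sub>v w)" for i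
  proof (induction i)
    case 0
    then show ?case using C Q D w by simp
  next
    case (Suc i)
    have "C ^\<^sub>m Suc i *\<^sub>v (Q ^\<^sub>m Suc i *\<^sub>v block_vec d m a w) =
        C *\<^sub>v (C ^\<^sub>m i *\<^sub>v (Q *\<^sub>v (Q ^\<^sub>m i *\<^sub>v block_vec d m a w)))"
      unfolding pow_mat_Suc_mult_vec[OF Q block_vec_carrier]
      by (rule pow_mat_Suc_mult_vec[OF C mult_mat_vec_carrier[OF Q Qpow[OF block_vec_carrier]]])
    also have "\<dots> = C *\<^sub>v (Q *\<^sub>v (C ^\<^sub>m i *\<^sub>v (Q ^\<^sub>m i *\<^sub>v block_vec d m a w)))"
      using commuting_mat_vec_pow[OF C Q CQ Qpow[OF block_vec_carrier]] by simp
    also have "\<dots> = block_vec d m a (D ^\<^sub>m Suc i *\<^sub>v w)"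
      unfolding Suc step[OF Dpow] pow_mat_Suc_mult_vec[OF D w(1)] ..
    finally show ?case .
  qed
  \<comment> \<open>One factor Q more than the k powers of C to be tested: then C^(k+1) v is the
    image of D^(k+1) w = 0, whereas C^k v = Q D^k w, whose a-th block is l'^(N-1) D^k w.\<close>
  define v where "v = Q ^\<^sub>m Suc k *\<^sub>v block_vec d m a w"
  have v: "v \<in> carrier_vec (d * m)" unfolding v_def by (rule Qpow[OF block_vec_carrier])
  have z: "C ^\<^sub>m Suc k *\<^sub>v v = 0\<^sub>v (d * m)"
    unfolding v_def chain w(2) using a by (simp add: block_vec_eq_zero_iff)
  have "C ^\<^sub>m k *\<^sub>v (Q *\<^sub>v (Q ^\<^sub>m k *\<^sub>v block_vec d m a w)) = Q *\<^sub>v (C ^\<^sub>m k *\<^sub>v (Q ^\<^sub>m k *\<^sub>v block_vec d m a w))"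
    by (rule commuting_mat_vec_pow[OF C Q CQ Qpow[OF block_vec_carrier]])
  then have "C ^\<^sub>m k *\<^sub>v v = Q *\<^sub>v block_vec d m a (D ^\<^sub>m k *\<^sub>v w)"
    unfolding v_def pow_mat_Suc_mult_vec[OF Q block_vec_carrier] chain .
  then have "vec_block m a (C ^\<^sub>m k *\<^sub>v v) = l' ^ (N - 1) \<cdot>\<^sub>v (D ^\<^sub>m k *\<^sub>v w)"
    unfolding Q_def using geom_quot_R_block_vec[OF \<gamma> a Dpow first N order_refl] by simp
  also have "\<dots> \<noteq> 0\<^sub>v m"
  proof
    assume "l' ^ (N - 1) \<cdot>\<^sub>v (D ^\<^sub>m k *\<^sub>v w) = 0\<^sub>v m"
    then have "inverse (l' ^ (N - 1)) \<cdot>\<^sub>v (l' ^ (N - 1) \<cdot>\<^sub>v (D ^\<^sub>m k *\<^sub>v w)) = 0\<^sub>v m"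
      by (simp add: smult_zero_vec_right)
    then have "D ^\<^sub>m k *\<^sub>v w = 0\<^sub>v m" using l' by (simp add: smult_smult_assoc)
    then show False using w(3) by simp
  qed
  finally have "C ^\<^sub>m k *\<^sub>v v \<noteq> 0\<^sub>v (d * m)" using a by (auto simp: vec_block_zero)
  then show ?thesis
    using jordan_block_size_gt[OF R_carrier jnf' v] z unfolding C_def k by (metis Suc_leI)
qed

end

section \<open>The lift\<close>

text \<open>For f = Delta^(k/w) the ratio g of f slashed by \<gamma> to f need not be known
  explicitly: its w-th power is a constant, so g takes finitely many values, and a continuous
  function with finite range on a connected set is constant.\<close>

lemma multiplier_exists:
  assumes G: "subgroup G SL2R" and w: "w \<noteq> 0" and L: "is_log_of L \<Delta>"
    and aut: "automorphic G w \<nu> (\<lambda>\<tau>. Matrix.vec 1 (\<lambda>_. \<Delta> \<tau>))" and rep: "representation G 1 \<nu>"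
  shows "\<exists>u. multiplier G k (Delta_power L (of_int k / of_int w)) u"
proof -
  define f where "f = Delta_power L (of_int k / of_int w)"
  have f0: "f \<tau> \<noteq> 0" for \<tau> by (simp add: f_def Delta_power_def)
  have fhol: "f holomorphic_on UH"
    using L unfolding f_def Delta_power_def is_log_of_def by (intro holomorphic_intros) auto
  have fw: "f \<tau> powi w = \<Delta> \<tau> powi k" if "\<tau> \<in> UH" for \<tau>
  proof -
    have "f \<tau> powi w = exp (of_int w * (of_int k / of_int w * L \<tau>))"
      unfolding f_def Delta_power_def by (rule exp_power_int)
    also have "of_int w * (of_int k / of_int w * L \<tau>) = of_int k * L \<tau>" using w by simp
    also have "exp (of_int k * L \<tau>) = exp (L \<tau>) powi k" by (rule exp_power_int[symmetric])
    finally show ?thesis using L that by (simp add: is_log_of_def)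
  qed
  have \<Delta>0: "\<Delta> \<tau> \<noteq> 0" if "\<tau> \<in> UH" for \<tau>
    using L that unfolding is_log_of_def by (metis exp_not_eq_zero)
  have conn: "connected UH"
    using convex_halfspace_Im_gt[of 0] by (simp add: UH_def convex_connected)
  have "\<exists>c. c \<noteq> 0 \<and> (\<forall>\<tau>\<in>UH. slash k \<gamma> f \<tau> = c * f \<tau>)" if \<gamma>: "\<gamma> \<in> G" for \<gamma>
  proof -
    have \<gamma>S: "\<gamma> \<in> carrier SL2R" using subgroup.mem_carrier[OF G \<gamma>] .
    define n where "n = \<nu> \<gamma> $$ (0, 0)"
    have \<nu>: "\<nu> \<gamma> \<in> carrier_mat 1 1" using representation_facts(1)[OF G rep \<gamma>] .
    have \<Delta>\<gamma>: "\<Delta> (mob \<gamma> \<tau>) = aut \<gamma> \<tau> powi w * n * \<Delta> \<tau>" if \<tau>: "\<tau> \<in> UH" for \<tau>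
    proof -
      have "vec_index (vslash w \<gamma> (\<lambda>\<tau>. Matrix.vec 1 (\<lambda>_. \<Delta> \<tau>)) \<tau>) 0 =
          vec_index (\<nu> \<gamma> *\<^sub>v Matrix.vec 1 (\<lambda>_. \<Delta> \<tau>)) 0"
        using aut \<gamma> \<tau> unfolding automorphic_def by simp
      then have "aut \<gamma> \<tau> powi (- w) * \<Delta> (mob \<gamma> \<tau>) = n * \<Delta> \<tau>"
        using \<nu> by (simp add: vslash_def scalar_prod_def n_def)
      then show ?thesis using \<gamma>S \<tau> by (simp add: power_int_minus field_simps)
    qed
    define g where "g \<tau> = slash k \<gamma> f \<tau> / f \<tau>" for \<tau>
    have "g holomorphic_on UH"
      unfolding g_def by (intro holomorphic_intros slash_holomorphic fhol \<gamma>S f0)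
    then have cont: "continuous_on UH g" by (rule holomorphic_on_imp_continuous_on)
    have g0: "g \<tau> \<noteq> 0" if "\<tau> \<in> UH" for \<tau> using that \<gamma>S f0 by (simp add: g_def slash_def)
    \<comment> \<open>Since f^w = Delta^k, the w-th power of g involves only the law of Delta
      itself, whose multiplier at \<gamma> is n; the automorphy factors cancel.\<close>
    have gw: "g \<tau> powi w = n powi k" if \<tau>: "\<tau> \<in> UH" for \<tau>
    proof -
      have "slash k \<gamma> f \<tau> powi w = (aut \<gamma> \<tau> powi (- k)) powi w * f (mob \<gamma> \<tau>) powi w"
        by (simp add: slash_def power_int_mult_distrib)
      also have "(aut \<gamma> \<tau> powi (- k)) powi w = inverse ((aut \<gamma> \<tau> powi w) powi k)"
        by (simp add: power_int_minus power_int_inverse mult.commute flip: power_int_mult)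
      also have "f (mob \<gamma> \<tau>) powi w = (aut \<gamma> \<tau> powi w * n * \<Delta> \<tau>) powi k"
        using \<tau> \<gamma>S by (simp add: fw \<Delta>\<gamma>)
      also have "\<dots> = (aut \<gamma> \<tau> powi w) powi k * n powi k * f \<tau> powi w"
        using \<tau> by (simp add: power_int_mult_distrib fw)
      finally have "slash k \<gamma> f \<tau> powi w = n powi k * f \<tau> powi w"
        using \<tau> \<gamma>S by simp
      then show ?thesis using f0 by (simp add: g_def power_int_divide_distrib)
    qed
    \<comment> \<open>The values are |w|-th roots of one number; for negative w that number has to
      be inverted.\<close>
    have "finite (g ` UH)"
    proof (rule finite_subset)
      have "g \<tau> ^ nat \<bar>w\<bar> = (if w > 0 then n powi k else inverse (n powi k))" if "\<tau> \<in> UH" for \<tau>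
      proof (cases "w > 0")
        case True
        then show ?thesis using gw[OF that] by (simp add: power_int_def)
      next
        case False
        then have "inverse (g \<tau> ^ nat \<bar>w\<bar>) = n powi k"
          using gw[OF that] w by (simp add: power_int_def[of "g \<tau>"] power_inverse)
        then show ?thesis using False by (metis inverse_inverse_eq)
      qed
      then show "g ` UH \<subseteq> {z. z ^ nat \<bar>w\<bar> = (if w > 0 then n powi k else inverse (n powi k))}" by auto
      show "finite {z. z ^ nat \<bar>w\<bar> = (if w > 0 then n powi k else inverse (n powi k))}"
        using w by (intro finite_nth_roots) auto
    qed
    then have "g constant_on UH" by (rule continuous_finite_range_constant[OF conn cont])
    then obtain c where c: "\<And>\<tau>. \<tau> \<in> UH \<Longrightarrow> g \<tau> = c" unfolding constant_on_def by blast
    have "\<i> \<in> UH" by (simp add: UH_def)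
    then have "c \<noteq> 0" using c g0 by metis
    moreover have "slash k \<gamma> f \<tau> = c * f \<tau>" if "\<tau> \<in> UH" for \<tau>
      using c[OF that] f0[of \<tau>] by (simp add: g_def field_simps)
    ultimately show ?thesis by blast
  qed
  then obtain u where "\<forall>\<gamma>\<in>G. u \<gamma> \<noteq> 0 \<and> (\<forall>\<tau>\<in>UH. slash k \<gamma> f \<tau> = u \<gamma> * f \<tau>)" by metis
  then show ?thesis unfolding multiplier_def f_def by blast
qed

lemma jordan_nf_eigenvalue:
  fixes A :: "complex Matrix.mat"
  assumes A: "A \<in> carrier_mat n n" and jnf: "jordan_nf A bs" and mem: "(s, l) \<in> set bs"
  shows "eigenvalue A l"
proof -
  have "s \<noteq> 0" using jnf mem unfolding jordan_nf_def by force
  then obtain k where k: "s = Suc k" by (cases s) auto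
  obtain v where v: "v \<in> carrier_vec n" "char_matrix A l ^\<^sub>m Suc k *\<^sub>v v = 0\<^sub>v n" "char_matrix A l ^\<^sub>m k *\<^sub>v v \<noteq> 0\<^sub>v n"
    using jordan_chain_exists[OF A jnf mem[unfolded k]] by blast
  have C: "char_matrix A l \<in> carrier_mat n n" using A by simp
  show ?thesis
    unfolding eigenvalue_char_matrix[OF A]
    using v pow_mat_Suc_mult_vec[OF C v(1)] mult_mat_vec_carrier[OF pow_carrier_mat[OF C] v(1)] by metis
qed

lemma mult_mat_vslash:
  assumes "M \<in> carrier_mat n m" "X (mob A \<tau>) \<in> carrier_vec m"
  shows "M *\<^sub>v vslash k A X \<tau> = vslash k A (\<lambda>\<tau>. M *\<^sub>v X \<tau>) \<tau>"
  unfolding vslash_def by (rule mult_mat_vec[OF assms])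

lemma vslash_vslash_eq:
  assumes "\<And>\<tau>. \<tau> \<in> UH \<Longrightarrow> X \<tau> = Y \<tau>" "A \<in> carrier SL2R" "\<tau> \<in> UH"
  shows "vslash k A X \<tau> = vslash k A Y \<tau>"
  using assms by (simp add: vslash_def)

context induced_representation
begin

context
  fixes X :: "complex \<Rightarrow> complex Matrix.vec" and k w :: int and L :: "complex \<Rightarrow> complex"
  assumes X: "holomorphic_vec m X" and X_aut: "automorphic H k \<rho> X"
    and u: "multiplier G k (Delta_power L (of_int k / of_int w)) u"
begin

abbreviation lift :: "complex \<Rightarrow> complex Matrix.vec" where "lift \<equiv> cusp_lift m k w L gs X"

lemma X_carrier [simp]: "\<tau> \<in> UH \<Longrightarrow> X \<tau> \<in> carrier_vec m"
  using X by (simp add: holomorphic_vec_def)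

lemma lift_carrier [simp]: "lift \<tau> \<in> carrier_vec (d * m)"
  by (simp add: cusp_lift_def)

text \<open>Slashing f by \<gamma> and then by its inverse gives f back; comparing at the single
  point i, where f is nonzero, suffices.\<close>

lemma multiplier_sinv:
  assumes "\<gamma> \<in> G"
  shows "u (sinv \<gamma>) * u \<gamma> = 1"
proof -
  define f where "f = Delta_power L (of_int k / of_int w)"
  have f0: "f \<tau> \<noteq> 0" for \<tau> by (simp add: f_def Delta_power_def)
  have u': "slash k \<gamma> f \<tau> = u \<gamma> * f \<tau>" if "\<gamma> \<in> G" "\<tau> \<in> UH" for \<gamma> \<tau>
    using u that by (simp add: multiplier_def f_def)
  have i: "\<i> \<in> UH" by (simp add: UH_def)
  have "f \<i> = slash k (\<gamma> ** sinv \<gamma>) f \<i>" using assms by (simp add: slash_def)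
  also have "\<dots> = slash k (sinv \<gamma>) (slash k \<gamma> f) \<i>" using assms i by (intro slash_mult) auto
  also have "\<dots> = u \<gamma> * slash k (sinv \<gamma>) f \<i>"
    using u'[OF assms, of "mob (sinv \<gamma>) \<i>"] assms i by (simp add: slash_def[of k "sinv \<gamma>"])
  also have "\<dots> = u \<gamma> * u (sinv \<gamma>) * f \<i>" using u'[of "sinv \<gamma>"] assms i by simp
  finally show ?thesis using f0[of \<i>] by (simp add: mult.commute)
qed

text \<open>By the multiplier at g = g_a^-1, the ratio of Delta^(k/w) at tau to its value at g tau
  is the weight k automorphy factor divided by u(g), and 1 / u(g) = u(g_a) by
  \<open>multiplier_sinv\<close>. So only a constant of Delta survives.\<close>

lemma vec_block_lift:
  assumes "a < d" "\<tau> \<in> UH"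
  shows "vec_block m a (lift \<tau>) = u (gs ! a) \<cdot>\<^sub>v vslash k (sinv (gs ! a)) X \<tau>"
proof (rule eq_vecI)
  let ?g = "sinv (gs ! a)"
  have gS: "?g \<in> carrier SL2R" and gG: "?g \<in> G" using assms by auto
  have UH: "mob ?g \<tau> \<in> UH" using gS assms by simp
  then have dim: "dim_vec (X (mob ?g \<tau>)) = m" using X_carrier by auto
  show "dim_vec (vec_block m a (lift \<tau>)) = dim_vec (u (gs ! a) \<cdot>\<^sub>v vslash k ?g X \<tau>)"
    by (simp add: vec_block_def vslash_def dim)
  fix r assume "r < dim_vec (u (gs ! a) \<cdot>\<^sub>v vslash k ?g X \<tau>)"
  then have r: "r < m" by (simp add: vslash_def dim)
  define s where "s = (of_int k / of_int w :: complex)"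
  have "slash k ?g (Delta_power L s) \<tau> = u ?g * Delta_power L s \<tau>"
    using u gG assms(2) by (simp add: multiplier_def s_def)
  then have "aut ?g \<tau> powi (- k) * Delta_power L s (mob ?g \<tau>) = u ?g * Delta_power L s \<tau>"
    by (simp add: slash_def)
  then have "u (gs ! a) * aut ?g \<tau> powi (- k) * Delta_power L s (mob ?g \<tau>) =
      u ?g * u (gs ! a) * Delta_power L s \<tau>"
    by (simp add: mult_ac)
  then have "u (gs ! a) * aut ?g \<tau> powi (- k) * Delta_power L s (mob ?g \<tau>) = Delta_power L s \<tau>"
    using multiplier_sinv[of "gs ! a"] assms(1) by simp
  moreover have "Delta_power L s (mob ?g \<tau>) * Delta_power L (- s) (mob ?g \<tau>) = 1"
    by (simp add: Delta_power_def flip: exp_add)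
  ultimately have "Delta_power L s \<tau> * Delta_power L (- s) (mob ?g \<tau>) = u (gs ! a) * aut ?g \<tau> powi (- k)"
    by (metis mult.assoc mult.right_neutral)
  then have "Delta_power L s \<tau> * (Delta_power L (- s) (mob ?g \<tau>) * x) = u (gs ! a) * (aut ?g \<tau> powi (- k) * x)" for x
    by (simp add: mult.assoc[symmetric])
  then show "vec_index (vec_block m a (lift \<tau>)) r = vec_index (u (gs ! a) \<cdot>\<^sub>v vslash k ?g X \<tau>) r"
    using r dim block_index_less[OF assms(1) r]
    by (simp add: vec_block_def cusp_lift_def weight_zero_def vslash_def s_def)
qed

lemma lift_index:
  assumes "a < d" "r < m" "\<tau> \<in> UH"
  shows "vec_index (lift \<tau>) (a * m + r) = u (gs ! a) * slash k (sinv (gs ! a)) (\<lambda>\<tau>. vec_index (X \<tau>) r) \<tau>"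
proof -
  have "mob (sinv (gs ! a)) \<tau> \<in> UH" using assms by simp
  then have dim: "dim_vec (X (mob (sinv (gs ! a)) \<tau>)) = m" using X_carrier by auto
  have "vec_index (lift \<tau>) (a * m + r) = vec_index (vec_block m a (lift \<tau>)) r"
    using assms by (simp add: vec_block_def)
  then show ?thesis
    unfolding vec_block_lift[OF assms(1,3)] using assms(2) dim by (simp add: vslash_def slash_def)
qed

lemma lift_index':
  assumes "p < d * m"
  shows "p div m < d" "p mod m < m"
    "\<tau> \<in> UH \<Longrightarrow> vec_index (lift \<tau>) p =
      u (gs ! (p div m)) * slash k (sinv (gs ! (p div m))) (\<lambda>\<tau>. vec_index (X \<tau>) (p mod m)) \<tau>"
proof -
  have "m > 0" using assms by (cases m) auto
  then show a: "p div m < d" and r: "p mod m < m" using assms by (auto simp: less_mult_imp_div_less)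
  show "vec_index (lift \<tau>) p =
      u (gs ! (p div m)) * slash k (sinv (gs ! (p div m))) (\<lambda>\<tau>. vec_index (X \<tau>) (p mod m)) \<tau>" if "\<tau> \<in> UH"
    using lift_index[OF a r that] by simp
qed

lemma holomorphic_lift: "holomorphic_vec (d * m) lift"
  unfolding holomorphic_vec_def
proof (intro conjI allI impI ballI)
  fix p assume p: "p < d * m"
  note ar = lift_index'[OF p]
  have "(\<lambda>\<tau>. vec_index (X \<tau>) (p mod m)) holomorphic_on UH"
    using X ar by (auto simp: holomorphic_vec_def)
  then have "(\<lambda>\<tau>. u (gs ! (p div m)) * slash k (sinv (gs ! (p div m))) (\<lambda>\<tau>. vec_index (X \<tau>) (p mod m)) \<tau>) holomorphic_on UH"
    using ar by (intro holomorphic_intros slash_holomorphic) auto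
  then show "(\<lambda>\<tau>. vec_index (lift \<tau>) p) holomorphic_on UH"
    by (rule holomorphic_transform) (simp add: ar(3))
qed auto

text \<open>With b the index sent to a, \<open>sinv (gs ! a) ** \<gamma> = trans \<gamma> a b **
  sinv (gs ! b)\<close> reduces the law to that of \<open>X\<close>. Expressing the result by the
  b-th block of the lift costs 1 / u(g_b), which is the origin of the ratio of scalings in
  \<open>R\<close>.\<close>

lemma automorphic_lift: "automorphic G k R lift"
  unfolding automorphic_def
proof (intro ballI)
  fix \<gamma> \<tau> assume \<gamma>: "\<gamma> \<in> G" and \<tau>: "\<tau> \<in> UH"
  have UH: "mob \<gamma> \<tau> \<in> UH" using \<gamma> \<tau> by simp
  show "vslash k \<gamma> lift \<tau> = R \<gamma> *\<^sub>v lift \<tau>"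
  proof (rule vec_eq_of_blocks[of _ d m])
    fix a assume a: "a < d"
    obtain b where b: "b < d" "trans \<gamma> a b \<in> H" using trans_exists_col[OF \<gamma> a] by blast
    have gb: "mob (sinv (gs ! b)) \<tau> \<in> UH" and ga: "mob (sinv (gs ! a)) (mob \<gamma> \<tau>) \<in> UH"
      using a b \<tau> UH by simp_all
    have "vec_block m a (vslash k \<gamma> lift \<tau>) = aut \<gamma> \<tau> powi (- k) \<cdot>\<^sub>v (u (gs ! a) \<cdot>\<^sub>v vslash k (sinv (gs ! a)) X (mob \<gamma> \<tau>))"
      using a UH by (simp add: vslash_def[of k \<gamma>] vec_block_smult[of _ d] vec_block_lift)
    also have "\<dots> = u (gs ! a) \<cdot>\<^sub>v vslash k \<gamma> (vslash k (sinv (gs ! a)) X) \<tau>"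
      by (simp add: vslash_def[of k \<gamma>] smult_smult_assoc mult.commute)
    also have "vslash k \<gamma> (vslash k (sinv (gs ! a)) X) \<tau> = vslash k (sinv (gs ! a) ** \<gamma>) X \<tau>"
      using a \<gamma> \<tau> by (intro vslash_mult[symmetric]) auto
    also have "sinv (gs ! a) ** \<gamma> = trans \<gamma> a b ** sinv (gs ! b)"
      using b by (simp add: trans_def)
    also have "vslash k (trans \<gamma> a b ** sinv (gs ! b)) X \<tau> = vslash k (sinv (gs ! b)) (vslash k (trans \<gamma> a b) X) \<tau>"
      using b \<tau> by (intro vslash_mult) auto
    also have "\<dots> = vslash k (sinv (gs ! b)) (\<lambda>\<tau>. \<rho> (trans \<gamma> a b) *\<^sub>v X \<tau>) \<tau>"
      using b \<tau> X_aut by (intro vslash_vslash_eq) (auto simp: automorphic_def)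
    also have "\<dots> = \<rho> (trans \<gamma> a b) *\<^sub>v vslash k (sinv (gs ! b)) X \<tau>"
      by (rule mult_mat_vslash[where X = X, OF \<rho>_carrier[OF b(2)] X_carrier[OF gb], symmetric])
    also have "u (gs ! a) \<cdot>\<^sub>v \<dots> = vec_block m a (R \<gamma> *\<^sub>v lift \<tau>)"
    proof -
      have "vslash k (sinv (gs ! b)) X \<tau> \<in> carrier_vec m"
        using X_carrier[OF gb] by (simp add: vslash_def)
      then show ?thesis
        unfolding vec_block_R[OF \<gamma> a b lift_carrier] vec_block_lift[OF b(1) \<tau>]
        using u_nonzero[OF b(1)] by (simp add: mult_mat_vec[OF \<rho>_carrier[OF b(2)]] smult_smult_assoc)
    qed
    finally show "vec_block m a (vslash k \<gamma> lift \<tau>) = vec_block m a (R \<gamma> *\<^sub>v lift \<tau>)" .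
  qed (auto simp: vslash_def)
qed

lemma log_expansion_lift:
  assumes neg: "- I2 \<in> H" and discG: "discrete_subgroup (psl ` G)" and discH: "discrete_subgroup (psl ` H)"
    and exps: "\<And>c. is_cusp H c \<Longrightarrow> log_expansion H m k \<rho> X c"
    and unimod: "unimodular_at_parabolics H \<rho>" and c: "is_cusp G c"
  shows "log_expansion G (d * m) k R lift c"
proof -
  have negG: "- I2 \<in> G" using neg by simp
  obtain h where h: "cuspidal G c h" using cuspidal_exists[OF G negG discG c] by blast
  have hpos: "h > 0" using h by (simp add: cuspidal_def)
  define t where "t = transl c h"
  have "transl c (of_int 1 * h) \<in> G" using h unfolding cuspidal_def by blast
  then have tG: "t \<in> G" by (simp add: t_def)
  have tcusp: "t_cusp G c = t" using t_cusp_cuspidal[OF G negG h] by (simp add: t_def)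
  \<comment> \<open>Any Jordan form will do: the expansion is written along \<open>bs'\<close> and
    leaves unneeded slots empty.\<close>
  obtain bs' where bs': "jordan_nf (R t) bs'" using jordan_nf_exists_complex[OF R_carrier] by blast
  have main: "log_series bs' (\<lambda>z. slash k (A_cusp c) (slash k (sinv (gs ! a)) (\<lambda>\<tau>. vec_index (X \<tau>) r)) (log_arg h z))"
    if a: "a < d" and r: "r < m" for a r
  proof -
    define B where "B = sinv (gs ! a)"
    define c' where "c' = act B c"
    have B: "B \<in> carrier SL2R" using a by (simp add: B_def)
    obtain \<alpha> \<beta> where U: "\<alpha> \<noteq> 0" "B ** A_cusp c = A_cusp c' ** mat22 \<alpha> \<beta> 0 (1 / \<alpha>)"
      using act_eq_obtain[OF B c'_def[symmetric]] .
    note conj = transl_conj[OF U B]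
    have tr: "trans (transl c x) a a = transl c' (\<alpha>\<^sup>2 * x)" for x
      using conj[of x] a by (simp add: trans_def B_def)
    have tpow: "t [^]\<^bsub>SL2R\<^esub> (n::nat) = transl c (of_nat n * h)" for n
      by (simp add: t_def transl_pow)
    \<comment> \<open>A power of t returns to the coset of \<open>gs ! a\<close>; conjugated to c',
      it is a nontrivial translation in \<open>H\<close>.\<close>
    have cusp': "is_cusp H c'"
    proof -
      obtain n :: nat where n: "n > 0" "trans (t [^]\<^bsub>SL2R\<^esub> n) a a \<in> H"
        using trans_pow_return[OF tG a] by blast
      have "\<alpha>\<^sup>2 * (of_nat n * h) \<noteq> 0" using U n hpos by simp
      then have "psl (transl c' (\<alpha>\<^sup>2 * (of_nat n * h))) \<noteq> psl I2"
        using psl_transl_eq_iff[of c' _ 0] by simp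
      then show ?thesis
        using n(2) unfolding is_cusp_def tpow tr by (intro bexI[of _ "transl c' (\<alpha>\<^sup>2 * (of_nat n * h))"]) auto
    qed
    obtain h' where h': "cuspidal H c' h'" using cuspidal_exists[OF H neg discH cusp'] by blast
    have h'pos: "h' > 0" using h' by (simp add: cuspidal_def)
    have "transl c' (of_int 1 * h') \<in> H" using h' unfolding cuspidal_def by blast
    then have tH: "transl c' h' \<in> H" by simp
    have "transl c (h' / \<alpha>\<^sup>2) = sinv B ** transl c' h' ** B"
    proof -
      have "sinv B ** (B ** transl c (h' / \<alpha>\<^sup>2) ** sinv B) ** B = transl c (h' / \<alpha>\<^sup>2)"
        using B by (simp add: matrix_mul_assoc[symmetric])
      then show ?thesis unfolding conj using U(1) by simp
    qed
    also have "\<dots> \<in> G" using tH a by (simp add: B_def)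
    \<comment> \<open>The generator of \<open>H\<close> at c', moved back to c, lies in
      \<open>G\<close>. Its length h' / alpha^2 is thus a multiple of h, and the factor is
      N.\<close>
    finally obtain n :: int where n: "h' / \<alpha>\<^sup>2 = of_int n * h" using h unfolding cuspidal_def by blast
    have "n > 0" using n U(1) hpos h'pos by (metis divide_pos_pos of_int_0_less_iff zero_less_mult_pos2 zero_less_power2)
    define N where "N = nat n"
    have N: "N > 0" using \<open>n > 0\<close> by (simp add: N_def)
    have hN: "h' = of_nat N * \<alpha>\<^sup>2 * h" using n U(1) \<open>n > 0\<close> by (simp add: N_def field_simps)
    have transN: "trans (t [^]\<^bsub>SL2R\<^esub> N) a a = transl c' h'"
      unfolding tpow tr hN by (simp add: mult_ac)
    \<comment> \<open>N is exactly the first return time: at c' the j-th power of t is a translation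
      by j h' / N, which lies in \<open>H\<close> only if N divides j.\<close>
    have first: "trans (t [^]\<^bsub>SL2R\<^esub> j) a a \<notin> H" if j: "0 < j" "j < N" for j :: nat
    proof
      assume "trans (t [^]\<^bsub>SL2R\<^esub> j) a a \<in> H"
      then obtain i :: int where "\<alpha>\<^sup>2 * (of_nat j * h) = of_int i * h'"
        using h' unfolding tpow tr cuspidal_def by blast
      then have "of_nat j = (of_int i * of_nat N :: real)" using U(1) hpos by (simp add: hN)
      then have "int j = i * int N" by (metis of_int_eq_iff of_int_mult of_int_of_nat_eq)
      then have "int N dvd int j" by simp
      then show False using j by (simp add: nat_dvd_not_less)
    qed
    have wH: "cusp_width H c' = h'" by (rule cusp_width_cuspidal[OF H neg h'])
    obtain bs where bs: "jordan_nf (\<rho> (transl c' h')) bs"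
      and ser: "\<And>r. r < m \<Longrightarrow> log_series bs (\<lambda>z. slash k (A_cusp c') (\<lambda>\<tau>. vec_index (X \<tau>) r) (log_arg h' z))"
      using exps[OF cusp'] log_expansion_iff[OF wH h'pos X_carrier]
      unfolding t_cusp_cuspidal[OF H neg h'] by auto
    have unit: "cmod l = 1" if "(s, l) \<in> set bs" for s l
      using jordan_nf_eigenvalue[OF \<rho>_carrier[OF tH] bs that] unimod tH
      unfolding unimodular_at_parabolics_def by auto
    show ?thesis
      unfolding B_def[symmetric]
    proof (rule log_series_slash_transfer[OF B U hpos h'pos hN ser[OF r] unit])
      fix s l i assume mem: "(s, l) \<in> set bs" and i: "i < N"
      \<comment> \<open>For i < N these are the N-th roots of \<open>l\<close>; each must be shown
        to have a block of \<open>R t\<close> of size at least s.\<close>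
      define l' where "l' = exp (2 * of_real pi * \<i> * of_real ((mu l + of_nat i) / of_nat N))"
      have "l' ^ N = exp (of_nat N * (2 * of_real pi * \<i> * of_real ((mu l + of_nat i) / of_nat N)))"
        unfolding l'_def by (rule exp_of_nat_mult[symmetric])
      also have "of_nat N * (2 * of_real pi * \<i> * of_real ((mu l + of_nat i) / of_nat N)) =
          2 * of_real pi * \<i> * of_real (mu l) + of_nat i * (of_real (2 * pi) * \<i>)"
        using N by (simp add: field_simps)
      also have "exp \<dots> = l"
        using mu_cis(3)[OF unit[OF mem]] exp_of_nat_mult[of i "of_real (2 * pi) * \<i>"]
        by (simp add: exp_add)
      finally have l': "l' ^ N = l" .
      have "\<exists>s'\<ge>s. (s', l') \<in> set bs'"
      proof (rule jordan_block_R[OF tG a N _ first _ _ _ bs'])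
        show "trans (t [^]\<^bsub>SL2R\<^esub> N) a a \<in> H" using tH by (simp add: transN)
        show "jordan_nf (\<rho> (trans (t [^]\<^bsub>SL2R\<^esub> N) a a)) bs" using bs by (simp add: transN)
      qed (use mem l' in \<open>auto simp: l'_def\<close>)
      then show "\<exists>s'\<ge>s. (s', exp (2 * of_real pi * \<i> * of_real ((mu l + of_nat i) / of_nat N))) \<in> set bs'"
        by (simp add: l'_def)
    qed
  qed
  have wG: "cusp_width G c = h" by (rule cusp_width_cuspidal[OF G negG h])
  have "log_series bs' (\<lambda>z. slash k (A_cusp c) (\<lambda>\<tau>. vec_index (lift \<tau>) p) (log_arg h z))" if p: "p < d * m" for p
  proof (rule log_series_cong)
    note ar = lift_index'[OF p]
    show "log_series bs' (\<lambda>z. u (gs ! (p div m)) *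
        slash k (A_cusp c) (slash k (sinv (gs ! (p div m))) (\<lambda>\<tau>. vec_index (X \<tau>) (p mod m))) (log_arg h z))"
      by (intro log_series_cmult main ar)
    fix z assume "Re z < 0"
    then have "mob (A_cusp c) (log_arg h z) \<in> UH" using hpos by simp
    then show "u (gs ! (p div m)) *
        slash k (A_cusp c) (slash k (sinv (gs ! (p div m))) (\<lambda>\<tau>. vec_index (X \<tau>) (p mod m))) (log_arg h z) =
      slash k (A_cusp c) (\<lambda>\<tau>. vec_index (lift \<tau>) p) (log_arg h z)"
      using ar(3) by (simp add: slash_def[of k "A_cusp c"])
  qed
  then show ?thesis
    unfolding log_expansion_iff[OF wG hpos lift_carrier] tcusp using bs' by blast
qed

lemma wh_logarithmic_lift:
  assumes "- I2 \<in> H" "discrete_subgroup (psl ` G)" "discrete_subgroup (psl ` H)"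
    and X_log: "wh_logarithmic_vvaf H m k \<rho> X"
  shows "wh_logarithmic_vvaf G (d * m) k R lift"
proof -
  have "logarithmic H m \<rho>" "\<rho> I2 = exp (\<i> * of_real pi * of_int k) \<cdot>\<^sub>m \<rho> (- I2)"
    "\<And>c. is_cusp H c \<Longrightarrow> log_expansion H m k \<rho> X c"
    using X_log by (auto simp: wh_logarithmic_vvaf_def)
  moreover from this(1) have "unimodular_at_parabolics H \<rho>" by (simp add: logarithmic_def)
  ultimately show ?thesis
    unfolding wh_logarithmic_vvaf_def
    using logarithmic_R R_neg_one holomorphic_lift automorphic_lift log_expansion_lift assms(1-3) by blast
qed

end

end

lemma rescaled_induced_one: "rescaled_induced (\<lambda>_. 1) H m \<rho> gs = induced H m \<rho> gs"
proof
  fix \<gamma>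
  have "induced H m \<rho> gs \<gamma> \<in> carrier_mat (length gs * m) (length gs * m)" by (simp add: induced_def)
  then show "rescaled_induced (\<lambda>_. 1) H m \<rho> gs \<gamma> = induced H m \<rho> gs \<gamma>"
    by (simp add: rescaled_induced_def)
qed

lemma is_cusp_mono: "H \<subseteq> G \<Longrightarrow> is_cusp H c \<Longrightarrow> is_cusp G c"
  unfolding is_cusp_def by blast

lemma cuspidal_unique:
  assumes "subgroup K SL2R" "- I2 \<in> K" "cuspidal K c h" "cuspidal K c h'"
  shows "h = h'"
  using cusp_width_cuspidal[OF assms(1-3)] cusp_width_cuspidal[OF assms(1,2,4)] by simp

section \<open>Conjugation\<close>

lemma conj_cancel:
  assumes "B \<in> carrier SL2R"
  shows "B ** (sinv B ** \<gamma> ** B) ** sinv B = \<gamma>"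
  using assms by (simp add: matrix_mul_assoc[symmetric])

lemma subgroup_conj:
  assumes K: "subgroup K SL2R" and B: "B \<in> carrier SL2R"
  shows "subgroup (conj_by B K) SL2R"
proof (rule SL.subgroupI)
  have sub: "A \<in> carrier SL2R" if "A \<in> K" for A using subgroup.mem_carrier[OF K that] .
  show "conj_by B K \<subseteq> carrier SL2R" using sub B by auto
  show "conj_by B K \<noteq> {}" using subgroup.one_closed[OF K] by auto
  fix a assume "a \<in> conj_by B K"
  then obtain \<gamma> where \<gamma>: "\<gamma> \<in> K" "a = sinv B ** \<gamma> ** B" by blast
  have "sinv a = sinv B ** sinv \<gamma> ** B"
    using \<gamma> sub B by (simp add: sinv_mult matrix_mul_assoc)
  then show "sinv a \<in> conj_by B K"
    using subgroup.m_inv_closed[OF K \<gamma>(1)] by simp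
  fix b assume "b \<in> conj_by B K"
  then obtain \<delta> where \<delta>: "\<delta> \<in> K" "b = sinv B ** \<delta> ** B" by blast
  have "a ** b = sinv B ** (\<gamma> ** \<delta>) ** B"
    using \<gamma>(2) \<delta>(2) B by (simp add: matrix_mul_assoc[symmetric])
  then show "a \<otimes>\<^bsub>SL2R\<^esub> b \<in> conj_by B K"
    using subgroup.m_closed[OF K \<gamma>(1) \<delta>(1)] by simp
qed

lemma conj_self:
  assumes K: "subgroup K SL2R" and B: "B \<in> K"
  shows "conj_by B K = K"
proof -
  have sub: "A \<in> carrier SL2R" if "A \<in> K" for A using subgroup.mem_carrier[OF K that] .
  have "sinv B ** \<gamma> ** B \<in> K" "B ** \<gamma> ** sinv B \<in> K" if "\<gamma> \<in> K" for \<gamma>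
    using subgroup.m_closed[OF K] subgroup.m_inv_closed[OF K] that B by auto
  then show ?thesis using conj_mem_iff[OF sub[OF B] sub] by blast
qed

text \<open>Serves the case that infinity is not a cusp of \<open>G\<close>, with B = A_c. Slashing
  by B moves the data at the cusp B c to c: representation and group are only renamed by
  conjugation, and the expansion undergoes a change of coordinate with N = 1.\<close>

lemma wh_logarithmic_conj:
  assumes G: "subgroup G SL2R" and neg: "- I2 \<in> G" and disc: "discrete_subgroup (psl ` G)"
    and B: "B \<in> carrier SL2R" and Y: "wh_logarithmic_vvaf G M k \<rho> Y"
  shows "wh_logarithmic_vvaf (conj_by B G) M k (\<lambda>\<delta>. \<rho> (B ** \<delta> ** sinv B)) (vslash k B Y)"
proof -
  define G' where "G' = conj_by B G"
  define \<rho>' where "\<rho>' = (\<lambda>\<delta>. \<rho> (B ** \<delta> ** sinv B))"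
  have sub: "A \<in> carrier SL2R" if "A \<in> G" for A using subgroup.mem_carrier[OF G that] .
  have G': "subgroup G' SL2R" unfolding G'_def by (rule subgroup_conj[OF G B])
  have \<rho>': "\<rho>' (sinv B ** \<gamma> ** B) = \<rho> \<gamma>" for \<gamma> by (simp add: \<rho>'_def conj_cancel[OF B])
  have log: "logarithmic G M \<rho>" and \<rho>I: "\<rho> I2 = exp (\<i> * of_real pi * of_int k) \<cdot>\<^sub>m \<rho> (- I2)"
    and hol: "holomorphic_vec M Y" and aut: "automorphic G k \<rho> Y"
    and exps: "\<And>c. is_cusp G c \<Longrightarrow> log_expansion G M k \<rho> Y c"
    using Y by (auto simp: wh_logarithmic_vvaf_def)
  have rep: "representation G M \<rho>" and unimod: "unimodular_at_parabolics G \<rho>"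
    using log by (auto simp: logarithmic_def)
  have Yc: "Y \<tau> \<in> carrier_vec M" if "\<tau> \<in> UH" for \<tau> using hol that by (simp add: holomorphic_vec_def)
  have "representation G' M \<rho>'"
    unfolding representation_def
  proof (rule homI)
    fix a assume "a \<in> carrier (SL2R\<lparr>carrier := G'\<rparr>)"
    then obtain \<gamma> where \<gamma>: "\<gamma> \<in> G" "a = sinv B ** \<gamma> ** B" by (auto simp: G'_def)
    have "\<rho> \<in> carrier (SL2R\<lparr>carrier := G\<rparr>) \<rightarrow> carrier (GL M)"
      using rep unfolding representation_def hom_def by blast
    then show "\<rho>' a \<in> carrier (GL M)" using \<gamma> by (auto simp: \<rho>')
    fix b assume "b \<in> carrier (SL2R\<lparr>carrier := G'\<rparr>)"
    then obtain \<delta> where \<delta>: "\<delta> \<in> G" "b = sinv B ** \<delta> ** B" by (auto simp: G'_def)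
    have "a ** b = sinv B ** (\<gamma> ** \<delta>) ** B"
      using \<gamma>(2) \<delta>(2) B by (simp add: matrix_mul_assoc[symmetric])
    then show "\<rho>' (a \<otimes>\<^bsub>SL2R\<lparr>carrier := G'\<rparr>\<^esub> b) = \<rho>' a \<otimes>\<^bsub>GL M\<^esub> \<rho>' b"
      using representation_facts(2)[OF G rep \<gamma>(1) \<delta>(1)] by (simp add: \<rho>' \<gamma>(2) \<delta>(2) GL_simps)
  qed
  moreover have "unimodular_at_parabolics G' \<rho>'"
    using unimod B unfolding unimodular_at_parabolics_def G'_def by (auto simp: \<rho>')
  moreover have "\<not> (\<forall>\<gamma>\<in>G'. parabolic \<gamma> \<longrightarrow> diagonalizable (\<rho>' \<gamma>))"
    using log B unfolding logarithmic_def G'_def by (auto simp: \<rho>')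
  ultimately have "logarithmic G' M \<rho>'" by (simp add: logarithmic_def)
  moreover have "\<rho>' I2 = exp (\<i> * of_real pi * of_int k) \<cdot>\<^sub>m \<rho>' (- I2)"
    using \<rho>I B by (simp add: \<rho>'_def)
  moreover have "holomorphic_vec M (vslash k B Y)"
    unfolding holomorphic_vec_def
  proof (intro conjI ballI allI impI)
    show "vslash k B Y \<tau> \<in> carrier_vec M" if "\<tau> \<in> UH" for \<tau>
      using Yc[of "mob B \<tau>"] B that by (simp add: vslash_def)
    fix r assume r: "r < M"
    have "slash k B (\<lambda>\<tau>. vec_index (Y \<tau>) r) holomorphic_on UH"
      using hol r by (intro slash_holomorphic B) (auto simp: holomorphic_vec_def)
    then show "(\<lambda>\<tau>. vec_index (vslash k B Y \<tau>) r) holomorphic_on UH"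
    proof (rule holomorphic_transform)
      fix \<tau> assume "\<tau> \<in> UH"
      then show "slash k B (\<lambda>\<tau>. vec_index (Y \<tau>) r) \<tau> = vec_index (vslash k B Y \<tau>) r"
        using Yc[of "mob B \<tau>"] B r by (auto simp: vslash_def slash_def)
    qed
  qed
  moreover have "automorphic G' k \<rho>' (vslash k B Y)"
    unfolding automorphic_def G'_def
  proof (safe)
    fix \<gamma> \<tau> assume \<gamma>: "\<gamma> \<in> G" and \<tau>: "\<tau> \<in> UH"
    note \<gamma>S = sub[OF \<gamma>]
    have UH: "mob B \<tau> \<in> UH" using B \<tau> by simp
    have "vslash k (sinv B ** \<gamma> ** B) (vslash k B Y) \<tau> = vslash k (B ** (sinv B ** \<gamma> ** B)) Y \<tau>"
      using B \<gamma>S \<tau> by (intro vslash_mult[symmetric]) auto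
    also have "B ** (sinv B ** \<gamma> ** B) = \<gamma> ** B" using B by (simp add: matrix_mul_assoc)
    also have "vslash k (\<gamma> ** B) Y \<tau> = vslash k B (vslash k \<gamma> Y) \<tau>" by (rule vslash_mult[OF \<gamma>S B \<tau>])
    also have "\<dots> = vslash k B (\<lambda>\<tau>. \<rho> \<gamma> *\<^sub>v Y \<tau>) \<tau>"
      using aut \<gamma> B \<tau> by (intro vslash_vslash_eq) (auto simp: automorphic_def)
    also have "\<dots> = \<rho> \<gamma> *\<^sub>v vslash k B Y \<tau>"
      by (rule mult_mat_vslash[where X = Y, OF representation_facts(1)[OF G rep \<gamma>] Yc[OF UH], symmetric])
    finally show "vslash k (sinv B ** \<gamma> ** B) (vslash k B Y) \<tau> = \<rho>' (sinv B ** \<gamma> ** B) *\<^sub>v vslash k B Y \<tau>"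
      by (simp add: \<rho>')
  qed
  moreover have "log_expansion G' M k \<rho>' (vslash k B Y) c" if c: "is_cusp G' c" for c
  proof -
    define c' where "c' = act B c"
    have c': "is_cusp G c'"
      using c is_cusp_conj[OF B subgroup.subset[OF G]] by (simp add: G'_def c'_def)
    obtain h where h: "cuspidal G c' h" using cuspidal_exists[OF G neg disc c'] by blast
    have hpos: "h > 0" using h by (simp add: cuspidal_def)
    obtain \<alpha> \<beta> where U: "\<alpha> \<noteq> 0" "B ** A_cusp c = A_cusp c' ** mat22 \<alpha> \<beta> 0 (1 / \<alpha>)"
      using act_eq_obtain[OF B c'_def[symmetric]] .
    have h': "cuspidal G' c (h / \<alpha>\<^sup>2)"
      unfolding G'_def by (rule cuspidal_conj[OF B U subgroup.subset[OF G] c'_def[symmetric] h])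
    have h'pos: "h / \<alpha>\<^sup>2 > 0" using hpos U(1) by simp
    have "B ** (- I2) ** sinv B = - I2" using B by simp
    then have neg': "- I2 \<in> G'" using neg unfolding G'_def by (subst conj_mem_iff[OF B]) auto
    \<comment> \<open>The generators at c and B c correspond under conjugation by B, so the two
      matrices are equal and the same Jordan form can be used.\<close>
    have "\<rho>' (t_cusp G' c) = \<rho> (t_cusp G c')"
      using transl_conj[OF U B, of "h / \<alpha>\<^sup>2"] U(1)
      by (simp add: \<rho>'_def t_cusp_cuspidal[OF G' neg' h'] t_cusp_cuspidal[OF G neg h])
    moreover obtain bs where bs: "jordan_nf (\<rho> (t_cusp G c')) bs"
      and ser: "\<And>r. r < M \<Longrightarrow> log_series bs (\<lambda>z. slash k (A_cusp c') (\<lambda>\<tau>. vec_index (Y \<tau>) r) (log_arg h z))"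
      using exps[OF c'] log_expansion_iff[OF cusp_width_cuspidal[OF G neg h] hpos Yc] by auto
    have "transl c' (of_int 1 * h) \<in> G" using h unfolding cuspidal_def by blast
    then have tG: "t_cusp G c' \<in> G" "parabolic (t_cusp G c')" by (auto simp: t_cusp_cuspidal[OF G neg h])
    have unit: "cmod l = 1" if "(s, l) \<in> set bs" for s l
      using jordan_nf_eigenvalue[OF representation_facts(1)[OF G rep tG(1)] bs that] unimod tG
      unfolding unimodular_at_parabolics_def by auto
    have "log_series bs (\<lambda>z. slash k (A_cusp c) (\<lambda>\<tau>. vec_index (vslash k B Y \<tau>) r) (log_arg (h / \<alpha>\<^sup>2) z))"
      if r: "r < M" for r
    proof (rule log_series_cong)
      show "log_series bs (\<lambda>z. slash k (A_cusp c) (slash k B (\<lambda>\<tau>. vec_index (Y \<tau>) r)) (log_arg (h / \<alpha>\<^sup>2) z))"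
      \<comment> \<open>With N = 1 only i = 0 occurs, and the required eigenvalue is
        \<open>l\<close> itself, so the blocks do not change.\<close>
      proof (rule log_series_slash_transfer[OF B U h'pos hpos, of 1, OF _ ser[OF r] unit])
        fix s l i assume "(s, l) \<in> set bs" "i < (1::nat)"
        then show "\<exists>s'\<ge>s. (s', exp (2 * of_real pi * \<i> * of_real ((mu l + of_nat i) / of_nat 1))) \<in> set bs"
          using mu_cis(3)[OF unit] by auto
      qed (use U in auto)
      fix z :: complex assume "Re z < 0"
      then have "mob B (mob (A_cusp c) (log_arg (h / \<alpha>\<^sup>2) z)) \<in> UH" using h'pos B by simp
      then have "Y (mob B (mob (A_cusp c) (log_arg (h / \<alpha>\<^sup>2) z))) \<in> carrier_vec M" by (rule Yc)
      then show "slash k (A_cusp c) (slash k B (\<lambda>\<tau>. vec_index (Y \<tau>) r)) (log_arg (h / \<alpha>\<^sup>2) z) =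
          slash k (A_cusp c) (\<lambda>\<tau>. vec_index (vslash k B Y \<tau>) r) (log_arg (h / \<alpha>\<^sup>2) z)"
        using r by (simp add: slash_def vslash_def)
    qed
    moreover have "vslash k B Y \<tau> \<in> carrier_vec M" if "\<tau> \<in> UH" for \<tau>
      using Yc[of "mob B \<tau>"] B that by (simp add: vslash_def)
    ultimately show ?thesis
      using log_expansion_iff[OF cusp_width_cuspidal[OF G' neg' h'] h'pos, of "vslash k B Y" M k \<rho>'] bs by auto
  qed
  ultimately show ?thesis
    unfolding wh_logarithmic_vvaf_def G'_def[symmetric] \<rho>'_def[symmetric] by blast
qed

section \<open>Coset representatives attached to a cusp\<close>

lemma distinct_concat_map_upt:
  assumes "\<And>i j i' j'. i < n \<Longrightarrow> i' < n \<Longrightarrow> j < N i \<Longrightarrow> j' < N i' \<Longrightarrow> f i j = f i' j' \<Longrightarrow> i = i' \<and> j = j'"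
  shows "distinct (concat (map (\<lambda>i. map (f i) [0..<N i]) [0..<n]))"
  using assms
proof (induction n)
  case (Suc n)
  have "distinct (concat (map (\<lambda>i. map (f i) [0..<N i]) [0..<n]))"
    by (rule Suc.IH, rule Suc.prems) auto
  moreover have "inj_on (f n) {..<N n}"
    by (rule inj_onI) (use Suc.prems[of n n] in auto)
  moreover have "f n j' \<noteq> f i j" if "i < n" "j < N i" "j' < N n" for i j j'
    using Suc.prems[of n i j' j] that by auto
  ultimately show ?case by (auto simp: distinct_map inj_on_def)
qed simp

text \<open>A coset \<gamma> H determines the \<open>H\<close>-orbit of \<gamma>^-1 c, which singles
  out the index i. Within this orbit the cosets differ by the stabilizer of c, generated up to sign
  by t_c, and the coset of t_c^j A_i^-1 depends exactly on j modulo the ratio of the widths of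
  \<open>H\<close> and \<open>G\<close> at c_i.\<close>

lemma left_coset_reps_cusp_coset_reps:
  assumes G: "subgroup G SL2R" and H: "subgroup H SL2R" and HG: "H \<subseteq> G" and neg: "- I2 \<in> H"
    and discG: "discrete_subgroup (psl ` G)" and discH: "discrete_subgroup (psl ` H)"
    and c: "is_cusp G c" and dec: "cusp_decomposition G H c n cs"
    and A: "\<And>i. i < n \<Longrightarrow> A i \<in> G" "\<And>i. i < n \<Longrightarrow> act (A i) c = cs i"
  shows "left_coset_reps G H (cusp_coset_reps G H c n cs A)"
proof -
  have sub: "B \<in> carrier SL2R" if "B \<in> G" for B using subgroup.mem_carrier[OF G that] .
  have mulG: "B ** C \<in> G" if "B \<in> G" "C \<in> G" for B C using subgroup.m_closed[OF G that] by simp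
  have mulH: "B ** C \<in> H" if "B \<in> H" "C \<in> H" for B C using subgroup.m_closed[OF H that] by simp
  have invG: "sinv B \<in> G" if "B \<in> G" for B using subgroup.m_inv_closed[OF G that] by simp
  have invH: "sinv B \<in> H" if "B \<in> H" for B using subgroup.m_inv_closed[OF H that] by simp
  have negG: "- I2 \<in> G" using neg HG by blast
  obtain h where h: "cuspidal G c h" using cuspidal_exists[OF G negG discG c] by blast
  have hpos: "h > 0" using h by (simp add: cuspidal_def)
  have tr: "transl c (of_int i * h) \<in> G" for i using h unfolding cuspidal_def by blast
  have cuspH: "is_cusp H (cs i)" if "i < n" for i using dec that by (simp add: cusp_decomposition_def)
  \<comment> \<open>As \<open>A i\<close> lies in \<open>G\<close>, conjugation by it preserves
    \<open>G\<close> and matches the width h at c with w = alpha^2 h at c_i. The generator of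
    \<open>H\<close> at c_i lies in \<open>G\<close>, so its length is a multiple N of w.\<close>
  have "\<exists>w N. cuspidal G (cs i) w \<and> cuspidal H (cs i) (of_nat N * w) \<and>
      (\<forall>x. A i ** transl c (x * h) ** sinv (A i) = transl (cs i) (x * w))" if i: "i < n" for i
  proof -
    note AS = sub[OF A(1)[OF i]]
    obtain \<alpha> \<beta> where U: "\<alpha> \<noteq> 0" "A i ** A_cusp c = A_cusp (cs i) ** mat22 \<alpha> \<beta> 0 (1 / \<alpha>)"
      using act_eq_obtain[OF AS A(2)[OF i]] .
    obtain w where w: "cuspidal G (cs i) w"
      using cuspidal_exists[OF G negG discG is_cusp_mono[OF HG cuspH[OF i]]] by blast
    have "cuspidal G c (w / \<alpha>\<^sup>2)"
      using cuspidal_conj[OF AS U subgroup.subset[OF G] A(2)[OF i] w] by (simp add: conj_self[OF G A(1)[OF i]])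
    then have "h = w / \<alpha>\<^sup>2" by (rule cuspidal_unique[OF G negG h])
    then have wh: "w = \<alpha>\<^sup>2 * h" using U(1) by simp
    obtain h' where h': "cuspidal H (cs i) h'" using cuspidal_exists[OF H neg discH cuspH[OF i]] by blast
    have "transl (cs i) (of_int 1 * h') \<in> H" using h' unfolding cuspidal_def by blast
    then have "transl (cs i) h' \<in> G" using HG by auto
    then obtain k :: int where k: "h' = of_int k * w" using w unfolding cuspidal_def by blast
    have "k > 0" using k w h' unfolding cuspidal_def by (metis of_int_0_less_iff zero_less_mult_pos2)
    then have "h' = of_nat (nat k) * w" using k by simp
    then show ?thesis using w h' transl_conj[OF U AS] wh
      by (intro exI[of _ w] exI[of _ "nat k"]) (auto simp: mult_ac)
  qed
  then obtain w N where wN: "\<And>i. i < n \<Longrightarrow> cuspidal G (cs i) (w i)" "\<And>i. i < n \<Longrightarrow> cuspidal H (cs i) (of_nat (N i) * w i)"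
    "\<And>i x. i < n \<Longrightarrow> A i ** transl c (x * h) ** sinv (A i) = transl (cs i) (x * w i)" by metis
  have wpos: "w i > 0" if "i < n" for i using wN(1)[OF that] by (simp add: cuspidal_def)
  have Npos: "N i > 0" if "i < n" for i
    using wN(2)[OF that] wpos[OF that] by (auto simp: cuspidal_def zero_less_mult_iff)
  have memH: "transl (cs i) (of_int k * w i) \<in> H \<longleftrightarrow> int (N i) dvd k" if i: "i < n" for i k
  proof -
    have "transl (cs i) (of_int k * w i) \<in> H \<longleftrightarrow> (\<exists>l::int. of_int k * w i = of_int l * (of_nat (N i) * w i))"
      using wN(2)[OF i] by (simp add: cuspidal_def)
    also have "\<dots> \<longleftrightarrow> (\<exists>l::int. (of_int k :: real) = of_int (l * int (N i)))"
      using wpos[OF i] by (simp flip: mult.assoc)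
    also have "\<dots> \<longleftrightarrow> int (N i) dvd k" by (simp only: of_int_eq_iff dvd_def mult.commute)
    finally show ?thesis .
  qed
  define g where "g i j = transl c (of_nat j * h) ** sinv (A i)" for i j
  have gG: "g i j \<in> G" if "i < n" for i j
    using tr[of "int j"] A(1)[OF that] by (simp add: g_def mulG invG)
  have gs: "cusp_coset_reps G H c n cs A = concat (map (\<lambda>i. map (g i) [0..<N i]) [0..<n])"
    unfolding cusp_coset_reps_def
    by (intro arg_cong[of _ _ concat] map_cong refl)
      (simp_all add: card_rcosets_stab[OF G negG wN(1) H neg wN(2)] t_cusp_cuspidal[OF G negG h] transl_pow g_def)
  have gprod: "sinv (g i j) ** C = A i ** (transl c (- of_nat j * h) ** C)"
    if "i < n" for i j and C :: mat2
    using sub[OF A(1)[OF that]] by (simp add: g_def sinv_mult transl_uminus matrix_mul_assoc)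
  define cos where "cos B = B <#\<^bsub>SL2R\<^esub> H" for B
  have cos: "cos B = cos C \<longleftrightarrow> sinv B ** C \<in> H" if "B \<in> G" "C \<in> G" for B C
    unfolding cos_def by (rule l_coset_eq_iff[OF H sub[OF that(1)] sub[OF that(2)]])
  have inj: "i = i' \<and> j = j'" if ij: "i < n" "i' < n" "j < N i" "j' < N i'" and eq: "cos (g i j) = cos (g i' j')" for i j i' j'
  proof -
    have "transl c (- of_nat j * h) ** (transl c (of_nat j' * h) ** sinv (A i'))
        = transl c ((of_nat j' - of_nat j) * h) ** sinv (A i')"
      by (simp add: matrix_mul_assoc transl_add algebra_simps)
    \<comment> \<open>This element of \<open>H\<close> sends c_i' to c_i. Inequivalence of the
      chosen cusps gives i' = i, and then it is a translation at c_i, so N_i divides j' - j.\<close>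
    then have E: "A i ** transl c ((of_nat j' - of_nat j) * h) ** sinv (A i') \<in> H"
      using eq cos[OF gG gG] gprod[OF ij(1), of j "g i' j'"] ij by (simp add: g_def matrix_mul_assoc)
    have "act (A i ** transl c ((of_nat j' - of_nat j) * h) ** sinv (A i')) (cs i') = cs i"
      using ij A(2)[of i'] A(2)[of i] sub[OF A(1)[of i]] sub[OF A(1)[of i']]
      by (simp add: act_mult) (metis act_sinv(1) transl_act)
    then have "cs i \<in> orb H (cs i')" using E unfolding orb_def by (metis imageI)
    then have ii: "i' = i" using dec ij unfolding cusp_decomposition_def by blast
    then have "transl (cs i) ((of_nat j' - of_nat j) * w i) \<in> H"
      using E wN(3)[OF ij(1)] by simp
    then have "int (N i) dvd int j' - int j" using memH[OF ij(1), of "int j' - int j"] by simp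
    then have "int j' mod int (N i) = int j mod int (N i)" by (simp add: mod_eq_dvd_iff)
    then have "j' = j" using ij ii by simp
    then show ?thesis using ii by simp
  qed
  have surj: "\<exists>i<n. \<exists>j<N i. cos \<gamma> = cos (g i j)" if \<gamma>: "\<gamma> \<in> G" for \<gamma>
  proof -
    have "act (sinv \<gamma>) c \<in> orb G c" using invG[OF \<gamma>] by (auto simp: orb_def)
    then obtain i where i: "i < n" "act (sinv \<gamma>) c \<in> orb H (cs i)" using dec by (auto simp: cusp_decomposition_def)
    then obtain \<eta> where \<eta>: "\<eta> \<in> H" "act (sinv \<gamma>) c = act \<eta> (cs i)" by (auto simp: orb_def)
    have \<eta>G: "\<eta> \<in> G" using \<eta> HG by blast
    note S = sub[OF \<gamma>] sub[OF \<eta>G] sub[OF A(1)[OF i(1)]]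
    \<comment> \<open>\<eta> is chosen so that \<delta> fixes c; hence \<delta> is a power of t_c up
      to sign.\<close>
    define \<delta> where "\<delta> = \<gamma> ** (\<eta> ** A i)"
    have \<delta>G: "\<delta> \<in> G" unfolding \<delta>_def by (intro mulG \<gamma> \<eta>G A(1) i)
    have "act \<delta> c = act \<gamma> (act (sinv \<gamma>) c)"
      unfolding \<eta>(2) \<delta>_def using S A(2)[OF i(1)] by (simp add: act_mult)
    then have "act \<delta> c = c" using S by simp
    then obtain x where x: "\<delta> = transl c x \<or> \<delta> = - transl c x" using h \<delta>G unfolding cuspidal_def by blast
    then have "transl c x \<in> G" using \<delta>G subgroup_neg_mem[OF G negG] by auto
    then obtain k :: int where k: "x = of_int k * h" using h unfolding cuspidal_def by blast
    \<comment> \<open>Reducing the exponent modulo N_i changes the element by a translation at c_i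
      that lies in \<open>H\<close>, so the coset is not affected.\<close>
    define j where "j = nat (k mod int (N i))"
    have jN: "int j = k mod int (N i)" using Npos[OF i(1)] by (simp add: j_def)
    have j: "j < N i" using Npos[OF i(1)] by (simp add: j_def nat_less_iff)
    have "\<gamma> = \<delta> ** sinv (A i) ** sinv \<eta>" using S by (simp add: \<delta>_def matrix_mul_assoc[symmetric])
    then have "sinv (g i j) ** \<gamma> = A i ** (transl c (- of_nat j * h) ** \<delta>) ** sinv (A i) ** sinv \<eta>"
      using gprod[OF i(1), of j \<gamma>] by (simp add: matrix_mul_assoc)
    moreover have "transl c (- of_nat j * h) ** transl c x = transl c (of_int (k - int j) * h)"
      unfolding k transl_add by (simp add: algebra_simps)
    ultimately have "sinv (g i j) ** \<gamma> = transl (cs i) (of_int (k - int j) * w i) ** sinv \<eta> \<or>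
        sinv (g i j) ** \<gamma> = - (transl (cs i) (of_int (k - int j) * w i) ** sinv \<eta>)"
      using x wN(3)[OF i(1), of "of_int (k - int j)"] by auto
    moreover have "transl (cs i) (of_int (k - int j) * w i) \<in> H"
      unfolding memH[OF i(1)] jN by (simp add: dvd_minus_mod)
    then have "transl (cs i) (of_int (k - int j) * w i) ** sinv \<eta> \<in> H"
      by (rule mulH[OF _ invH[OF \<eta>(1)]])
    \<comment> \<open>The undetermined sign is harmless because \<open>- I2\<close> belongs to
      \<open>H\<close>.\<close>
    ultimately have "sinv (g i j) ** \<gamma> \<in> H" by (metis subgroup_neg_mem[OF H neg])
    then have "cos (g i j) = cos \<gamma>" using cos[OF gG[OF i(1)] \<gamma>] by simp
    then show ?thesis using i j by metis
  qed
  define gl where "gl = concat (map (\<lambda>i. map (g i) [0..<N i]) [0..<n])"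
  have map: "map cos gl = concat (map (\<lambda>i. map (\<lambda>j. cos (g i j)) [0..<N i]) [0..<n])"
    by (simp add: gl_def map_concat o_def)
  have "distinct (map cos gl)" unfolding map by (rule distinct_concat_map_upt) (rule inj)
  moreover have "set (map cos gl) = cos ` G"
    unfolding map using surj gG by (fastforce simp: image_iff)
  ultimately have "bij_betw ((!) (map cos gl)) {..<length gl} (cos ` G)"
    by (intro bij_betw_nth) auto
  then have "bij_betw (\<lambda>a. cos (gl ! a)) {..<length gl} (cos ` G)"
    by (rule bij_betw_cong[THEN iffD1, rotated]) simp
  moreover have "set gl \<subseteq> G" using gG by (auto simp: gl_def)
  ultimately show ?thesis
    unfolding gs gl_def[symmetric] left_coset_reps_def cos_def by blast
qed

section \<open>Failure of diagonalizability\<close>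

lemma (in induced_representation) diagonalizable_R_conj:
  assumes "B \<in> G" "\<gamma> \<in> G" "diagonalizable (R (sinv B ** \<gamma> ** B))"
  shows "diagonalizable (R \<gamma>)"
proof (rule diagonalizable_similar[OF _ assms(3)])
  show "similar_mat (R \<gamma>) (R (sinv B ** \<gamma> ** B))"
  proof (rule similar_matI)
    show "{R \<gamma>, R (sinv B ** \<gamma> ** B), R B, R (sinv B)} \<subseteq> carrier_mat (d * m) (d * m)" by simp
    show "R B * R (sinv B) = 1\<^sub>m (d * m)" "R (sinv B) * R B = 1\<^sub>m (d * m)"
      using assms by (simp_all add: R_one flip: R_mult)
    have "R B * R (sinv B ** \<gamma> ** B) * R (sinv B) = R (B ** (sinv B ** \<gamma> ** B) ** sinv B)"
      using assms by (simp add: R_mult)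
    then show "R \<gamma> = R B * R (sinv B ** \<gamma> ** B) * R (sinv B)"
      using assms by (simp add: conj_cancel)
  qed
qed

text \<open>Stated for every element of \<open>H\<close> fixing a cusp \<open>G\<close>-equivalent
  to c, not only for generators of the stabilizer: fixing the point already makes its conjugate at c
  a power of t_c up to sign.\<close>

lemma (in induced_representation) diagonalizable_at_cusp:
  assumes neg: "- I2 \<in> H" and disc: "discrete_subgroup (psl ` G)" and c: "is_cusp G c"
    and diag: "diagonalizable (R (t_cusp G c))" and B: "B \<in> G"
    and t: "t \<in> H" "act t (act B c) = act B c"
  shows "diagonalizable (\<rho> t)"
proof -
  have negG: "- I2 \<in> G" using neg by simp
  obtain h where h: "cuspidal G c h" using cuspidal_exists[OF G negG disc c] by blast
  have "transl c (of_int 1 * h) \<in> G" using h unfolding cuspidal_def by blast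
  then have tG: "transl c h \<in> G" by simp
  define s where "s = sinv B ** t ** B"
  have sG: "s \<in> G" using B t by (simp add: s_def)
  have "act s c = c" using B t by (simp add: s_def act_mult)
  then obtain x where x: "s = transl c x \<or> s = - transl c x" using h sG unfolding cuspidal_def by blast
  then have "transl c x \<in> G" using sG subgroup_neg_mem[OF G negG] by auto
  then obtain k :: int where k: "x = of_int k * h" using h unfolding cuspidal_def by blast
  \<comment> \<open>Both signs give the same square, a genuine power of t_c.\<close>
  have ss: "s ** s = transl c (of_int (2 * k) * h)" using x by (auto simp: transl_add k algebra_simps)
  have pow: "diagonalizable (R (transl c (of_nat n * h)))" for n
  proof -
    have "R (transl c (of_nat n * h)) = R (transl c h) ^\<^sub>m n"
      using R_pow[OF tG, of n] by (simp add: transl_pow)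
    then show ?thesis
      using diagonalizable_pow[OF diag] by (simp add: t_cusp_cuspidal[OF G negG h])
  qed
  have "diagonalizable (R (s ** s))"
  \<comment> \<open>The conjugate of t may be a negative power of t_c; then the inverse of its
    square is the nonnegative power to which \<open>pow\<close> applies.\<close>
  proof (cases "k \<ge> 0")
    case True
    then show ?thesis using pow[of "nat (2 * k)"] by (simp add: ss)
  next
    case False
    have "R (sinv (s ** s)) * R (s ** s) = 1\<^sub>m (d * m)"
      using sG by (simp add: R_one flip: R_mult)
    moreover have "diagonalizable (R (sinv (s ** s)))"
      using False pow[of "nat (- (2 * k))"] by (simp add: ss transl_uminus)
    ultimately show ?thesis by (rule diagonalizable_inverse[OF R_carrier R_carrier])
  qed
  then have "diagonalizable (R s * R s)" using sG by (simp add: R_mult)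
  moreover have "R (sinv s) * R s = 1\<^sub>m (d * m)" using sG by (simp add: R_one flip: R_mult)
  ultimately have "diagonalizable (R s)" by (rule diagonalizable_of_square[OF R_carrier R_carrier, rotated])
  then have "diagonalizable (R t)" unfolding s_def using B t by (intro diagonalizable_R_conj[of B t]) auto
  then show ?thesis by (rule diagonalizable_R_imp[OF t(1)])
qed

theorem theorem1p2:
  fixes G H :: "mat2 set" and m :: nat and k :: int
    and \<rho> :: "mat2 \<Rightarrow> complex Matrix.mat" and X :: "complex \<Rightarrow> complex Matrix.vec"
  assumes "subgroup G SL2R" and "subgroup H SL2R" and "H \<subseteq> G"
    and "finite (rcosets\<^bsub>SL2R\<lparr>carrier := G\<rparr>\<^esub> H)"
    and "- I2 \<in> H"
    and "fuchsian_first_kind (psl ` G)" and "fuchsian_first_kind (psl ` H)"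
    and "representation H m \<rho>"
    and "wh_vvaf H m k \<rho> X"
  shows
    "(\<forall>c n cs t gs.
        is_cusp G c \<longrightarrow> cusp_decomposition G H c n cs \<longrightarrow>
        (\<forall>i<n. t i \<in> H \<and> act (t i) (cs i) = cs i \<and>
               generate PSL2R {psl (t i)} = stab H (cs i)) \<longrightarrow>
        left_coset_reps G H gs \<longrightarrow>
        (\<exists>i<n. \<not> diagonalizable (\<rho> (t i))) \<longrightarrow>
        \<not> diagonalizable (induced H m \<rho> gs (t_cusp G c)))
   \<and> (wh_logarithmic_vvaf H m k \<rho> X \<longrightarrow>
      (\<forall>c n cs A gs c0 w \<Delta> L.
        is_cusp G c \<longrightarrow> (is_cusp G Infty \<longrightarrow> c = Infty) \<longrightarrow>
        cusp_decomposition G H c n cs \<longrightarrow>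
        (\<forall>i<n. A i \<in> G \<and> act (A i) c = cs i) \<longrightarrow>
        gs = cusp_coset_reps G H c n cs A \<longrightarrow>
        Delta_form G c0 w \<Delta> \<longrightarrow> is_log_of L \<Delta> \<longrightarrow>
        (\<exists>u. multiplier G k (Delta_power L (of_int k / of_int w)) u \<and>
          (is_cusp G Infty \<longrightarrow>
             wh_logarithmic_vvaf G (length gs * m) k
               (rescaled_induced u H m \<rho> gs)
               (cusp_lift m k w L gs X)) \<and>
          (\<not> is_cusp G Infty \<longrightarrow>
             wh_logarithmic_vvaf
               ((\<lambda>\<gamma>. inv\<^bsub>SL2R\<^esub> (A_cusp c) ** \<gamma> ** A_cusp c) ` G) (length gs * m) k
               (\<lambda>\<delta>. rescaled_induced u H m \<rho> gs (A_cusp c ** \<delta> ** inv\<^bsub>SL2R\<^esub> (A_cusp c)))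
               (vslash k (A_cusp c) (cusp_lift m k w L gs X))))))"
proof -
  note G = assms(1) and H = assms(2) and HG = assms(3) and neg = assms(5) and rep = assms(8)
  have discG: "discrete_subgroup (psl ` G)" and discH: "discrete_subgroup (psl ` H)"
    using assms(6,7) by (auto simp: fuchsian_first_kind_def)
  have negG: "- I2 \<in> G" using neg HG by blast
  show ?thesis
  proof (intro conjI allI impI, goal_cases)
    case (1 c n cs t gs)
    show ?case
    proof
      assume diag: "diagonalizable (induced H m \<rho> gs (t_cusp G c))"
      \<comment> \<open>With unit scaling \<open>R\<close> is the induced representation itself, by
        \<open>rescaled_induced_one\<close>; the choice of representatives is arbitrary
        here.\<close>
      interpret induced_representation G H m \<rho> gs "\<lambda>_. 1"
        by (rule induced_representation.intro[OF G H HG rep 1(4)]) simp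
      obtain i where i: "i < n" "\<not> diagonalizable (\<rho> (t i))" using 1(5) by blast
      \<comment> \<open>Each c_i lies in its own \<open>H\<close>-orbit, hence in the
        \<open>G\<close>-orbit of c; this supplies the element B carrying c to c_i.\<close>
      have "cs i \<in> orb H (cs i)"
        using subgroup.one_closed[OF H] unfolding orb_def by (intro image_eqI[of _ _ I2]) auto
      then have "cs i \<in> orb G c" using 1(2) i(1) by (auto simp: cusp_decomposition_def)
      then obtain B where B: "B \<in> G" "cs i = act B c" by (auto simp: orb_def)
      have "diagonalizable (\<rho> (t i))"
        by (rule diagonalizable_at_cusp[OF neg discG 1(1) _ B(1)])
          (use diag 1(3) i(1) B(2) in \<open>auto simp: rescaled_induced_one\<close>)
      then show False using i(2) by blast
    qed
  next
    case (2 c n cs A gs c0 w \<Delta> L)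
    have reps: "left_coset_reps G H gs"
      unfolding 2(6) using 2(5)
      by (intro left_coset_reps_cusp_coset_reps G H HG neg discG discH 2(2,4)) auto
    obtain \<nu> where \<nu>: "wh_admissible_vvaf G 1 w \<nu> (\<lambda>\<tau>. Matrix.vec 1 (\<lambda>_. \<Delta> \<tau>))" and w: "w \<noteq> 0"
      using 2(7) by (auto simp: Delta_form_def)
    obtain u where u: "multiplier G k (Delta_power L (of_int k / of_int w)) u"
      using multiplier_exists[OF G w 2(8)] \<nu> unfolding wh_admissible_vvaf_def admissible_def by blast
    have gsG: "gs ! a \<in> G" if "a < length gs" for a
      using reps that by (auto simp: left_coset_reps_def)
    interpret induced_representation G H m \<rho> gs u
      by (rule induced_representation.intro[OF G H HG rep reps]) (use u gsG in \<open>auto simp: multiplier_def\<close>)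
    have hol: "holomorphic_vec m X" "automorphic H k \<rho> X"
      using 2(1) by (auto simp: wh_logarithmic_vvaf_def)
    note lift = wh_logarithmic_lift[OF hol u neg discG discH 2(1)]
    \<comment> \<open>The conjugated statement holds for the cusp c in either case, so it is proved
      alongside the direct one and the case distinction on infinity only selects between
      them.\<close>
    show ?case
      using u lift wh_logarithmic_conj[OF G negG discG A_cusp_SL2R lift, of c] by blast
  qed
qed

end
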